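(* Let $M$ be an $n$-dimensional smooth real manifold, $p: Z \to M$ a torus bundle with fibers real $n$-tori and zero section $s$, and let $\mathcal{J}$ be a semi-flat generalized almost complex structure on $Z$, arising from the adapted generalized almost complex structure $\underline{\mathcal{J}}$ on the vector bundle $s^*T_{Z/M}\oplus T_M$ over $M$. Let $\mathcal{S}$ be the sheaf of flat sections of $s^*T_{Z/M}$ (and $\mathcal{S}^\vee$ the sheaf of flat sections of $s^*T_{Z/M}^\vee$ for the dual connection). Then $\mathcal{J}$ is integrable if and only if $$\bigl[\underline{\mathcal{J}}(\mathcal{S}\oplus\mathcal{S}^\vee),\ \underline{\mathcal{J}}(\mathcal{S}\oplus\mathcal{S}^\vee)\bigr]=0,$$ i.e. the Courant bracket (on $T_M\oplus T_M^\vee$) of any two local sections of the sheaf $\underline{\mathcal{J}}(\mathcal{S}\oplus\mathcal{S}^\vee)\subseteq T_M\oplus T_M^\vee$ vanishes.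
   Context: Generalized almost complex structures. On $W\oplus W^\vee$ ($W$ a real vector bundle) use the pairing $\langle v+f,w+g\rangle=-\tfrac12(f(w)+g(v))$. A generalized almost complex structure on $W$ is an automorphism $\mathcal{J}$ of $W\oplus W^\vee$ which is orthogonal for this pairing and satisfies $\mathcal{J}^2=-1$. A generalized almost complex structure on a manifold $N$ is one on $W=T_N$. The Courant bracket is $[X+\xi,Y+\eta]=[X,Y]+\mathcal{L}_X\eta-\mathcal{L}_Y\xi+\tfrac12 d(\iota_Y\xi-\iota_X\eta)$. A generalized almost complex structure on $N$ is integrable if the sheaf of sections of its $(+i)$-eigenbundle $E\subseteq(T_N\oplus T_N^\vee)\otimes\mathbb{C}$ is closed under the ($\mathbb{C}$-bilinearly extended) Courant bracket. Torus bundles. $p:Z\to M$ is a smooth fiber bundle with fiber an $n$-torus and a global section $s$; its structure group is taken to be reduced to $GL(n,\mathbb{Z})$, so $Z$ is a bundle of Lie groups with zero section $s$. Put $V=s^*T_{Z/M}$, a rank $n$ vector bundle; translation along the fibers gives $T_{Z/M}\cong p^*V$. There is a bundle of lattices $\Lambda\subset \mathrm{tot}(V)$ with $Z\cong \mathrm{tot}(V)/\Lambda$, and $V$ carries the flat connection $\nabla$ for which local sections of $\Lambda$ are flat. On $X=\mathrm{tot}(V)\xrightarrow{\pi}M$, with tautological section $S$ of $\pi^*V$, the map $D=(\pi^*\nabla)(S):T_X\to\pi^*V$ splits the sequence $0\to\pi^*V\to T_X\to\pi^*T_M\to0$; it is invariant under translation by $\Lambda$, so it descends to a splitting of $0\to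 p^*V\xrightarrow{j}T_Z\xrightarrow{dp}p^*T_M\to0$, again denoted $D:T_Z\to p^*V$ ($D\circ j=1$), with corresponding $\alpha:p^*T_M\to T_Z$ ($dp\circ\alpha=1$, $D\circ\alpha=0$). Let $$F:T_Z\oplus T_Z^\vee\to p^*V\oplus p^*T_M\oplus p^*V^\vee\oplus p^*T_M^\vee,\quad F(w+\xi)=(Dw,\ dp\,w,\ j^\vee\xi,\ \alpha^\vee\xi),$$ which is an isomorphism. Semi-flat. With $\dim M=n$ equal to the fiber dimension, a semi-flat generalized almost complex structure on $Z$ is one of the form $\mathcal{J}=F^{-1}(p^*\underline{\mathcal{J}})F$, where $\underline{\mathcal{J}}$ is a generalized almost complex structure on $V\oplus T_M$ which is adapted: $\underline{\mathcal{J}}(V\oplus V^\vee)=T_M\oplus T_M^\vee$. *)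

theory Defs
  imports "HOL-Analysis.Analysis"
begin

section \<open>Smooth manifolds\<close>

primrec C_k_on :: "nat \<Rightarrow> 'a::euclidean_space set \<Rightarrow> ('a \<Rightarrow> 'b::real_normed_vector) \<Rightarrow> bool" where
  "C_k_on 0 S f \<longleftrightarrow> continuous_on S f"
| "C_k_on (Suc k) S f \<longleftrightarrow>
     (\<forall>x\<in>S. f differentiable (at x)) \<and> (\<forall>v. C_k_on k S (\<lambda>x. frechet_derivative f (at x) v))"

text \<open>Only used for open \<open>S\<close>.\<close>
definition smooth_on :: "'a::euclidean_space set \<Rightarrow> ('a \<Rightarrow> 'b::real_normed_vector) \<Rightarrow> bool" where
  "smooth_on S f \<longleftrightarrow> (\<forall>k. C_k_on k S f)"

text \<open>A chart is a pair \<open>(D, \<phi>)\<close> of its domain and its coordinate map. The points of a manifold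
  are all elements of its (Hausdorff, second countable) type.\<close>

type_synonym ('a, 'e) chart = "'a set \<times> ('a \<Rightarrow> 'e)"

definition smooth_atlas ::
    "('a::{t2_space, second_countable_topology}, 'e::euclidean_space) chart set \<Rightarrow> bool" where
  "smooth_atlas A \<longleftrightarrow>
     (\<Union>(D, \<phi>)\<in>A. D) = UNIV \<and>
     (\<forall>(D, \<phi>)\<in>A. open D \<and> open (\<phi> ` D) \<and> homeomorphism D (\<phi> ` D) \<phi> (inv_into D \<phi>)) \<and>
     (\<forall>(D, \<phi>)\<in>A. \<forall>(D', \<phi>')\<in>A. smooth_on (\<phi> ` (D \<inter> D')) (\<phi>' \<circ> inv_into D \<phi>))"

definition euclidean_atlas :: "('e, 'e::euclidean_space) chart set" where
  "euclidean_atlas = {(UNIV, id)}"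

definition product_atlas ::
    "('a, 'e) chart set \<Rightarrow> ('b, 'f) chart set \<Rightarrow> ('a \<times> 'b, 'e \<times> 'f) chart set" where
  "product_atlas A B = {(D \<times> D', map_prod \<phi> \<phi>') | D \<phi> D' \<phi>'. (D, \<phi>) \<in> A \<and> (D', \<phi>') \<in> B}"

text \<open>Smoothness of a map on an open subset \<open>U\<close> of a manifold.\<close>
definition smooth_map ::
    "('a::topological_space, 'e::euclidean_space) chart set \<Rightarrow>
     ('b::topological_space, 'f::euclidean_space) chart set \<Rightarrow> 'a set \<Rightarrow> ('a \<Rightarrow> 'b) \<Rightarrow> bool" where
  "smooth_map A B U f \<longleftrightarrow> continuous_on U f \<and>
     (\<forall>(D, \<phi>)\<in>A. \<forall>(D', \<phi>')\<in>B. smooth_on (\<phi> ` (D \<inter> U \<inter> f -` D')) (\<phi>' \<circ> f \<circ> inv_into D \<phi>))"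

text \<open>The tangent space at \<open>z\<close> is the model space \<open>'e\<close>: a tangent vector is given by its
  components in a chart chosen at \<open>z\<close>. Everything below transforms from this chart to other
  charts by the differentials of the coordinate maps, so the choice is immaterial.\<close>

definition chart_at :: "('a, 'e) chart set \<Rightarrow> 'a \<Rightarrow> ('a, 'e) chart" where
  "chart_at A z = (SOME c. c \<in> A \<and> z \<in> fst c)"

text \<open>The differential \<open>T\<^sub>z \<rightarrow> T\<^bsub>f z\<^esub>\<close> of \<open>f\<close> at \<open>z\<close>.\<close>
definition differential ::
    "('a, 'e::euclidean_space) chart set \<Rightarrow> ('b, 'f::euclidean_space) chart set \<Rightarrow>
     ('a \<Rightarrow> 'b) \<Rightarrow> 'a \<Rightarrow> 'e \<Rightarrow> 'f" where
  "differential A B f z = (case chart_at A z of (D, \<phi>) \<Rightarrow>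
     frechet_derivative (snd (chart_at B (f z)) \<circ> f \<circ> inv_into D \<phi>) (at (\<phi> z)))"

section \<open>Vector bundles\<close>

text \<open>The fibres of a vector bundle are linear subspaces of one Euclidean space \<open>'w\<close>;
  \<open>sections W U\<close> are the smooth sections over the open set \<open>U\<close>. The values of a section
  outside \<open>U\<close> are irrelevant.\<close>

record ('x, 'w) vbundle =
  fiber :: "'x \<Rightarrow> 'w set"
  sections :: "'x set \<Rightarrow> ('x \<Rightarrow> 'w) set"

text \<open>Smooth sections over \<open>U\<close> of the pull-back of the tangent bundle of \<open>B\<close> along
  \<open>g\<close>: \<open>X x\<close> lies in the tangent space at \<open>g x\<close>, and its components in
  every chart of \<open>B\<close> are smooth.\<close>
definition fields_along ::
    "('a::topological_space, 'e::euclidean_space) chart set \<Rightarrow>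
     ('b::topological_space, 'f::euclidean_space) chart set \<Rightarrow>
     ('a \<Rightarrow> 'b) \<Rightarrow> 'a set \<Rightarrow> ('a \<Rightarrow> 'f) set" where
  "fields_along A B g U =
     {X. \<forall>(D, \<phi>)\<in>B. smooth_map A euclidean_atlas (U \<inter> g -` D)
           (\<lambda>x. differential B euclidean_atlas \<phi> (g x) (X x))}"

definition tangent_bundle ::
    "('a::topological_space, 'e::euclidean_space) chart set \<Rightarrow> ('a, 'e) vbundle" where
  "tangent_bundle A = \<lparr>fiber = (\<lambda>_. UNIV), sections = fields_along A A id\<rparr>"

definition whitney_sum :: "('x, 'v) vbundle \<Rightarrow> ('x, 'w) vbundle \<Rightarrow> ('x, 'v \<times> 'w) vbundle" where
  "whitney_sum V W =
     \<lparr>fiber = (\<lambda>x. fiber V x \<times> fiber W x),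
      sections = (\<lambda>U. {\<sigma>. fst \<circ> \<sigma> \<in> sections V U \<and> snd \<circ> \<sigma> \<in> sections W U})\<rparr>"

text \<open>A linear functional on the subspace \<open>W\<close> is represented by its unique linear extension
  that vanishes on the orthogonal complement of \<open>W\<close>.\<close>
definition dual_space :: "'w::euclidean_space set \<Rightarrow> ('w \<Rightarrow>\<^sub>L real) set" where
  "dual_space W = {f. \<forall>v\<in>W\<^sup>\<bottom>. blinfun_apply f v = 0}"

definition to_dual :: "'w::euclidean_space set \<Rightarrow> ('w \<Rightarrow> real) \<Rightarrow> ('w \<Rightarrow>\<^sub>L real)" where
  "to_dual W f = (THE g. g \<in> dual_space W \<and> (\<forall>v\<in>W. blinfun_apply g v = f v))"

text \<open>A section of the dual bundle is smooth if it pairs smoothly with all smooth local sections.\<close>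
definition dual_sections ::
    "('x::topological_space, 'e::euclidean_space) chart set \<Rightarrow> ('x, 'w::euclidean_space) vbundle \<Rightarrow>
     'x set \<Rightarrow> ('x \<Rightarrow> ('w \<Rightarrow>\<^sub>L real)) set" where
  "dual_sections A W U =
     {f. (\<forall>x\<in>U. f x \<in> dual_space (fiber W x)) \<and>
         (\<forall>U' \<sigma>. open U' \<and> U' \<subseteq> U \<and> \<sigma> \<in> sections W U' \<longrightarrow>
            smooth_map A euclidean_atlas U' (\<lambda>x. blinfun_apply (f x) (\<sigma> x)))}"

text \<open>Fibres and smooth sections of \<open>W \<oplus> W\<^sup>\<or>\<close>.\<close>

definition gen_fiber ::
    "('x, 'w::euclidean_space) vbundle \<Rightarrow> 'x \<Rightarrow> ('w \<times> ('w \<Rightarrow>\<^sub>L real)) set" where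
  "gen_fiber W x = fiber W x \<times> dual_space (fiber W x)"

definition gen_sections ::
    "('x::topological_space, 'e::euclidean_space) chart set \<Rightarrow> ('x, 'w::euclidean_space) vbundle \<Rightarrow>
     'x set \<Rightarrow> ('x \<Rightarrow> 'w \<times> ('w \<Rightarrow>\<^sub>L real)) set" where
  "gen_sections A W U = {e. fst \<circ> e \<in> sections W U \<and> snd \<circ> e \<in> dual_sections A W U}"

section \<open>Generalized almost complex structures\<close>

definition pairing ::
    "'w::real_normed_vector \<times> ('w \<Rightarrow>\<^sub>L real) \<Rightarrow> 'w \<times> ('w \<Rightarrow>\<^sub>L real) \<Rightarrow> real" where
  "pairing = (\<lambda>(v, f) (w, g). - (1/2) * (blinfun_apply f w + blinfun_apply g v))"

text \<open>\<open>A\<close> is the atlas of the base of \<open>W\<close>. A fibrewise linear map is smooth if it maps smooth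
  local sections to smooth local sections.\<close>
definition gen_almost_complex ::
    "('x::topological_space, 'e::euclidean_space) chart set \<Rightarrow> ('x, 'w::euclidean_space) vbundle \<Rightarrow>
     ('x \<Rightarrow> 'w \<times> ('w \<Rightarrow>\<^sub>L real) \<Rightarrow> 'w \<times> ('w \<Rightarrow>\<^sub>L real)) \<Rightarrow> bool" where
  "gen_almost_complex A W J \<longleftrightarrow>
     (\<forall>x. \<forall>a\<in>gen_fiber W x. J x a \<in> gen_fiber W x) \<and>
     (\<forall>x. \<forall>a\<in>gen_fiber W x. \<forall>b\<in>gen_fiber W x. J x (a + b) = J x a + J x b) \<and>
     (\<forall>x r. \<forall>a\<in>gen_fiber W x. J x (r *\<^sub>R a) = r *\<^sub>R J x a) \<and>
     (\<forall>x. \<forall>a\<in>gen_fiber W x. \<forall>b\<in>gen_fiber W x. pairing (J x a) (J x b) = pairing a b) \<and>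
     (\<forall>x. \<forall>a\<in>gen_fiber W x. J x (J x a) = - a) \<and>
     (\<forall>U e. open U \<and> e \<in> gen_sections A W U \<longrightarrow> (\<lambda>x. J x (e x)) \<in> gen_sections A W U)"

section \<open>The Courant bracket and integrability\<close>

text \<open>Components of a vector field, and of a 1-form paired with a constant vector \<open>w\<close>,
  as functions on the image of a chart.\<close>

definition field_in_chart ::
    "('a, 'e::euclidean_space) chart set \<Rightarrow> ('a, 'e) chart \<Rightarrow> ('a \<Rightarrow> 'e) \<Rightarrow> 'e \<Rightarrow> 'e" where
  "field_in_chart A = (\<lambda>(D, \<phi>) X y.
     differential A euclidean_atlas \<phi> (inv_into D \<phi> y) (X (inv_into D \<phi> y)))"

definition form_in_chart ::
    "('a, 'e::euclidean_space) chart set \<Rightarrow> ('a, 'e) chart \<Rightarrow> ('a \<Rightarrow> ('e \<Rightarrow>\<^sub>L real)) \<Rightarrow>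
     'e \<Rightarrow> 'e \<Rightarrow> real" where
  "form_in_chart A = (\<lambda>(D, \<phi>) \<xi> w y.
     blinfun_apply (\<xi> (inv_into D \<phi> y)) (differential euclidean_atlas A (inv_into D \<phi>) y w))"

text \<open>The standard coordinate expressions, in the chart chosen at \<open>z\<close>:
  \<open>[X,Y] = DY(X) - DX(Y)\<close> and \<open>(L\<^sub>X \<eta>)(w) = D(\<eta>(w))(X) + \<eta>(DX(w))\<close>.\<close>

definition lie_bracket ::
    "('a, 'e::euclidean_space) chart set \<Rightarrow> ('a \<Rightarrow> 'e) \<Rightarrow> ('a \<Rightarrow> 'e) \<Rightarrow> 'a \<Rightarrow> 'e" where
  "lie_bracket A X Y z =
     (let c = chart_at A z; y = snd c z; X' = field_in_chart A c X; Y' = field_in_chart A c Y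
      in frechet_derivative Y' (at y) (X' y) - frechet_derivative X' (at y) (Y' y))"

definition lie_derivative ::
    "('a, 'e::euclidean_space) chart set \<Rightarrow> ('a \<Rightarrow> 'e) \<Rightarrow> ('a \<Rightarrow> ('e \<Rightarrow>\<^sub>L real)) \<Rightarrow>
     'a \<Rightarrow> ('e \<Rightarrow>\<^sub>L real)" where
  "lie_derivative A X \<eta> z =
     (let c = chart_at A z; y = snd c z; X' = field_in_chart A c X
      in Blinfun (\<lambda>w. frechet_derivative (form_in_chart A c \<eta> w) (at y) (X' y)
                     + form_in_chart A c \<eta> (frechet_derivative X' (at y) w) y))"

definition d_fun ::
    "('a, 'e::euclidean_space) chart set \<Rightarrow> ('a \<Rightarrow> real) \<Rightarrow> 'a \<Rightarrow> ('e \<Rightarrow>\<^sub>L real)" where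
  "d_fun A h z = Blinfun (differential A euclidean_atlas h z)"

definition courant ::
    "('a, 'e::euclidean_space) chart set \<Rightarrow> ('a \<Rightarrow> 'e \<times> ('e \<Rightarrow>\<^sub>L real)) \<Rightarrow>
     ('a \<Rightarrow> 'e \<times> ('e \<Rightarrow>\<^sub>L real)) \<Rightarrow> 'a \<Rightarrow> 'e \<times> ('e \<Rightarrow>\<^sub>L real)" where
  "courant A a b z =
     (let X = fst \<circ> a; \<xi> = snd \<circ> a; Y = fst \<circ> b; \<eta> = snd \<circ> b
      in (lie_bracket A X Y z,
          lie_derivative A X \<eta> z - lie_derivative A Y \<xi> z
            + (1/2) *\<^sub>R d_fun A (\<lambda>x. blinfun_apply (\<xi> x) (Y x) - blinfun_apply (\<eta> x) (X x)) z))"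

text \<open>A section of a complexified bundle is a pair \<open>(a, b)\<close> of real sections, standing for
  \<open>a + \<i> b\<close>.\<close>

definition courant_complex where
  "courant_complex A = (\<lambda>(a, b) (c, d).
     (\<lambda>z. courant A a c z - courant A b d z, \<lambda>z. courant A a d z + courant A b c z))"

definition times_i :: "'v::real_vector \<times> 'v \<Rightarrow> 'v \<times> 'v" where
  "times_i = (\<lambda>(a, b). (- b, a))"

text \<open>Smooth sections over \<open>U\<close> of the \<open>+\<i>\<close>-eigenbundle of the complexification of \<open>J\<close>.\<close>
definition eigen_sections ::
    "('x::topological_space, 'e::euclidean_space) chart set \<Rightarrow>
     ('x \<Rightarrow> 'e \<times> ('e \<Rightarrow>\<^sub>L real) \<Rightarrow> 'e \<times> ('e \<Rightarrow>\<^sub>L real)) \<Rightarrow> 'x set \<Rightarrow>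
     (('x \<Rightarrow> 'e \<times> ('e \<Rightarrow>\<^sub>L real)) \<times> ('x \<Rightarrow> 'e \<times> ('e \<Rightarrow>\<^sub>L real))) set" where
  "eigen_sections A J U =
     {(a, b). a \<in> gen_sections A (tangent_bundle A) U \<and> b \<in> gen_sections A (tangent_bundle A) U \<and>
        (\<forall>z\<in>U. (J z (a z), J z (b z)) = times_i (a z, b z))}"

definition integrable_gacs ::
    "('x::topological_space, 'e::euclidean_space) chart set \<Rightarrow>
     ('x \<Rightarrow> 'e \<times> ('e \<Rightarrow>\<^sub>L real) \<Rightarrow> 'e \<times> ('e \<Rightarrow>\<^sub>L real)) \<Rightarrow> bool" where
  "integrable_gacs A J \<longleftrightarrow>
     (\<forall>U. open U \<longrightarrow> (\<forall>e\<in>eigen_sections A J U. \<forall>f\<in>eigen_sections A J U.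
        courant_complex A e f \<in> eigen_sections A J U))"

section \<open>Torus bundles\<close>

record ('m, 'f, 'z, 'e, 'n) torus_bundle =
  base :: "('m, 'f) chart set"
  tot :: "('z, 'e) chart set"
  prj :: "'z \<Rightarrow> 'm"
  zero_section :: "'m \<Rightarrow> 'z"
  trivs :: "('m set \<times> ('m \<Rightarrow> real ^ 'n::finite \<Rightarrow> 'z)) set"

text \<open>A local trivialization, that is a diffeomorphism \<open>U \<times> \<real>\<^sup>n/\<int>\<^sup>n \<rightarrow> p\<^sup>-\<^sup>1(U)\<close> over \<open>U\<close>, is given by
  its composite \<open>\<psi>\<close> with the quotient map \<open>U \<times> \<real>\<^sup>n \<rightarrow> U \<times> \<real>\<^sup>n/\<int>\<^sup>n\<close>. The last clause says that
  it is onto \<open>p\<^sup>-\<^sup>1(U)\<close> with smooth inverse: the inverse lifts locally to a smooth map \<open>l\<close> to \<open>\<real>\<^sup>n\<close>.\<close>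
definition local_triv ::
    "('m::topological_space, 'f::euclidean_space, 'z::topological_space, 'e::euclidean_space, 'n::finite) torus_bundle
     \<Rightarrow> 'm set \<Rightarrow> ('m \<Rightarrow> real ^ 'n \<Rightarrow> 'z) \<Rightarrow> bool" where
  "local_triv B U \<psi> \<longleftrightarrow>
     open U \<and>
     smooth_map (product_atlas (base B) euclidean_atlas) (tot B) (U \<times> UNIV) (\<lambda>(x, y). \<psi> x y) \<and>
     (\<forall>x\<in>U. \<forall>y. prj B (\<psi> x y) = x) \<and>
     (\<forall>x\<in>U. \<forall>y y'. \<psi> x y = \<psi> x y' \<longleftrightarrow> (\<forall>i. (y - y') $ i \<in> \<int>)) \<and>
     (\<forall>z. prj B z \<in> U \<longrightarrow>
        (\<exists>W l. open W \<and> z \<in> W \<and> smooth_map (tot B) euclidean_atlas W l \<and>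
               (\<forall>z'\<in>W. prj B z' \<in> U \<and> \<psi> (prj B z') (l z') = z')))"

definition GL_int :: "(real ^ 'n ^ 'n) set" where
  "GL_int = {P. (\<forall>i j. P $ i $ j \<in> \<int>) \<and> (\<exists>Q. (\<forall>i j. Q $ i $ j \<in> \<int>) \<and> P ** Q = mat 1 \<and> Q ** P = mat 1)}"

text \<open>The transition maps of the trivializations are locally constant with values in \<open>GL(n,\<int>)\<close>.\<close>
definition torus_bundle ::
    "('m::{t2_space, second_countable_topology}, 'f::euclidean_space,
      'z::{t2_space, second_countable_topology}, 'e::euclidean_space, 'n::finite) torus_bundle \<Rightarrow> bool" where
  "torus_bundle B \<longleftrightarrow>
     smooth_atlas (base B) \<and> smooth_atlas (tot B) \<and>
     smooth_map (tot B) (base B) UNIV (prj B) \<and>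
     smooth_map (base B) (tot B) UNIV (zero_section B) \<and>
     (\<Union>(U, \<psi>)\<in>trivs B. U) = UNIV \<and>
     (\<forall>(U, \<psi>)\<in>trivs B. local_triv B U \<psi> \<and> (\<forall>x\<in>U. zero_section B x = \<psi> x 0)) \<and>
     (\<forall>(U, \<psi>)\<in>trivs B. \<forall>(U', \<psi>')\<in>trivs B. \<forall>x0\<in>U \<inter> U'.
        \<exists>N P. open N \<and> x0 \<in> N \<and> N \<subseteq> U \<inter> U' \<and> P \<in> GL_int \<and> (\<forall>x\<in>N. \<forall>y. \<psi>' x y = \<psi> x (P *v y)))"

text \<open>The group law on the fibres.\<close>
definition fiber_add ::
    "('m, 'f, 'z, 'e, 'n::finite) torus_bundle \<Rightarrow> 'z \<Rightarrow> 'z \<Rightarrow> 'z" where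
  "fiber_add B z z' = (THE z''. \<exists>(U, \<psi>)\<in>trivs B. \<exists>x\<in>U. \<exists>y y'.
     z = \<psi> x y \<and> z' = \<psi> x y' \<and> z'' = \<psi> x (y + y'))"

text \<open>The bundle \<open>g\<^sup>*V\<close> for \<open>g : N \<rightarrow> M\<close>, where \<open>V = s\<^sup>*T\<^bsub>Z/M\<^esub>\<close> and \<open>T\<^bsub>Z/M\<^esub> = ker dp\<close>;
  \<open>C\<close> is the atlas of \<open>N\<close>.\<close>

definition vert ::
    "('m, 'f::euclidean_space, 'z, 'e::euclidean_space, 'n::finite) torus_bundle \<Rightarrow> 'm \<Rightarrow> 'e set" where
  "vert B x = {v. differential (tot B) (base B) (prj B) (zero_section B x) v = 0}"

definition vert_pullback ::
    "('m, 'f::euclidean_space, 'z::topological_space, 'e::euclidean_space, 'n::finite) torus_bundle \<Rightarrow>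
     ('a::topological_space, 'd::euclidean_space) chart set \<Rightarrow> ('a \<Rightarrow> 'm) \<Rightarrow> ('a, 'e) vbundle" where
  "vert_pullback B C g =
     \<lparr>fiber = (\<lambda>a. vert B (g a)),
      sections = (\<lambda>U. {\<sigma>. (\<forall>a\<in>U. \<sigma> a \<in> vert B (g a)) \<and>
                           \<sigma> \<in> fields_along C (tot B) (zero_section B \<circ> g) U})\<rparr>"

definition vert_bundle ::
    "('m::topological_space, 'f::euclidean_space, 'z::topological_space, 'e::euclidean_space, 'n::finite) torus_bundle
     \<Rightarrow> ('m, 'e) vbundle" where
  "vert_bundle B = vert_pullback B (base B) id"

text \<open>The exponential map \<open>V\<^sub>x \<rightarrow> Z\<^sub>x\<close> of the Lie group \<open>Z\<^sub>x\<close>: the one-parameter subgroups are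
  \<open>t \<mapsto> \<psi> x (t y)\<close>. Its kernel is the lattice \<open>\<Lambda>\<^sub>x\<close>, and it induces \<open>tot(V)/\<Lambda> \<cong> Z\<close>.\<close>

definition fiber_exp ::
    "('m, 'f, 'z, 'e::euclidean_space, 'n::finite) torus_bundle \<Rightarrow> 'm \<Rightarrow> 'e \<Rightarrow> 'z" where
  "fiber_exp B x v = (THE z. \<exists>(U, \<psi>)\<in>trivs B. x \<in> U \<and>
     (\<exists>y. differential euclidean_atlas (tot B) (\<lambda>t::real. \<psi> x (t *\<^sub>R y)) 0 1 = v \<and> z = \<psi> x y))"

definition vert_lattice ::
    "('m, 'f::euclidean_space, 'z, 'e::euclidean_space, 'n::finite) torus_bundle \<Rightarrow> 'm \<Rightarrow> 'e set" where
  "vert_lattice B x = {v \<in> vert B x. fiber_exp B x v = zero_section B x}"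

text \<open>A frame of \<open>V\<close> over \<open>U\<close> consisting of sections of \<open>\<Lambda>\<close>.\<close>
definition lattice_frame ::
    "('m::topological_space, 'f::euclidean_space, 'z::topological_space, 'e::euclidean_space, 'n::finite) torus_bundle
     \<Rightarrow> 'm set \<Rightarrow> ('n \<Rightarrow> 'm \<Rightarrow> 'e) \<Rightarrow> bool" where
  "lattice_frame B U lam \<longleftrightarrow> open U \<and>
     (\<forall>i. lam i \<in> sections (vert_bundle B) U \<and> (\<forall>x\<in>U. lam i x \<in> vert_lattice B x)) \<and>
     (\<forall>x\<in>U. bij_betw (\<lambda>c::real ^ 'n. \<Sum>i\<in>UNIV. (c $ i) *\<^sub>R lam i x) UNIV (vert B x))"

text \<open>The pull-back connection \<open>((g\<^sup>*\<nabla>)\<^sub>u \<sigma>)(a)\<close> for \<open>u \<in> T\<^sub>a N\<close> and a section \<open>\<sigma>\<close> of \<open>g\<^sup>*V\<close> near \<open>a\<close>.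
  Since sections of \<open>\<Lambda>\<close> are flat, the Leibniz rule gives
  \<open>(g\<^sup>*\<nabla>)\<^sub>u (\<Sum>i. h\<^sub>i g\<^sup>*\<lambda>\<^sub>i) = \<Sum>i. dh\<^sub>i(u) g\<^sup>*\<lambda>\<^sub>i\<close>.\<close>
definition pull_conn ::
    "('m::topological_space, 'f::euclidean_space, 'z::topological_space, 'e::euclidean_space, 'n::finite) torus_bundle
     \<Rightarrow> ('a::topological_space, 'd::euclidean_space) chart set \<Rightarrow> ('a \<Rightarrow> 'm) \<Rightarrow>
     'a \<Rightarrow> 'd \<Rightarrow> ('a \<Rightarrow> 'e) \<Rightarrow> 'e" where
  "pull_conn B C g a u \<sigma> = (THE v. \<exists>U lam W h.
     lattice_frame B U lam \<and> open W \<and> a \<in> W \<and> g ` W \<subseteq> U \<and>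
     (\<forall>i. smooth_map C euclidean_atlas W (h i)) \<and>
     (\<forall>b\<in>W. \<sigma> b = (\<Sum>i\<in>UNIV. h i b *\<^sub>R lam i (g b))) \<and>
     v = (\<Sum>i\<in>UNIV. differential C euclidean_atlas (h i) a u *\<^sub>R lam i (g a)))"

definition conn ::
    "('m::topological_space, 'f::euclidean_space, 'z::topological_space, 'e::euclidean_space, 'n::finite) torus_bundle
     \<Rightarrow> 'm \<Rightarrow> 'f \<Rightarrow> ('m \<Rightarrow> 'e) \<Rightarrow> 'e" where
  "conn B = pull_conn B (base B) id"

text \<open>The sheaves \<open>S\<close> and \<open>S\<^sup>\<or>\<close>; the dual connection is
  \<open>(\<nabla>\<^sub>u \<tau>)(\<sigma>) = d(\<tau>(\<sigma>))(u) - \<tau>(\<nabla>\<^sub>u \<sigma>)\<close>.\<close>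

definition flat_sections ::
    "('m::topological_space, 'f::euclidean_space, 'z::topological_space, 'e::euclidean_space, 'n::finite) torus_bundle
     \<Rightarrow> 'm set \<Rightarrow> ('m \<Rightarrow> 'e) set" where
  "flat_sections B U = {\<sigma> \<in> sections (vert_bundle B) U. \<forall>x\<in>U. \<forall>u. conn B x u \<sigma> = 0}"

definition flat_dual_sections ::
    "('m::topological_space, 'f::euclidean_space, 'z::topological_space, 'e::euclidean_space, 'n::finite) torus_bundle
     \<Rightarrow> 'm set \<Rightarrow> ('m \<Rightarrow> ('e \<Rightarrow>\<^sub>L real)) set" where
  "flat_dual_sections B U =
     {\<tau> \<in> dual_sections (base B) (vert_bundle B) U.
        \<forall>U' \<sigma>. open U' \<and> U' \<subseteq> U \<and> \<sigma> \<in> sections (vert_bundle B) U' \<longrightarrow>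
          (\<forall>x\<in>U'. \<forall>u. differential (base B) euclidean_atlas (\<lambda>x'. blinfun_apply (\<tau> x') (\<sigma> x')) x u
                        - blinfun_apply (\<tau> x) (conn B x u \<sigma>) = 0)}"

section \<open>Semi-flat structures\<close>

text \<open>\<open>j : p\<^sup>*V \<rightarrow> T\<^sub>Z\<close> is induced by translation along the fibres.\<close>
definition vert_incl ::
    "('m, 'f, 'z, 'e::euclidean_space, 'n::finite) torus_bundle \<Rightarrow> 'z \<Rightarrow> 'e \<Rightarrow> 'e" where
  "vert_incl B z v =
     differential euclidean_atlas (tot B) (\<lambda>t::real. fiber_add B z (fiber_exp B (prj B z) (t *\<^sub>R v))) 0 1"

text \<open>\<open>D : T\<^sub>Z \<rightarrow> p\<^sup>*V\<close>. Near \<open>z\<close>, a smooth section \<open>l\<close> of \<open>p\<^sup>*V\<close> with \<open>exp \<circ> l = id\<close> is the same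
  as a local inverse \<open>Z \<rightarrow> tot(V)\<close> of the local diffeomorphism \<open>exp : tot(V) \<rightarrow> Z\<close>. It pulls the
  tautological section of \<open>\<pi>\<^sup>*V\<close> back to \<open>l\<close>, so that \<open>(\<pi>\<^sup>*\<nabla>)(S)\<close> descends to \<open>(p\<^sup>*\<nabla>)(l)\<close>.\<close>
definition vert_split ::
    "('m::topological_space, 'f::euclidean_space, 'z::topological_space, 'e::euclidean_space, 'n::finite) torus_bundle
     \<Rightarrow> 'z \<Rightarrow> 'e \<Rightarrow> 'e" where
  "vert_split B z w = (THE v. \<exists>W l. open W \<and> z \<in> W \<and>
     l \<in> sections (vert_pullback B (tot B) (prj B)) W \<and>
     (\<forall>z'\<in>W. fiber_exp B (prj B z') (l z') = z') \<and>
     v = pull_conn B (tot B) (prj B) z w l)"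

text \<open>\<open>\<alpha> : p\<^sup>*T\<^sub>M \<rightarrow> T\<^sub>Z\<close>\<close>
definition horiz_lift ::
    "('m::topological_space, 'f::euclidean_space, 'z::topological_space, 'e::euclidean_space, 'n::finite) torus_bundle
     \<Rightarrow> 'z \<Rightarrow> 'f \<Rightarrow> 'e" where
  "horiz_lift B z u =
     (THE w. differential (tot B) (base B) (prj B) z w = u \<and> vert_split B z w = 0)"

text \<open>The bundle \<open>V \<oplus> T\<^sub>M\<close> over \<open>M\<close>. Below, \<open>(V \<oplus> T\<^sub>M) \<oplus> (V \<oplus> T\<^sub>M)\<^sup>\<or>\<close> plays the role of
  \<open>V \<oplus> T\<^sub>M \<oplus> V\<^sup>\<or> \<oplus> T\<^sub>M\<^sup>\<or>\<close>.\<close>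
definition vert_tangent_bundle ::
    "('m::topological_space, 'f::euclidean_space, 'z::topological_space, 'e::euclidean_space, 'n::finite) torus_bundle
     \<Rightarrow> ('m, 'e \<times> 'f) vbundle" where
  "vert_tangent_bundle B = whitney_sum (vert_bundle B) (tangent_bundle (base B))"

definition iso_F ::
    "('m::topological_space, 'f::euclidean_space, 'z::topological_space, 'e::euclidean_space, 'n::finite) torus_bundle
     \<Rightarrow> 'z \<Rightarrow> 'e \<times> ('e \<Rightarrow>\<^sub>L real) \<Rightarrow> ('e \<times> 'f) \<times> (('e \<times> 'f) \<Rightarrow>\<^sub>L real)" where
  "iso_F B z = (\<lambda>(w, \<xi>).
     ((vert_split B z w, differential (tot B) (base B) (prj B) z w),
      to_dual (fiber (vert_tangent_bundle B) (prj B z))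
        (\<lambda>(v, u). blinfun_apply \<xi> (vert_incl B z v) + blinfun_apply \<xi> (horiz_lift B z u))))"

text \<open>The inclusions of \<open>V \<oplus> V\<^sup>\<or>\<close> and of \<open>T\<^sub>M \<oplus> T\<^sub>M\<^sup>\<or>\<close>.\<close>

definition incl_V ::
    "'e::euclidean_space \<times> ('e \<Rightarrow>\<^sub>L real) \<Rightarrow> ('e \<times> 'f::euclidean_space) \<times> (('e \<times> 'f) \<Rightarrow>\<^sub>L real)" where
  "incl_V = (\<lambda>(v, \<tau>). ((v, 0), \<tau> o\<^sub>L fst_blinfun))"

definition incl_T ::
    "'f::euclidean_space \<times> ('f \<Rightarrow>\<^sub>L real) \<Rightarrow> ('e::euclidean_space \<times> 'f) \<times> (('e \<times> 'f) \<Rightarrow>\<^sub>L real)" where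
  "incl_T = (\<lambda>(u, \<theta>). ((0, u), \<theta> o\<^sub>L snd_blinfun))"

definition adapted ::
    "('m::topological_space, 'f::euclidean_space, 'z::topological_space, 'e::euclidean_space, 'n::finite) torus_bundle
     \<Rightarrow> ('m \<Rightarrow> ('e \<times> 'f) \<times> (('e \<times> 'f) \<Rightarrow>\<^sub>L real) \<Rightarrow> ('e \<times> 'f) \<times> (('e \<times> 'f) \<Rightarrow>\<^sub>L real)) \<Rightarrow> bool" where
  "adapted B Jb \<longleftrightarrow>
     (\<forall>x. Jb x ` incl_V ` gen_fiber (vert_bundle B) x = incl_T ` gen_fiber (tangent_bundle (base B)) x)"

text \<open>\<open>J\<close> is the semi-flat generalized almost complex structure on \<open>Z\<close> arising from \<open>Jb\<close>.\<close>
definition semi_flat ::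
    "('m::topological_space, 'f::euclidean_space, 'z::topological_space, 'e::euclidean_space, 'n::finite) torus_bundle
     \<Rightarrow> ('z \<Rightarrow> 'e \<times> ('e \<Rightarrow>\<^sub>L real) \<Rightarrow> 'e \<times> ('e \<Rightarrow>\<^sub>L real))
     \<Rightarrow> ('m \<Rightarrow> ('e \<times> 'f) \<times> (('e \<times> 'f) \<Rightarrow>\<^sub>L real) \<Rightarrow> ('e \<times> 'f) \<times> (('e \<times> 'f) \<Rightarrow>\<^sub>L real)) \<Rightarrow> bool" where
  "semi_flat B J Jb \<longleftrightarrow>
     gen_almost_complex (tot B) (tangent_bundle (tot B)) J \<and>
     gen_almost_complex (base B) (vert_tangent_bundle B) Jb \<and>
     adapted B Jb \<and>
     (\<forall>z. J z = inv (iso_F B z) \<circ> Jb (prj B z) \<circ> iso_F B z)"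

text \<open>The sheaf \<open>Jb(S \<oplus> S\<^sup>\<or>)\<close>, as a subsheaf of \<open>T\<^sub>M \<oplus> T\<^sub>M\<^sup>\<or>\<close>.\<close>
definition J_flat_sections ::
    "('m::topological_space, 'f::euclidean_space, 'z::topological_space, 'e::euclidean_space, 'n::finite) torus_bundle
     \<Rightarrow> ('m \<Rightarrow> ('e \<times> 'f) \<times> (('e \<times> 'f) \<Rightarrow>\<^sub>L real) \<Rightarrow> ('e \<times> 'f) \<times> (('e \<times> 'f) \<Rightarrow>\<^sub>L real))
     \<Rightarrow> 'm set \<Rightarrow> ('m \<Rightarrow> 'f \<times> ('f \<Rightarrow>\<^sub>L real)) set" where
  "J_flat_sections B Jb U =
     {a. \<exists>\<sigma>\<in>flat_sections B U. \<exists>\<tau>\<in>flat_dual_sections B U.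
           \<forall>x\<in>U. incl_T (a x) = Jb x (incl_V (\<sigma> x, \<tau> x))}"

end

theory Submission
  imports Defs
begin

text \<open>
  Write a section of the \<open>+\<i>\<close>-eigenbundle as \<open>a - \<i> J a\<close> with \<open>a\<close> real: integrability means
  that the Nijenhuis expression
  \<open>N(a, b) = [J a, J b] - [a, b] - J [a, J b] - J [J a, b]\<close> vanishes. The Courant bracket satisfies a
  Leibniz rule up to a term in the pairing, and these terms cancel in \<open>N\<close> because \<open>J\<close> is
  orthogonal; so \<open>N\<close> is tensorial, and since \<open>N(J a, b) = - J N(a, b)\<close> it suffices to evaluate it
  on a local frame of \<open>p\<^sup>*(V \<oplus> V\<^sup>\<or>)\<close>, which together with its image under \<open>J\<close> spans everything.

  In a local trivialization let \<open>l\<close> be the fibre coordinates. For constant \<open>c\<close>, \<open>g\<close> in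
  \<open>\<real>\<^sup>n\<close> and a section \<open>a\<close> of \<open>T\<^sub>M \<oplus> T\<^sub>M\<^sup>\<or>\<close>, consider the section of \<open>T\<^sub>Z \<oplus> T\<^sub>Z\<^sup>\<or>\<close> with
  vertical part \<open>(c, g dl)\<close> and horizontal part the lift of \<open>a\<close>. The bracket of two such sections
  is the lift of the bracket of their horizontal parts. The flat sections of \<open>V \<oplus> V\<^sup>\<or>\<close> are
  exactly those with locally constant \<open>c\<close>, \<open>g\<close>, and \<open>J\<close> sends their lifts \<open>A\<close>, \<open>A'\<close> to the lifts of
  sections \<open>a\<close>, \<open>a'\<close> of \<open>\<J>(\<S> \<oplus> \<S>\<^sup>\<or>)\<close>. Hence \<open>N(A, A')\<close> is the lift of \<open>[a, a']\<close>.
\<close>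

section \<open>Smooth functions on open subsets of Euclidean spaces\<close>

text \<open>Two obstacles shape the proof. Differentials and brackets are defined in a chart chosen
  separately at each point, so their dependence on the point is invisible; they are first
  characterized by what they do to functions and vector fields,
  \<open>[X,Y]f = X(Yf) - Y(Xf)\<close> and
  \<open>(L_X \<eta>)(W) = X(\<eta>(W)) - \<eta>([X,W])\<close>. The exponential map, the group law,
  the connection, the splitting and the horizontal lift are definite descriptions over all
  trivializations, frames or lifts. Read in one trivialization, two choices differ by integral data,
  which continuity makes locally constant, so derivatives do not see the choice: \<open>D\<close>
  becomes \<open>dl\<close>, and \<open>\<alpha>\<close> the differential of \<open>\<psi>\<close>
  along the base. The bracket of lifts is the lift of the bracket because the connection is flat:
  \<open>dl\<close> is a closed form taking the constant value \<open>c\<close> on a lift, so the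
  bracket acquires no vertical part, and every function entering the Courant bracket, tested on
  lifted fields, is a constant plus a pull-back from \<open>M\<close>.\<close>

lemma has_derivative_frechet:
  "f differentiable (at x) \<Longrightarrow> (f has_derivative frechet_derivative f (at x)) (at x)"
  by (simp add: frechet_derivative_works)

lemma frechet_derivative_cong:
  assumes "open S" "x \<in> S" "\<And>y. y \<in> S \<Longrightarrow> f y = g y"
  shows "frechet_derivative f (at x) = frechet_derivative g (at x)"
proof -
  have "(f has_derivative D) (at x) \<longleftrightarrow> (g has_derivative D) (at x)" for D
    using assms has_derivative_transform_within_open by metis
  then show ?thesis by (simp add: frechet_derivative_def)
qed

lemma differentiable_cong_open:
  assumes "open S" "x \<in> S" "\<And>y. y \<in> S \<Longrightarrow> f y = g y"
  shows "f differentiable (at x) \<longleftrightarrow> g differentiable (at x)"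
  using assms has_derivative_transform_within_open unfolding differentiable_def by metis

lemma C_k_on_cong:
  assumes "open S" "\<And>y. y \<in> S \<Longrightarrow> f y = g y"
  shows "C_k_on k S f \<longleftrightarrow> C_k_on k S g"
  using assms(2)
proof (induction k arbitrary: f g)
  case 0
  then show ?case by (simp cong: continuous_on_cong)
next
  case (Suc k)
  have "f differentiable (at x) \<longleftrightarrow> g differentiable (at x)" if "x \<in> S" for x
    using differentiable_cong_open[OF assms(1) that, of f g] Suc.prems by blast
  moreover have "C_k_on k S (\<lambda>x. frechet_derivative f (at x) v)
      \<longleftrightarrow> C_k_on k S (\<lambda>x. frechet_derivative g (at x) v)" for v
  proof (rule Suc.IH)
    fix y assume "y \<in> S"
    then show "frechet_derivative f (at y) v = frechet_derivative g (at y) v"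
      using frechet_derivative_cong[OF assms(1), of y f g] Suc.prems by simp
  qed
  ultimately show ?case by simp
qed

text \<open>\<open>frechet_derivative\<close> is a choice operator; this is where explicit formulas
  enter. By uniqueness of derivatives \<open>f'\<close> is the chosen one on \<open>S\<close>, and
  openness of \<open>S\<close> allows the exchange inside \<open>C_k_on\<close>.\<close>

lemma C_k_on_SucI:
  assumes "open S" and D: "\<And>x. x \<in> S \<Longrightarrow> (f has_derivative f' x) (at x)"
    and "\<And>v. C_k_on k S (\<lambda>x. f' x v)"
  shows "C_k_on (Suc k) S f"
proof -
  have "C_k_on k S (\<lambda>x. frechet_derivative f (at x) v)" for v
    using assms(3)[of v] C_k_on_cong[OF assms(1), of "\<lambda>x. f' x v"] frechet_derivative_at[OF D] by simp
  with D show ?thesis by (auto simp: differentiable_def)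
qed

lemma C_k_on_subset: "C_k_on k S f \<Longrightarrow> T \<subseteq> S \<Longrightarrow> C_k_on k T f"
  by (induction k arbitrary: f) (auto intro: continuous_on_subset)

lemma C_k_on_Suc_imp: "C_k_on (Suc k) S f \<Longrightarrow> C_k_on k S f"
proof (induction k arbitrary: f)
  case 0
  then have "\<forall>x\<in>S. f differentiable (at x)" by simp
  then show ?case
    by (simp add: continuous_at_imp_continuous_on differentiable_imp_continuous_within)
qed auto

lemma C_k_on_local:
  assumes "\<And>x. x \<in> S \<Longrightarrow> \<exists>T. open T \<and> x \<in> T \<and> C_k_on k T f"
  shows "C_k_on k S f"
  using assms
proof (induction k arbitrary: f)
  case 0
  have "continuous (at x) f" if "x \<in> S" for x
    using 0[OF that] continuous_on_eq_continuous_at by auto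
  then show ?case by (simp add: continuous_at_imp_continuous_on)
next
  case (Suc k)
  have "f differentiable (at x)" if "x \<in> S" for x
    using Suc.prems[OF that] by auto
  moreover have "C_k_on k S (\<lambda>x. frechet_derivative f (at x) v)" for v
    by (rule Suc.IH) (use Suc.prems in force)
  ultimately show ?case by simp
qed

lemma C_k_on_const: "C_k_on k S (\<lambda>x. c)"
  by (induction k arbitrary: c) auto

lemma C_k_on_bounded_linear_compose:
  assumes S: "open S" and L: "bounded_linear L" and "C_k_on k S f"
  shows "C_k_on k S (\<lambda>x. L (f x))"
  using assms(3)
proof (induction k arbitrary: f)
  case 0
  then show ?case by (simp add: bounded_linear.continuous_on[OF L])
next
  case (Suc k)
  have D: "((\<lambda>x. L (f x)) has_derivative (\<lambda>v. L (frechet_derivative f (at x) v))) (at x)"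
    if "x \<in> S" for x
    using Suc.prems that by (intro bounded_linear.has_derivative[OF L] has_derivative_frechet) auto
  then show ?case using Suc by (intro C_k_on_SucI[OF S D]) auto
qed

lemma C_k_on_bounded_linear:
  assumes "bounded_linear L"
  shows "C_k_on k S L"
proof (cases k)
  case 0
  with assms show ?thesis by (simp add: linear_continuous_on)
next
  case (Suc j)
  have "frechet_derivative L (at x) = L" for x
    using assms bounded_linear_imp_has_derivative frechet_derivative_at by metis
  with Suc assms show ?thesis
    by (auto simp: C_k_on_const differentiable_def intro: bounded_linear_imp_has_derivative)
qed

lemma C_k_on_add:
  assumes S: "open S" and "C_k_on k S f" "C_k_on k S g"
  shows "C_k_on k S (\<lambda>x. f x + g x)"
  using assms(2,3)
proof (induction k arbitrary: f g)
  case 0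
  then show ?case by (simp add: continuous_on_add)
next
  case (Suc k)
  have D: "((\<lambda>x. f x + g x) has_derivative
     (\<lambda>v. frechet_derivative f (at x) v + frechet_derivative g (at x) v)) (at x)"
    if "x \<in> S" for x
    using Suc.prems that by (intro has_derivative_add has_derivative_frechet) auto
  then show ?case using Suc by (intro C_k_on_SucI[OF S D]) auto
qed

lemma C_k_on_sum:
  assumes S: "open S" and "\<And>i. i \<in> I \<Longrightarrow> C_k_on k S (f i)"
  shows "C_k_on k S (\<lambda>x. \<Sum>i\<in>I. f i x)"
  using assms(2) by (induction I rule: infinite_finite_induct) (auto intro!: C_k_on_const C_k_on_add S)

text \<open>The product rule yields two products in which one factor is differentiated and the other
  merely demoted from \<open>Suc k\<close> to \<open>k\<close>, hence the induction over all pairs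
  \<open>f\<close>, \<open>g\<close>.\<close>

lemma C_k_on_bounded_bilinear:
  assumes S: "open S" and M: "bounded_bilinear M" and "C_k_on k S f" "C_k_on k S g"
  shows "C_k_on k S (\<lambda>x. M (f x) (g x))"
  using assms(3,4)
proof (induction k arbitrary: f g)
  case 0
  then show ?case by (simp add: bounded_bilinear.continuous_on[OF M])
next
  case (Suc k)
  have D: "((\<lambda>x. M (f x) (g x)) has_derivative
     (\<lambda>v. M (f x) (frechet_derivative g (at x) v) + M (frechet_derivative f (at x) v) (g x))) (at x)"
    if "x \<in> S" for x
    using Suc.prems that by (intro bounded_bilinear.FDERIV[OF M] has_derivative_frechet) auto
  moreover have "C_k_on k S (\<lambda>x. M (f x) (frechet_derivative g (at x) v) + M (frechet_derivative f (at x) v) (g x))" for v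
    using Suc.prems C_k_on_Suc_imp[OF Suc.prems(1)] C_k_on_Suc_imp[OF Suc.prems(2)]
    by (intro C_k_on_add S Suc.IH) auto
  ultimately show ?case by (intro C_k_on_SucI[OF S D]) auto
qed

lemma linear_basis_expand:
  fixes L :: "'a::euclidean_space \<Rightarrow> 'b::real_vector"
  assumes "linear L"
  shows "L v = (\<Sum>b\<in>Basis. (v \<bullet> b) *\<^sub>R L b)"
  by (subst euclidean_representation[of v, symmetric])
     (simp add: linear_sum[OF assms] linear_scale[OF assms])

text \<open>The chain rule applies the derivative of \<open>f\<close> to a vector varying with
  \<open>x\<close>, whereas \<open>C_k_on\<close> only controls derivatives in fixed directions.
  Expanding that vector in \<open>Basis\<close> leaves sums of products whose factors are covered by
  the induction hypothesis, applied to the directional derivatives of \<open>f\<close>.\<close>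

lemma C_k_on_compose:
  fixes g :: "'a::euclidean_space \<Rightarrow> 'b::euclidean_space" and f :: "'b \<Rightarrow> 'c::real_normed_vector"
  assumes S: "open S" and T: "open T" and g: "g ` S \<subseteq> T" and "C_k_on k T f" "C_k_on k S g"
  shows "C_k_on k S (\<lambda>x. f (g x))"
  using assms(4,5)
proof (induction k arbitrary: f)
  case 0
  then show ?case using continuous_on_compose2[of T f S g] g by simp
next
  case (Suc k)
  have D: "((\<lambda>x. f (g x)) has_derivative
     (\<lambda>v. frechet_derivative f (at (g x)) (frechet_derivative g (at x) v))) (at x)"
    if "x \<in> S" for x
    by (rule has_derivative_compose[OF has_derivative_frechet has_derivative_frechet]) (use Suc.prems that g in auto)
  have E: "frechet_derivative f (at (g x)) (frechet_derivative g (at x) v) =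
      (\<Sum>b\<in>Basis. (frechet_derivative g (at x) v \<bullet> b) *\<^sub>R frechet_derivative f (at (g x)) b)"
    if "x \<in> S" for x v
    by (rule linear_basis_expand, rule linear_frechet_derivative) (use Suc.prems that g in auto)
  have "C_k_on k S (\<lambda>x. \<Sum>b\<in>Basis. (frechet_derivative g (at x) v \<bullet> b) *\<^sub>R frechet_derivative f (at (g x)) b)" for v
    using Suc.prems C_k_on_Suc_imp[OF Suc.prems(2)]
    by (intro C_k_on_sum S C_k_on_bounded_bilinear[OF S bounded_bilinear_scaleR]
        C_k_on_bounded_linear_compose[OF S bounded_linear_inner_left] Suc.IH[of "\<lambda>y. frechet_derivative f (at y) _"]) auto
  then have "C_k_on k S (\<lambda>x. frechet_derivative f (at (g x)) (frechet_derivative g (at x) v))" for v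
    using C_k_on_cong[OF S E] by simp
  then show ?case by (intro C_k_on_SucI[OF S D]) auto
qed

lemma smooth_on_cong:
  "open S \<Longrightarrow> (\<And>y. y \<in> S \<Longrightarrow> f y = g y) \<Longrightarrow> smooth_on S f \<longleftrightarrow> smooth_on S g"
  by (simp add: smooth_on_def C_k_on_cong[of S f g])

lemma smooth_on_subset: "smooth_on S f \<Longrightarrow> T \<subseteq> S \<Longrightarrow> smooth_on T f"
  by (auto simp: smooth_on_def intro: C_k_on_subset)

lemma smooth_on_local:
  "(\<And>x. x \<in> S \<Longrightarrow> \<exists>T. open T \<and> x \<in> T \<and> smooth_on T f) \<Longrightarrow> smooth_on S f"
  unfolding smooth_on_def by (intro allI C_k_on_local) blast

lemma smooth_on_const: "smooth_on S (\<lambda>x. c)"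
  by (simp add: smooth_on_def C_k_on_const)

lemma smooth_on_bounded_linear_compose:
  "open S \<Longrightarrow> bounded_linear L \<Longrightarrow> smooth_on S f \<Longrightarrow> smooth_on S (\<lambda>x. L (f x))"
  by (simp add: smooth_on_def C_k_on_bounded_linear_compose)

lemma smooth_on_bounded_linear: "bounded_linear L \<Longrightarrow> smooth_on S L"
  by (simp add: smooth_on_def C_k_on_bounded_linear)

lemma smooth_on_sum:
  "open S \<Longrightarrow> (\<And>i. i \<in> I \<Longrightarrow> smooth_on S (f i)) \<Longrightarrow> smooth_on S (\<lambda>x. \<Sum>i\<in>I. f i x)"
  by (simp add: smooth_on_def C_k_on_sum)

lemma smooth_on_add:
  "open S \<Longrightarrow> smooth_on S f \<Longrightarrow> smooth_on S g \<Longrightarrow> smooth_on S (\<lambda>x. f x + g x)"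
  by (simp add: smooth_on_def C_k_on_add)

lemma smooth_on_bounded_bilinear:
  "open S \<Longrightarrow> bounded_bilinear M \<Longrightarrow> smooth_on S f \<Longrightarrow> smooth_on S g \<Longrightarrow> smooth_on S (\<lambda>x. M (f x) (g x))"
  by (simp add: smooth_on_def C_k_on_bounded_bilinear)

lemma smooth_on_compose:
  fixes g :: "'a::euclidean_space \<Rightarrow> 'b::euclidean_space" and f :: "'b \<Rightarrow> 'c::real_normed_vector"
  shows "open S \<Longrightarrow> open T \<Longrightarrow> g ` S \<subseteq> T \<Longrightarrow> smooth_on T f \<Longrightarrow> smooth_on S g
    \<Longrightarrow> smooth_on S (\<lambda>x. f (g x))"
  by (simp add: smooth_on_def C_k_on_compose)

lemma smooth_on_Pair:
  assumes S: "open S" and "smooth_on S f" "smooth_on S g"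
  shows "smooth_on S (\<lambda>x. (f x, g x))"
proof -
  have b1: "bounded_linear (\<lambda>a. (a, 0))" and b2: "bounded_linear (\<lambda>a. (0, a))"
    by (intro bounded_linear_Pair bounded_linear_ident bounded_linear_zero)+
  have "smooth_on S (\<lambda>x. (f x, 0) + (0, g x))"
    by (rule smooth_on_add[OF S smooth_on_bounded_linear_compose[OF S b1 assms(2)]
        smooth_on_bounded_linear_compose[OF S b2 assms(3)]])
  then show ?thesis by simp
qed

lemma smooth_on_imp_differentiable: "smooth_on S f \<Longrightarrow> x \<in> S \<Longrightarrow> f differentiable (at x)"
  unfolding smooth_on_def by (drule spec[of _ "Suc 0"]) simp

lemma smooth_on_imp_continuous_on: "smooth_on S f \<Longrightarrow> continuous_on S f"
  unfolding smooth_on_def by (drule spec[of _ 0]) simp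

lemma smooth_on_frechet_derivative:
  "smooth_on S f \<Longrightarrow> smooth_on S (\<lambda>x. frechet_derivative f (at x) v)"
  unfolding smooth_on_def by (rule allI, drule_tac x = "Suc k" in spec) simp

lemma smooth_on_frechet_derivative_apply:
  fixes g :: "'a::euclidean_space \<Rightarrow> 'b::euclidean_space" and f :: "'b \<Rightarrow> 'c::real_normed_vector"
  assumes S: "open S" and T: "open T" and g: "g ` S \<subseteq> T"
    and f: "smooth_on T f" and sg: "smooth_on S g" and h: "smooth_on S h"
  shows "smooth_on S (\<lambda>x. frechet_derivative f (at (g x)) (h x))"
proof -
  have "smooth_on S (\<lambda>x. \<Sum>b\<in>Basis. (h x \<bullet> b) *\<^sub>R frechet_derivative f (at (g x)) b)"
    by (intro smooth_on_sum S smooth_on_bounded_bilinear[OF S bounded_bilinear_scaleR]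
        smooth_on_bounded_linear_compose[OF S bounded_linear_inner_left] h
        smooth_on_compose[OF S T g _ sg, of "\<lambda>y. frechet_derivative f (at y) _"]
        smooth_on_frechet_derivative f)
  moreover have "frechet_derivative f (at (g x)) (h x) =
      (\<Sum>b\<in>Basis. (h x \<bullet> b) *\<^sub>R frechet_derivative f (at (g x)) b)" if "x \<in> S" for x
    by (rule linear_basis_expand, rule linear_frechet_derivative, rule smooth_on_imp_differentiable[OF f])
       (use that g in auto)
  ultimately show ?thesis by (simp cong: smooth_on_cong[OF S])
qed

section \<open>Symmetry of second derivatives\<close>

lemma second_difference_mean_value:
  fixes f :: "'a::euclidean_space \<Rightarrow> real"
  assumes S: "open S" and f: "smooth_on S f" and s: "s > 0"
    and in_S: "\<And>a b. 0 \<le> a \<Longrightarrow> a \<le> s \<Longrightarrow> 0 \<le> b \<Longrightarrow> b \<le> s \<Longrightarrow> x + a *\<^sub>R u + b *\<^sub>R v \<in> S"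
  shows "\<exists>a b. 0 \<le> a \<and> a \<le> s \<and> 0 \<le> b \<and> b \<le> s \<and>
    f (x + s *\<^sub>R u + s *\<^sub>R v) - f (x + s *\<^sub>R u) - f (x + s *\<^sub>R v) + f x =
    s * s * frechet_derivative (\<lambda>y. frechet_derivative f (at y) u) (at (x + a *\<^sub>R u + b *\<^sub>R v)) v"
proof -
  have line: "((\<lambda>t. g (c t)) has_derivative (\<lambda>h. h * frechet_derivative g (at (c t)) w)) (at t within A)"
    if "smooth_on S g" "c t \<in> S" "(c has_derivative (\<lambda>h. h *\<^sub>R w)) (at t)"
    for g :: "'a \<Rightarrow> real" and c t w A
  proof -
    have d: "g differentiable (at (c t))" using that smooth_on_imp_differentiable by blast
    have "((\<lambda>t. g (c t)) has_derivative (\<lambda>h. frechet_derivative g (at (c t)) (h *\<^sub>R w))) (at t)"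
      by (rule has_derivative_compose[OF that(3) has_derivative_frechet[OF d]])
    then show ?thesis
      using linear_scale[OF linear_frechet_derivative[OF d]]
      by (auto intro: has_derivative_at_withinI)
  qed
  let ?D = "\<lambda>y. frechet_derivative f (at y) u"
  \<comment> \<open>Mean value theorem along \<open>u\<close> for the increment of \<open>f\<close>
    in direction \<open>v\<close>. The summands with factor 0 are kept so that every point has the
    form covered by \<open>in_S\<close>.\<close>
  have "\<exists>a\<in>{0..s}. (f (x + s *\<^sub>R u + s *\<^sub>R v) - f (x + s *\<^sub>R u + 0 *\<^sub>R v))
      - (f (x + 0 *\<^sub>R u + s *\<^sub>R v) - f (x + 0 *\<^sub>R u + 0 *\<^sub>R v))
      = (s - 0) * ?D (x + a *\<^sub>R u + s *\<^sub>R v) - (s - 0) * ?D (x + a *\<^sub>R u + 0 *\<^sub>R v)"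
    by (rule mvt_very_simple)
       (use s in_S in_S[of _ 0] in_S[of _ s] in \<open>auto intro!: has_derivative_diff line[OF f] derivative_eq_intros\<close>)
  then obtain a where a: "0 \<le> a" "a \<le> s" and
    e: "f (x + s *\<^sub>R u + s *\<^sub>R v) - f (x + s *\<^sub>R u) - f (x + s *\<^sub>R v) + f x
      = s * (?D (x + a *\<^sub>R u + s *\<^sub>R v) - ?D (x + a *\<^sub>R u + 0 *\<^sub>R v))"
    by (auto simp: algebra_simps)
  have "\<exists>b\<in>{0..s}. ?D (x + a *\<^sub>R u + s *\<^sub>R v) - ?D (x + a *\<^sub>R u + 0 *\<^sub>R v)
      = (s - 0) * frechet_derivative ?D (at (x + a *\<^sub>R u + b *\<^sub>R v)) v"
    by (rule mvt_very_simple)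
       (use s a in \<open>auto intro!: line[OF smooth_on_frechet_derivative[OF f]] in_S derivative_eq_intros\<close>)
  then obtain b where "0 \<le> b" "b \<le> s" "?D (x + a *\<^sub>R u + s *\<^sub>R v) - ?D (x + a *\<^sub>R u + 0 *\<^sub>R v)
      = s * frechet_derivative ?D (at (x + a *\<^sub>R u + b *\<^sub>R v)) v" by auto
  with a e show ?thesis by (intro exI[of _ a] exI[of _ b]) simp
qed

text \<open>The second difference of \<open>f\<close> over a small parallelogram is symmetric in
  \<open>u\<close> and \<open>v\<close>, and by the mean value theorem it is \<open>s * s\<close>
  times either mixed derivative at some nearby point. Continuity of both mixed derivatives then
  excludes a gap at \<open>x\<close>.\<close>

lemma symmetric_second_derivative_real:
  fixes f :: "'a::euclidean_space \<Rightarrow> real"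
  assumes S: "open S" and f: "smooth_on S f" and x: "x \<in> S"
  shows "frechet_derivative (\<lambda>y. frechet_derivative f (at y) u) (at x) v =
         frechet_derivative (\<lambda>y. frechet_derivative f (at y) v) (at x) u"
    (is "?A x = ?B x")
proof (rule ccontr)
  assume ne: "?A x \<noteq> ?B x"
  \<comment> \<open>Half of the gap: two errors below \<open>e\<close> cannot bridge it.\<close>
  define e where "e = \<bar>?A x - ?B x\<bar> / 2"
  have e: "e > 0" using ne by (simp add: e_def)
  have "continuous_on S ?A" "continuous_on S ?B"
    by (intro smooth_on_imp_continuous_on smooth_on_frechet_derivative f)+
  then have "continuous (at x) ?A" "continuous (at x) ?B"
    using S x continuous_on_eq_continuous_at by blast+
  then obtain d1 d2 where d1: "d1 > 0" "\<And>y. dist y x < d1 \<Longrightarrow> dist (?A y) (?A x) < e"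
    and d2: "d2 > 0" "\<And>y. dist y x < d2 \<Longrightarrow> dist (?B y) (?B x) < e"
    using e unfolding continuous_at_eps_delta by metis
  obtain d3 where d3: "d3 > 0" "ball x d3 \<subseteq> S" using S x openE by blast
  define d where "d = min d1 (min d2 d3)"
  have d: "d > 0" using d1 d2 d3 by (simp add: d_def)
  \<comment> \<open>Small enough for the parallelogram with sides \<open>s u\<close>,
    \<open>s v\<close> to stay within distance \<open>d\<close> of \<open>x\<close>; the summand 1
    keeps the denominator positive when \<open>u\<close> and \<open>v\<close> vanish.\<close>
  define s where "s = d / (2 * (norm u + norm v + 1))"
  have s: "s > 0" using d by (simp add: s_def add_nonneg_pos)
  have near: "dist (x + a *\<^sub>R u + b *\<^sub>R v) x < d" if "0 \<le> a" "a \<le> s" "0 \<le> b" "b \<le> s" for a b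
  proof -
    have "dist (x + a *\<^sub>R u + b *\<^sub>R v) x = norm (a *\<^sub>R u + b *\<^sub>R v)" by (simp add: dist_norm)
    also have "\<dots> \<le> a * norm u + b * norm v"
      using norm_triangle_ineq[of "a *\<^sub>R u" "b *\<^sub>R v"] that by simp
    also have "\<dots> \<le> s * norm u + s * norm v"
      using that by (intro add_mono mult_right_mono) auto
    also have "\<dots> < s * (2 * (norm u + norm v + 1))"
      using s by (simp add: algebra_simps add_strict_increasing)
    also have "\<dots> = d"
      unfolding s_def by (smt (verit) norm_ge_zero nonzero_eq_divide_eq)
    finally show ?thesis .
  qed
  then have in_S: "x + a *\<^sub>R u + b *\<^sub>R v \<in> S" if "0 \<le> a" "a \<le> s" "0 \<le> b" "b \<le> s" for a b
    using that d3 by (auto simp: d_def dist_commute subset_iff)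
  then have in_S': "x + a *\<^sub>R v + b *\<^sub>R u \<in> S" if "0 \<le> a" "a \<le> s" "0 \<le> b" "b \<le> s" for a b
    using that by (metis add.assoc add.commute)
  from second_difference_mean_value[OF S f s in_S] obtain a b where ab: "0 \<le> a" "a \<le> s" "0 \<le> b" "b \<le> s"
    and 1: "f (x + s *\<^sub>R u + s *\<^sub>R v) - f (x + s *\<^sub>R u) - f (x + s *\<^sub>R v) + f x
      = s * s * ?A (x + a *\<^sub>R u + b *\<^sub>R v)" by blast
  from second_difference_mean_value[OF S f s in_S'] obtain a' b' where ab': "0 \<le> a'" "a' \<le> s" "0 \<le> b'" "b' \<le> s"
    and 2: "f (x + s *\<^sub>R v + s *\<^sub>R u) - f (x + s *\<^sub>R v) - f (x + s *\<^sub>R u) + f x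
      = s * s * ?B (x + a' *\<^sub>R v + b' *\<^sub>R u)" by blast
  have "x + s *\<^sub>R v + s *\<^sub>R u = x + s *\<^sub>R u + s *\<^sub>R v" by simp
  from 1 2[unfolded this] have "s * s * ?A (x + a *\<^sub>R u + b *\<^sub>R v) = s * s * ?B (x + a' *\<^sub>R v + b' *\<^sub>R u)"
    by linarith
  then have "?A (x + a *\<^sub>R u + b *\<^sub>R v) = ?B (x + a' *\<^sub>R v + b' *\<^sub>R u)" using s by (metis mult_cancel_left mult_eq_0_iff less_irrefl)
  moreover have "dist (?A (x + a *\<^sub>R u + b *\<^sub>R v)) (?A x) < e"
    using near[OF ab] by (intro d1) (simp add: d_def)
  moreover have "dist (?B (x + a' *\<^sub>R v + b' *\<^sub>R u)) (?B x) < e"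
  proof (rule d2(2))
    have "x + a' *\<^sub>R v + b' *\<^sub>R u = x + b' *\<^sub>R u + a' *\<^sub>R v" by simp
    with near[OF ab'(3,4,1,2)] show "dist (x + a' *\<^sub>R v + b' *\<^sub>R u) x < d2"
      by (simp only: d_def min_less_iff_conj)
  qed
  ultimately have "dist (?A x) (?B x) < \<bar>?A x - ?B x\<bar>"
    unfolding e_def by (simp only: dist_triangle_half_r)
  then show False by (simp add: dist_real_def)
qed

lemma symmetric_second_derivative:
  fixes f :: "'a::euclidean_space \<Rightarrow> 'b::euclidean_space"
  assumes S: "open S" and f: "smooth_on S f" and x: "x \<in> S"
  shows "frechet_derivative (\<lambda>y. frechet_derivative f (at y) u) (at x) v =
         frechet_derivative (\<lambda>y. frechet_derivative f (at y) v) (at x) u"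
proof (rule euclidean_eqI)
  fix b :: 'b
  have inner: "frechet_derivative (\<lambda>y. g y \<bullet> b) (at y) w = frechet_derivative g (at y) w \<bullet> b"
    if "smooth_on S g" "y \<in> S" for g :: "'a \<Rightarrow> 'b" and y w
    using frechet_derivative_at[OF bounded_linear.has_derivative[OF bounded_linear_inner_left
          has_derivative_frechet[OF smooth_on_imp_differentiable[OF that]]], of b, symmetric] by simp
  have D: "frechet_derivative (\<lambda>y. frechet_derivative f (at y) u) (at x) v \<bullet> b =
    frechet_derivative (\<lambda>y. frechet_derivative (\<lambda>y. f y \<bullet> b) (at y) u) (at x) v" for u v
  proof -
    have "frechet_derivative (\<lambda>y. frechet_derivative f (at y) u) (at x) v \<bullet> b =
      frechet_derivative (\<lambda>y. frechet_derivative f (at y) u \<bullet> b) (at x) v"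
      using inner[OF smooth_on_frechet_derivative[OF f] x] by simp
    also have "\<dots> = frechet_derivative (\<lambda>y. frechet_derivative (\<lambda>y. f y \<bullet> b) (at y) u) (at x) v"
      by (subst frechet_derivative_cong[OF S x]) (auto simp: inner[OF f])
    finally show ?thesis .
  qed
  show "frechet_derivative (\<lambda>y. frechet_derivative f (at y) u) (at x) v \<bullet> b =
         frechet_derivative (\<lambda>y. frechet_derivative f (at y) v) (at x) u \<bullet> b"
    unfolding D
    by (rule symmetric_second_derivative_real[OF S _ x])
       (rule smooth_on_bounded_linear_compose[OF S bounded_linear_inner_left f])
qed

section \<open>Smooth maps and differentials\<close>

abbreviation smooth_fun ::
    "('a::topological_space, 'e::euclidean_space) chart set \<Rightarrow> 'a set \<Rightarrow> ('a \<Rightarrow> 'f::euclidean_space) \<Rightarrow> bool" where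
  "smooth_fun A U f \<equiv> smooth_map A euclidean_atlas U f"

abbreviation dfun ::
    "('a, 'e::euclidean_space) chart set \<Rightarrow> ('a \<Rightarrow> 'f::euclidean_space) \<Rightarrow> 'a \<Rightarrow> 'e \<Rightarrow> 'f" where
  "dfun A \<equiv> differential A euclidean_atlas"

lemma
  assumes "smooth_atlas A" "(D, \<phi>) \<in> A"
  shows chart_open: "open D"
    and chart_image_open: "open (\<phi> ` D)"
    and chart_continuous: "continuous_on D \<phi>"
    and chart_inv_continuous: "continuous_on (\<phi> ` D) (inv_into D \<phi>)"
    and chart_inv: "x \<in> D \<Longrightarrow> inv_into D \<phi> (\<phi> x) = x"
  using assms unfolding smooth_atlas_def homeomorphism_def by fast+

lemma chart_inv_right: "y \<in> \<phi> ` D \<Longrightarrow> \<phi> (inv_into D \<phi> y) = y"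
  by (rule f_inv_into_f)

lemma chart_image_Int:
  assumes "smooth_atlas A" "(D, \<phi>) \<in> A"
  shows "\<phi> ` (D \<inter> U) = \<phi> ` D \<inter> inv_into D \<phi> -` U"
  using chart_inv[OF assms] by (force simp: image_iff)

lemma chart_image_Int_open:
  assumes A: "smooth_atlas A" "(D, \<phi>) \<in> A" and "open U"
  shows "open (\<phi> ` (D \<inter> U))"
  unfolding chart_image_Int[OF A]
  by (rule continuous_open_preimage[OF chart_inv_continuous[OF A] chart_image_open[OF A] assms(3)])

lemma chart_transition:
  "smooth_atlas A \<Longrightarrow> (D, \<phi>) \<in> A \<Longrightarrow> (D', \<phi>') \<in> A \<Longrightarrow> smooth_on (\<phi> ` (D \<inter> D')) (\<phi>' \<circ> inv_into D \<phi>)"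
  unfolding smooth_atlas_def by fast

lemma chart_exists:
  assumes "smooth_atlas A"
  obtains D \<phi> where "(D, \<phi>) \<in> A" "z \<in> D"
proof -
  have "z \<in> (\<Union>(D, \<phi>)\<in>A. D)" using assms unfolding smooth_atlas_def by simp
  then show thesis using that by auto
qed

lemma chart_at_props:
  assumes "smooth_atlas A" and "chart_at A z = (D, \<phi>)"
  shows "(D, \<phi>) \<in> A" "z \<in> D"
proof -
  obtain D' \<phi>' where "(D', \<phi>') \<in> A" "z \<in> D'" using chart_exists[OF assms(1)] .
  then have "\<exists>c. c \<in> A \<and> z \<in> fst c" by force
  from someI_ex[OF this] have "chart_at A z \<in> A \<and> z \<in> fst (chart_at A z)"
    by (simp add: chart_at_def)
  with assms(2) show "(D, \<phi>) \<in> A" "z \<in> D" by simp_all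
qed

lemma inv_into_UNIV_id [simp]: "inv_into UNIV id = id" "inv_into UNIV (\<lambda>x. x) = (\<lambda>x. x)"
  by (auto simp: fun_eq_iff intro: inv_into_f_eq)

lemma in_euclidean_atlas [simp]: "c \<in> euclidean_atlas \<longleftrightarrow> c = (UNIV, id)"
  by (simp add: euclidean_atlas_def)

lemma ball_euclidean_atlas [simp]: "(\<forall>c\<in>euclidean_atlas. P c) \<longleftrightarrow> P (UNIV, id)"
  by (simp add: euclidean_atlas_def)

lemma smooth_atlas_euclidean: "smooth_atlas euclidean_atlas"
proof -
  have "smooth_on UNIV (id :: 'a \<Rightarrow> 'a)"
    using smooth_on_bounded_linear[OF bounded_linear_ident] by (simp add: id_def)
  then show ?thesis
    by (simp add: smooth_atlas_def homeomorphism_def) (simp add: euclidean_atlas_def)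
qed

lemma chart_at_euclidean [simp]: "chart_at euclidean_atlas z = (UNIV, id)"
  by (cases "chart_at euclidean_atlas z") (use chart_at_props(1)[OF smooth_atlas_euclidean] in force)

lemma smooth_on_congI:
  "smooth_on S f \<Longrightarrow> open S \<Longrightarrow> (\<And>y. y \<in> S \<Longrightarrow> f y = g y) \<Longrightarrow> smooth_on S g"
  using smooth_on_cong[of S f g] by simp

section \<open>Restriction, gluing and composition of smooth maps\<close>

lemma smooth_map_continuous: "smooth_map A B U f \<Longrightarrow> continuous_on U f"
  by (simp add: smooth_map_def)

lemma smooth_map_in_charts:
  assumes "smooth_map A B U f" "(D, \<phi>) \<in> A" "(D', \<phi>') \<in> B"
  shows "smooth_on (\<phi> ` (D \<inter> U \<inter> f -` D')) (\<phi>' \<circ> f \<circ> inv_into D \<phi>)"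
  using assms unfolding smooth_map_def by fast

lemma smooth_map_subset:
  assumes f: "smooth_map A B U f" and "V \<subseteq> U"
  shows "smooth_map A B V f"
  unfolding smooth_map_def
proof (intro conjI ballI; (clarify)?)
  show "continuous_on V f" using smooth_map_continuous[OF f] assms(2) by (rule continuous_on_subset)
next
  fix D \<phi> D' \<phi>' assume "(D, \<phi>) \<in> A" "(D', \<phi>') \<in> B"
  from smooth_map_in_charts[OF f this]
  show "smooth_on (\<phi> ` (D \<inter> V \<inter> f -` D')) (\<phi>' \<circ> f \<circ> inv_into D \<phi>)"
    by (rule smooth_on_subset) (use assms(2) in auto)
qed

lemma open_Int_vimage:
  "continuous_on U f \<Longrightarrow> open U \<Longrightarrow> open V \<Longrightarrow> open (U \<inter> f -` V)"
  using continuous_open_preimage by blast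

lemma smooth_map_local:
  assumes A: "smooth_atlas A" and B: "smooth_atlas B"
    and loc: "\<And>x. x \<in> U \<Longrightarrow> \<exists>N. open N \<and> x \<in> N \<and> smooth_map A B N f"
  shows "smooth_map A B U f"
  unfolding smooth_map_def
proof (intro conjI ballI; (clarify)?)
  have "continuous (at x) f" if "x \<in> U" for x
  proof -
    obtain N where "open N" "x \<in> N" "smooth_map A B N f" using loc[OF \<open>x \<in> U\<close>] by auto
    then show ?thesis using smooth_map_continuous[of A B N f] by (simp add: continuous_on_eq_continuous_at)
  qed
  then show "continuous_on U f" by (simp add: continuous_at_imp_continuous_on)
next
  fix D \<phi> D' \<phi>' assume c: "(D, \<phi>) \<in> A" "(D', \<phi>') \<in> B"
  show "smooth_on (\<phi> ` (D \<inter> U \<inter> f -` D')) (\<phi>' \<circ> f \<circ> inv_into D \<phi>)"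
  proof (rule smooth_on_local)
    fix y assume "y \<in> \<phi> ` (D \<inter> U \<inter> f -` D')"
    then obtain x where x: "y = \<phi> x" "x \<in> D" "x \<in> U" "f x \<in> D'" by auto
    obtain N where N: "open N" "x \<in> N" "smooth_map A B N f" using loc[OF \<open>x \<in> U\<close>] by auto
    have "open (N \<inter> f -` D')"
      by (rule open_Int_vimage[OF smooth_map_continuous[OF N(3)] N(1) chart_open[OF B c(2)]])
    then have "open (\<phi> ` (D \<inter> (N \<inter> f -` D')))" by (rule chart_image_Int_open[OF A c(1)])
    moreover have "y \<in> \<phi> ` (D \<inter> (N \<inter> f -` D'))" using x N by auto
    ultimately show "\<exists>T. open T \<and> y \<in> T \<and> smooth_on T (\<phi>' \<circ> f \<circ> inv_into D \<phi>)"
      using smooth_map_in_charts[OF N(3) c] by (auto simp: Int_assoc)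
  qed
qed

lemma smooth_map_cong:
  assumes A: "smooth_atlas A" and U: "open U" and B: "smooth_atlas B"
    and f: "smooth_map A B U f" and eq: "\<And>x. x \<in> U \<Longrightarrow> f x = g x"
  shows "smooth_map A B U g"
  unfolding smooth_map_def
proof (intro conjI ballI; (clarify)?)
  show "continuous_on U g" using smooth_map_continuous[OF f] eq by (simp cong: continuous_on_cong)
next
  fix D \<phi> D' \<phi>' assume c: "(D, \<phi>) \<in> A" "(D', \<phi>') \<in> B"
  have *: "D \<inter> U \<inter> g -` D' = D \<inter> U \<inter> f -` D'" using eq by auto
  have "open (\<phi> ` (D \<inter> (U \<inter> f -` D')))"
    by (intro chart_image_Int_open[OF A c(1)] open_Int_vimage smooth_map_continuous[OF f] U chart_open[OF B c(2)])
  then have o: "open (\<phi> ` (D \<inter> U \<inter> f -` D'))" by (simp only: Int_assoc)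
  show "smooth_on (\<phi> ` (D \<inter> U \<inter> g -` D')) (\<phi>' \<circ> g \<circ> inv_into D \<phi>)"
    unfolding *
  proof (rule smooth_on_congI[OF smooth_map_in_charts[OF f c] o])
    fix y assume "y \<in> \<phi> ` (D \<inter> U \<inter> f -` D')"
    then show "(\<phi>' \<circ> f \<circ> inv_into D \<phi>) y = (\<phi>' \<circ> g \<circ> inv_into D \<phi>) y"
      using chart_inv[OF A c(1)] eq by auto
  qed
qed

text \<open>Every other coordinate expression of \<open>f\<close> is the given one with a transition
  map composed on either side.\<close>

lemma smooth_map_single_chart:
  assumes A: "smooth_atlas A" and B: "smooth_atlas B" and c: "(D, \<phi>) \<in> A" "(E, \<psi>) \<in> B"
    and U: "open U" "U \<subseteq> D" "f ` U \<subseteq> E" and cont: "continuous_on U f"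
    and s: "smooth_on (\<phi> ` U) (\<psi> \<circ> f \<circ> inv_into D \<phi>)"
  shows "smooth_map A B U f"
  unfolding smooth_map_def
proof (intro conjI ballI; (clarify)?)
  show "continuous_on U f" by fact
next
  fix D' \<phi>' E' \<psi>' assume c': "(D', \<phi>') \<in> A" "(E', \<psi>') \<in> B"
  let ?N = "U \<inter> f -` E'"
  have N: "open ?N" by (rule open_Int_vimage[OF cont U(1) chart_open[OF B c'(2)]])
  have oN: "open (\<phi>' ` (D' \<inter> ?N))" by (rule chart_image_Int_open[OF A c'(1) N])
  have oU: "open (\<phi> ` (D \<inter> ?N))" by (rule chart_image_Int_open[OF A c(1) N])
  have oE: "open (\<psi> ` (E \<inter> E'))" by (rule chart_image_Int_open[OF B c(2) chart_open[OF B c'(2)]])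
  have 1: "smooth_on (\<phi>' ` (D' \<inter> ?N)) (\<phi> \<circ> inv_into D' \<phi>')"
    using chart_transition[OF A c'(1) c(1)] by (rule smooth_on_subset) (use U in auto)
  have 2: "smooth_on (\<phi> ` (D \<inter> ?N)) (\<psi> \<circ> f \<circ> inv_into D \<phi>)"
    using s by (rule smooth_on_subset) auto
  note t3 = chart_transition[OF B c(2) c'(2)]
  have 23: "smooth_on (\<phi> ` (D \<inter> ?N)) (\<lambda>y. (\<psi>' \<circ> inv_into E \<psi>) ((\<psi> \<circ> f \<circ> inv_into D \<phi>) y))"
    by (rule smooth_on_compose[OF oU oE _ t3 2]) (use U chart_inv[OF A c(1)] in auto)
  have 123: "smooth_on (\<phi>' ` (D' \<inter> ?N))
     (\<lambda>y. (\<psi>' \<circ> inv_into E \<psi>) ((\<psi> \<circ> f \<circ> inv_into D \<phi>) ((\<phi> \<circ> inv_into D' \<phi>') y)))"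
    by (rule smooth_on_compose[OF oN oU _ 23 1]) (use U chart_inv[OF A c'(1)] in auto)
  have "(\<psi>' \<circ> inv_into E \<psi>) ((\<psi> \<circ> f \<circ> inv_into D \<phi>) ((\<phi> \<circ> inv_into D' \<phi>') y)) =
      (\<psi>' \<circ> f \<circ> inv_into D' \<phi>') y" if "y \<in> \<phi>' ` (D' \<inter> ?N)" for y
  proof -
    from that obtain x where x: "y = \<phi>' x" "x \<in> D'" "x \<in> U" "f x \<in> E'" by auto
    then have "x \<in> D" "f x \<in> E" using U by auto
    with x show ?thesis
      by (simp add: chart_inv[OF A c'(1)] chart_inv[OF A c(1)] chart_inv[OF B c(2)])
  qed
  then have "smooth_on (\<phi>' ` (D' \<inter> ?N)) (\<psi>' \<circ> f \<circ> inv_into D' \<phi>')"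
    by (rule smooth_on_congI[OF 123 oN])
  then show "smooth_on (\<phi>' ` (D' \<inter> U \<inter> f -` E')) (\<psi>' \<circ> f \<circ> inv_into D' \<phi>')"
    by (simp add: Int_assoc)
qed

text \<open>Near each point one chart in each of the three manifolds suffices, and in these charts
  the composite is a composite of smooth maps of Euclidean spaces.\<close>

lemma smooth_map_compose:
  assumes A: "smooth_atlas A" and B: "smooth_atlas B" and C: "smooth_atlas C"
    and U: "open U" and V: "open V" and f: "smooth_map A B U f" and g: "smooth_map B C V g"
    and sub: "f ` U \<subseteq> V"
  shows "smooth_map A C U (\<lambda>x. g (f x))"
proof (rule smooth_map_local[OF A C])
  fix x assume x: "x \<in> U"
  obtain D \<phi> where c: "(D, \<phi>) \<in> A" "x \<in> D" using chart_exists[OF A] .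
  obtain E \<psi> where e: "(E, \<psi>) \<in> B" "f x \<in> E" using chart_exists[OF B] .
  obtain G \<gamma> where h: "(G, \<gamma>) \<in> C" "g (f x) \<in> G" using chart_exists[OF C] .
  let ?V = "V \<inter> (g -` G) \<inter> E"
  have oV: "open ?V"
    by (intro open_Int open_Int_vimage smooth_map_continuous[OF g] V chart_open[OF C h(1)] chart_open[OF B e(1)])
  let ?N = "U \<inter> (f -` ?V) \<inter> D"
  have oN: "open ?N"
    by (intro open_Int open_Int_vimage smooth_map_continuous[OF f] U oV chart_open[OF A c(1)])
  have xN: "x \<in> ?N" using x c e h sub by auto
  have o1: "open (\<phi> ` ?N)" using chart_image_Int_open[OF A c(1) oN] by (simp add: Int_absorb1 inf.commute inf.left_commute)
  have "?V = E \<inter> ?V" by auto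
  then have o2: "open (\<psi> ` ?V)" using chart_image_Int_open[OF B e(1) oV] by simp
  have s1: "smooth_on (\<phi> ` ?N) (\<psi> \<circ> f \<circ> inv_into D \<phi>)"
    by (rule smooth_on_subset[OF smooth_map_in_charts[OF f c(1) e(1)]]) auto
  have s2: "smooth_on (\<psi> ` ?V) (\<gamma> \<circ> g \<circ> inv_into E \<psi>)"
    by (rule smooth_on_subset[OF smooth_map_in_charts[OF g e(1) h(1)]]) auto
  have s3: "smooth_on (\<phi> ` ?N) (\<lambda>y. (\<gamma> \<circ> g \<circ> inv_into E \<psi>) ((\<psi> \<circ> f \<circ> inv_into D \<phi>) y))"
    by (rule smooth_on_compose[OF o1 o2 _ s2 s1]) (use chart_inv[OF A c(1)] in auto)
  have "(\<gamma> \<circ> g \<circ> inv_into E \<psi>) ((\<psi> \<circ> f \<circ> inv_into D \<phi>) y) = (\<gamma> \<circ> (\<lambda>x. g (f x)) \<circ> inv_into D \<phi>) y"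
    if "y \<in> \<phi> ` ?N" for y
    using that by (auto simp: chart_inv[OF A c(1)] chart_inv[OF B e(1)])
  then have s4: "smooth_on (\<phi> ` ?N) (\<gamma> \<circ> (\<lambda>x. g (f x)) \<circ> inv_into D \<phi>)"
    by (rule smooth_on_congI[OF s3 o1])
  have "continuous_on ?N (\<lambda>x. g (f x))"
    by (rule continuous_on_compose2[OF smooth_map_continuous[OF g] continuous_on_subset[OF smooth_map_continuous[OF f]]])
       auto
  then have "smooth_map A C ?N (\<lambda>x. g (f x))"
    by (intro smooth_map_single_chart[OF A C c(1) h(1) oN _ _ _ s4]) auto
  with oN xN show "\<exists>N. open N \<and> x \<in> N \<and> smooth_map A C N (\<lambda>x. g (f x))" by auto
qed

text \<open>The target has a single chart, so its preimage condition disappears; continuity of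
  \<open>f\<close> is recovered from its coordinate expressions.\<close>

lemma smooth_fun_iff:
  assumes A: "smooth_atlas A" and U: "open U"
  shows "smooth_fun A U f \<longleftrightarrow> (\<forall>(D, \<phi>)\<in>A. smooth_on (\<phi> ` (D \<inter> U)) (\<lambda>y. f (inv_into D \<phi> y)))"
proof
  assume "smooth_fun A U f"
  then show "\<forall>(D, \<phi>)\<in>A. smooth_on (\<phi> ` (D \<inter> U)) (\<lambda>y. f (inv_into D \<phi> y))"
    by (auto simp: smooth_map_def comp_def)
next
  assume s: "\<forall>(D, \<phi>)\<in>A. smooth_on (\<phi> ` (D \<inter> U)) (\<lambda>y. f (inv_into D \<phi> y))"
  have "continuous (at x) f" if "x \<in> U" for x
  proof -
    obtain D \<phi> where c: "(D, \<phi>) \<in> A" "x \<in> D" using chart_exists[OF A] .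
    have "continuous_on (\<phi> ` (D \<inter> U)) (\<lambda>y. f (inv_into D \<phi> y))"
      using s c by (intro smooth_on_imp_continuous_on) auto
    then have "continuous_on (D \<inter> U) (\<lambda>x. f (inv_into D \<phi> (\<phi> x)))"
      by (rule continuous_on_compose2[OF _ continuous_on_subset[OF chart_continuous[OF A c(1)]]]) auto
    moreover have "continuous_on (D \<inter> U) (\<lambda>x. f (inv_into D \<phi> (\<phi> x))) \<longleftrightarrow> continuous_on (D \<inter> U) f"
      by (rule continuous_on_cong) (auto simp: chart_inv[OF A c(1)])
    ultimately have "continuous_on (D \<inter> U) f" by simp
    then show ?thesis
      using open_Int[OF chart_open[OF A c(1)] U] c that by (simp add: continuous_on_eq_continuous_at)
  qed
  with s show "smooth_fun A U f"
    by (auto simp: smooth_map_def comp_def intro: continuous_at_imp_continuous_on)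
qed

lemma smooth_funI:
  assumes "smooth_atlas A" "open U"
    and "\<And>D \<phi>. (D, \<phi>) \<in> A \<Longrightarrow> open (\<phi> ` (D \<inter> U)) \<Longrightarrow> smooth_on (\<phi> ` (D \<inter> U)) (\<lambda>y. f (inv_into D \<phi> y))"
  shows "smooth_fun A U f"
  unfolding smooth_fun_iff[OF assms(1,2)]
proof clarify
  fix D \<phi> assume c: "(D, \<phi>) \<in> A"
  show "smooth_on (\<phi> ` (D \<inter> U)) (\<lambda>y. f (inv_into D \<phi> y))"
    by (rule assms(3)[OF c chart_image_Int_open[OF assms(1) c assms(2)]])
qed

lemma smooth_funD:
  assumes "smooth_atlas A" "open U" "smooth_fun A U f" "(D, \<phi>) \<in> A"
  shows "smooth_on (\<phi> ` (D \<inter> U)) (\<lambda>y. f (inv_into D \<phi> y))"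
  using assms(3,4) unfolding smooth_fun_iff[OF assms(1,2)] by fast

lemma smooth_map_id: "smooth_atlas A \<Longrightarrow> smooth_map A A U (\<lambda>x. x)"
proof (rule smooth_map_subset[of _ _ UNIV])
  assume A: "smooth_atlas A"
  show "smooth_map A A UNIV (\<lambda>x. x)"
    using chart_transition[OF A] by (auto simp: smooth_map_def comp_def)
qed simp

lemma smooth_fun_chart:
  assumes "smooth_atlas A" "(D, \<phi>) \<in> A"
  shows "smooth_fun A D \<phi>"
  unfolding smooth_fun_iff[OF assms(1) chart_open[OF assms]]
  using chart_transition[OF assms(1) _ assms(2)] by (auto simp: comp_def)

lemma smooth_fun_euclidean: "open S \<Longrightarrow> smooth_fun euclidean_atlas S f \<longleftrightarrow> smooth_on S f"
  by (simp add: smooth_fun_iff[OF smooth_atlas_euclidean])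

lemma smooth_map_chart_inv:
  assumes A: "smooth_atlas A" "(D, \<phi>) \<in> A"
  shows "smooth_map euclidean_atlas A (\<phi> ` D) (inv_into D \<phi>)"
proof (rule smooth_map_single_chart[OF smooth_atlas_euclidean A(1) _ A(2), of UNIV id])
  have "smooth_on (\<phi> ` D) (\<lambda>x. x)" by (rule smooth_on_bounded_linear) (rule bounded_linear_ident)
  then have "smooth_on (\<phi> ` D) (\<phi> \<circ> inv_into D \<phi>)"
    by (rule smooth_on_congI[OF _ chart_image_open[OF A]]) (simp add: chart_inv_right)
  then show "smooth_on (id ` \<phi> ` D) (\<phi> \<circ> inv_into D \<phi> \<circ> inv_into UNIV id)"
    by simp
qed (auto simp: chart_image_open[OF A] chart_inv_continuous[OF A] inv_into_into)

section \<open>Algebra of smooth functions\<close>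

lemma smooth_fun_const: "smooth_atlas A \<Longrightarrow> open U \<Longrightarrow> smooth_fun A U (\<lambda>x. c)"
  by (rule smooth_funI) (simp_all add: smooth_on_const)

lemma smooth_fun_bounded_linear:
  "smooth_atlas A \<Longrightarrow> open U \<Longrightarrow> bounded_linear L \<Longrightarrow> smooth_fun A U f \<Longrightarrow> smooth_fun A U (\<lambda>x. L (f x))"
  by (rule smooth_funI, assumption, assumption, rule smooth_on_bounded_linear_compose, assumption, assumption, rule smooth_funD)

lemma smooth_fun_bounded_bilinear:
  "smooth_atlas A \<Longrightarrow> open U \<Longrightarrow> bounded_bilinear M \<Longrightarrow> smooth_fun A U f \<Longrightarrow> smooth_fun A U g
    \<Longrightarrow> smooth_fun A U (\<lambda>x. M (f x) (g x))"
  by (rule smooth_funI, assumption, assumption, rule smooth_on_bounded_bilinear, assumption, assumption; rule smooth_funD)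

lemma smooth_fun_add:
  "smooth_atlas A \<Longrightarrow> open U \<Longrightarrow> smooth_fun A U f \<Longrightarrow> smooth_fun A U g \<Longrightarrow> smooth_fun A U (\<lambda>x. f x + g x)"
  by (rule smooth_funI, assumption, assumption, rule smooth_on_add, assumption; rule smooth_funD)

lemma smooth_fun_minus:
  "smooth_atlas A \<Longrightarrow> open U \<Longrightarrow> smooth_fun A U f \<Longrightarrow> smooth_fun A U (\<lambda>x. - f x)"
  by (rule smooth_fun_bounded_linear[OF _ _ bounded_linear_minus[OF bounded_linear_ident]])

lemma smooth_fun_diff:
  "smooth_atlas A \<Longrightarrow> open U \<Longrightarrow> smooth_fun A U f \<Longrightarrow> smooth_fun A U g \<Longrightarrow> smooth_fun A U (\<lambda>x. f x - g x)"
  using smooth_fun_add[of A U f "\<lambda>x. - g x"] smooth_fun_minus[of A U g] by simp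

lemma smooth_fun_sum:
  "smooth_atlas A \<Longrightarrow> open U \<Longrightarrow> (\<And>i. i \<in> I \<Longrightarrow> smooth_fun A U (f i)) \<Longrightarrow> smooth_fun A U (\<lambda>x. \<Sum>i\<in>I. f i x)"
  by (rule smooth_funI, assumption, assumption, rule smooth_on_sum, assumption, rule smooth_funD) simp_all

lemma smooth_fun_Pair:
  "smooth_atlas A \<Longrightarrow> open U \<Longrightarrow> smooth_fun A U f \<Longrightarrow> smooth_fun A U g \<Longrightarrow> smooth_fun A U (\<lambda>x. (f x, g x))"
  by (rule smooth_funI, assumption, assumption, rule smooth_on_Pair, assumption; rule smooth_funD)

lemmas smooth_fun_scaleR = smooth_fun_bounded_bilinear[OF _ _ bounded_bilinear_scaleR]

section \<open>Differentials and the chain rule\<close>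

lemma smooth_map_chart_differentiable:
  assumes A: "smooth_atlas A" and B: "smooth_atlas B" and U: "open U" "z \<in> U"
    and f: "smooth_map A B U f" and c: "(D, \<phi>) \<in> A" "z \<in> D" "(D', \<phi>') \<in> B" "f z \<in> D'"
  shows "(\<phi>' \<circ> f \<circ> inv_into D \<phi>) differentiable (at (\<phi> z))"
  using smooth_map_in_charts[OF f c(1,3)] by (rule smooth_on_imp_differentiable) (use U c in auto)

lemma differential_has_derivative:
  assumes A: "smooth_atlas A" and B: "smooth_atlas B" and U: "open U" "z \<in> U"
    and f: "smooth_map A B U f" and "chart_at A z = (D, \<phi>)" "chart_at B (f z) = (D', \<phi>')"
  shows "((\<phi>' \<circ> f \<circ> inv_into D \<phi>) has_derivative differential A B f z) (at (\<phi> z))"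
  using smooth_map_chart_differentiable[OF A B U f chart_at_props[OF A assms(6)] chart_at_props[OF B assms(7)]]
  by (simp add: differential_def assms has_derivative_frechet)

lemma differential_linear:
  assumes "smooth_atlas A" "smooth_atlas B" "open U" "z \<in> U" "smooth_map A B U f"
  shows "linear (differential A B f z)"
proof (cases "chart_at A z", cases "chart_at B (f z)")
  fix D \<phi> D' \<phi>' assume "chart_at A z = (D, \<phi>)" "chart_at B (f z) = (D', \<phi>')"
  from differential_has_derivative[OF assms this] show ?thesis by (rule has_derivative_linear)
qed

text \<open>Both factors on the right refer to the same chart \<open>chart_at B (f z)\<close> in the
  middle, which cancels near \<open>z\<close>.\<close>

lemma differential_compose:
  assumes A: "smooth_atlas A" and B: "smooth_atlas B" and C: "smooth_atlas C"
    and U: "open U" "z \<in> U" and f: "smooth_map A B U f"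
    and V: "open V" "f z \<in> V" and g: "smooth_map B C V g"
  shows "differential A C (\<lambda>x. g (f x)) z v = differential B C g (f z) (differential A B f z v)"
proof (cases "chart_at A z", cases "chart_at B (f z)", cases "chart_at C (g (f z))")
  fix D \<phi> E \<psi> G \<gamma>
  assume c: "chart_at A z = (D, \<phi>)" "chart_at B (f z) = (E, \<psi>)" "chart_at C (g (f z)) = (G, \<gamma>)"
  note cA = chart_at_props[OF A c(1)] and cB = chart_at_props[OF B c(2)]
  have "((\<psi> \<circ> f \<circ> inv_into D \<phi>) has_derivative differential A B f z) (at (\<phi> z))"
    by (rule differential_has_derivative[OF A B U f c(1,2)])
  moreover have "((\<gamma> \<circ> g \<circ> inv_into E \<psi>) has_derivative differential B C g (f z))
     (at ((\<psi> \<circ> f \<circ> inv_into D \<phi>) (\<phi> z)))"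
    using differential_has_derivative[OF B C V g c(2,3)] by (simp add: chart_inv[OF A cA(1)] cA)
  ultimately have *: "((\<lambda>y. (\<gamma> \<circ> g \<circ> inv_into E \<psi>) ((\<psi> \<circ> f \<circ> inv_into D \<phi>) y)) has_derivative
     (\<lambda>v. differential B C g (f z) (differential A B f z v))) (at (\<phi> z))"
    by (rule has_derivative_compose)
  let ?N = "\<phi> ` (D \<inter> (U \<inter> f -` E))"
  have "open ?N"
    by (intro chart_image_Int_open[OF A cA(1)] open_Int_vimage smooth_map_continuous[OF f] U chart_open[OF B cB(1)])
  moreover have "\<phi> z \<in> ?N" using cA cB U by auto
  moreover have "(\<gamma> \<circ> g \<circ> inv_into E \<psi>) ((\<psi> \<circ> f \<circ> inv_into D \<phi>) y) = (\<gamma> \<circ> (\<lambda>x. g (f x)) \<circ> inv_into D \<phi>) y"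
    if "y \<in> ?N" for y
    using that by (auto simp: chart_inv[OF A cA(1)] chart_inv[OF B cB(1)])
  ultimately have "((\<gamma> \<circ> (\<lambda>x. g (f x)) \<circ> inv_into D \<phi>) has_derivative
     (\<lambda>v. differential B C g (f z) (differential A B f z v))) (at (\<phi> z))"
    by (rule has_derivative_transform_within_open[OF *])
  from frechet_derivative_at[OF this] show ?thesis
    by (simp add: differential_def c) metis
qed

lemma differential_cong:
  assumes A: "smooth_atlas A" and U: "open U" "z \<in> U" and eq: "\<And>x. x \<in> U \<Longrightarrow> f x = g x"
  shows "differential A B f z = differential A B g z"
proof (cases "chart_at A z")
  fix D \<phi> assume c: "chart_at A z = (D, \<phi>)"
  note cA = chart_at_props[OF A c]
  have "frechet_derivative (snd (chart_at B (g z)) \<circ> f \<circ> inv_into D \<phi>) (at (\<phi> z)) =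
     frechet_derivative (snd (chart_at B (g z)) \<circ> g \<circ> inv_into D \<phi>) (at (\<phi> z))"
    by (rule frechet_derivative_cong[OF chart_image_Int_open[OF A cA(1) U(1)]])
       (use cA U eq chart_inv[OF A cA(1)] in auto)
  then show ?thesis using eq[OF U(2)] by (simp add: differential_def c)
qed

lemma differential_ident:
  assumes A: "smooth_atlas A"
  shows "differential A A (\<lambda>x. x) z v = v"
proof (cases "chart_at A z")
  fix D \<phi> assume c: "chart_at A z = (D, \<phi>)"
  note cA = chart_at_props[OF A c]
  have "frechet_derivative (\<phi> \<circ> (\<lambda>x. x) \<circ> inv_into D \<phi>) (at (\<phi> z)) = frechet_derivative (\<lambda>x. x) (at (\<phi> z))"
    by (rule frechet_derivative_cong[OF chart_image_open[OF A cA(1)]])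
       (use cA in \<open>auto simp: chart_inv_right\<close>)
  then show ?thesis by (simp add: differential_def c)
qed

lemma differential_euclidean [simp]:
  "differential euclidean_atlas euclidean_atlas f z = frechet_derivative f (at z)"
  by (simp add: differential_def)

lemma dfun_euclidean_chart:
  assumes "chart_at A z = (D, \<phi>)"
  shows "dfun A f z = frechet_derivative (\<lambda>y. f (inv_into D \<phi> y)) (at (\<phi> z))"
  by (simp add: differential_def assms comp_def)

lemma dfun_has_derivative:
  assumes "smooth_atlas A" "open U" "z \<in> U" "smooth_fun A U f" "chart_at A z = (D, \<phi>)"
  shows "((\<lambda>y. f (inv_into D \<phi> y)) has_derivative dfun A f z) (at (\<phi> z))"
  using differential_has_derivative[OF assms(1) smooth_atlas_euclidean assms(2-5) chart_at_euclidean]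
  by (simp add: comp_def)

lemma dfun_eqI:
  assumes "chart_at A z = (D, \<phi>)" "((\<lambda>y. f (inv_into D \<phi> y)) has_derivative L) (at (\<phi> z))"
  shows "dfun A f z = L"
  using frechet_derivative_at[OF assms(2)] by (simp add: dfun_euclidean_chart[OF assms(1)])

lemma dfun_const: "dfun A (\<lambda>x. c) z = (\<lambda>v. 0)"
  by (cases "chart_at A z") (rule dfun_eqI, auto)

lemma dfun_add:
  assumes "smooth_atlas A" "open U" "z \<in> U" "smooth_fun A U f" "smooth_fun A U g"
  shows "dfun A (\<lambda>x. f x + g x) z v = dfun A f z v + dfun A g z v"
proof (cases "chart_at A z")
  fix D \<phi> assume "chart_at A z = (D, \<phi>)"
  from dfun_eqI[OF this has_derivative_add[OF dfun_has_derivative[OF assms(1-4) this] dfun_has_derivative[OF assms(1-3,5) this]]]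
  show ?thesis by simp
qed

lemma dfun_bounded_linear:
  assumes "smooth_atlas A" "open U" "z \<in> U" "smooth_fun A U f" "bounded_linear L"
  shows "dfun A (\<lambda>x. L (f x)) z v = L (dfun A f z v)"
proof (cases "chart_at A z")
  fix D \<phi> assume "chart_at A z = (D, \<phi>)"
  from dfun_eqI[OF this bounded_linear.has_derivative[OF assms(5) dfun_has_derivative[OF assms(1-4) this]]]
  show ?thesis by simp
qed

lemma dfun_bounded_bilinear:
  assumes "smooth_atlas A" "open U" "z \<in> U" "smooth_fun A U f" "smooth_fun A U g" "bounded_bilinear M"
  shows "dfun A (\<lambda>x. M (f x) (g x)) z v = M (f z) (dfun A g z v) + M (dfun A f z v) (g z)"
proof (cases "chart_at A z")
  fix D \<phi> assume c: "chart_at A z = (D, \<phi>)"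
  from dfun_eqI[OF this bounded_bilinear.FDERIV[OF assms(6) dfun_has_derivative[OF assms(1-4) this] dfun_has_derivative[OF assms(1-3,5) this]]]
  show ?thesis using chart_inv[OF assms(1) chart_at_props(1)[OF assms(1) c]] chart_at_props(2)[OF assms(1) c] by simp
qed

lemma dfun_diff:
  assumes "smooth_atlas A" "open U" "z \<in> U" "smooth_fun A U f" "smooth_fun A U g"
  shows "dfun A (\<lambda>x. f x - g x) z v = dfun A f z v - dfun A g z v"
  using dfun_add[OF assms(1-4) smooth_fun_minus[OF assms(1,2,5)]]
    dfun_bounded_linear[OF assms(1-3,5) bounded_linear_minus[OF bounded_linear_ident]] by simp

lemma dfun_sum:
  assumes "smooth_atlas A" "open U" "z \<in> U" "\<And>i. i \<in> I \<Longrightarrow> smooth_fun A U (f i)"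
  shows "dfun A (\<lambda>x. \<Sum>i\<in>I. f i x) z v = (\<Sum>i\<in>I. dfun A (f i) z v)"
  using assms(4)
proof (induction I rule: infinite_finite_induct)
  case (insert i I)
  have "smooth_fun A U (f i)" by (rule insert.prems) simp
  moreover have "smooth_fun A U (\<lambda>x. \<Sum>i\<in>I. f i x)"
    by (rule smooth_fun_sum[OF assms(1,2)]) (rule insert.prems, simp)
  ultimately have "dfun A (\<lambda>x. f i x + (\<Sum>i\<in>I. f i x)) z v = dfun A (f i) z v + dfun A (\<lambda>x. \<Sum>i\<in>I. f i x) z v"
    by (rule dfun_add[OF assms(1-3)])
  also have "dfun A (\<lambda>x. \<Sum>i\<in>I. f i x) z v = (\<Sum>i\<in>I. dfun A (f i) z v)"
    by (rule insert.IH) (rule insert.prems, simp)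
  finally show ?case using insert.hyps by simp
qed (auto simp: dfun_const)

section \<open>Vector fields and the Lie bracket\<close>

lemma smooth_fun_frechet_derivative:
  assumes A: "smooth_atlas A" and N: "open N" and u: "smooth_fun A N u" and h: "smooth_fun A N h"
    and T: "open T" and F: "smooth_on T F" and sub: "u ` N \<subseteq> T"
  shows "smooth_fun A N (\<lambda>x. frechet_derivative F (at (u x)) (h x))"
proof (rule smooth_funI[OF A N])
  fix D \<phi> assume c: "(D, \<phi>) \<in> A" and o: "open (\<phi> ` (D \<inter> N))"
  have "(\<lambda>y. u (inv_into D \<phi> y)) ` \<phi> ` (D \<inter> N) \<subseteq> T"
    using sub chart_inv[OF A c] by auto
  then show "smooth_on (\<phi> ` (D \<inter> N)) (\<lambda>y. frechet_derivative F (at (u (inv_into D \<phi> y))) (h (inv_into D \<phi> y)))"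
    by (rule smooth_on_frechet_derivative_apply[OF o T _ F smooth_funD[OF A N u c] smooth_funD[OF A N h c]])
qed

section \<open>Smooth vector fields along a map\<close>

lemma fields_alongD:
  "X \<in> fields_along C A g U \<Longrightarrow> (D, \<phi>) \<in> A \<Longrightarrow>
    smooth_fun C (U \<inter> g -` D) (\<lambda>x. dfun A \<phi> (g x) (X x))"
  unfolding fields_along_def by fast

lemma fields_alongI:
  "(\<And>D \<phi>. (D, \<phi>) \<in> A \<Longrightarrow> smooth_fun C (U \<inter> g -` D) (\<lambda>x. dfun A \<phi> (g x) (X x)))
    \<Longrightarrow> X \<in> fields_along C A g U"
  unfolding fields_along_def by fast

lemma fields_along_subset: "X \<in> fields_along C A g U \<Longrightarrow> V \<subseteq> U \<Longrightarrow> X \<in> fields_along C A g V"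
  by (rule fields_alongI, rule smooth_map_subset, erule fields_alongD) auto

lemma fields_along_local:
  assumes C: "smooth_atlas C" and A: "smooth_atlas A" and cont: "continuous_on U g" and U: "open U"
    and "\<And>x. x \<in> U \<Longrightarrow> \<exists>N. open N \<and> x \<in> N \<and> X \<in> fields_along C A g N"
  shows "X \<in> fields_along C A g U"
proof (rule fields_alongI, rule smooth_map_local[OF C smooth_atlas_euclidean])
  fix D \<phi> x assume c: "(D, \<phi>) \<in> A" and "x \<in> U \<inter> g -` D"
  then obtain N where N: "open N" "x \<in> N" "X \<in> fields_along C A g N" using assms(5)[of x] by auto
  have "U \<inter> g -` D \<inter> N \<subseteq> N \<inter> g -` D" by auto
  from smooth_map_subset[OF fields_alongD[OF N(3) c] this]
  have "smooth_fun C (U \<inter> g -` D \<inter> N) (\<lambda>x. dfun A \<phi> (g x) (X x))" .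
  moreover have "open (U \<inter> g -` D \<inter> N)"
    using open_Int[OF open_Int_vimage[OF cont U chart_open[OF A c]] N(1)] .
  ultimately show "\<exists>N. open N \<and> x \<in> N \<and> smooth_fun C N (\<lambda>x. dfun A \<phi> (g x) (X x))"
    using \<open>x \<in> U \<inter> g -` D\<close> N(2) by blast
qed

lemma fields_along_cong:
  assumes C: "smooth_atlas C" and A: "smooth_atlas A" and cont: "continuous_on U g" and U: "open U"
    and X: "X \<in> fields_along C A g U"
    and eq: "\<And>x. x \<in> U \<Longrightarrow> X x = Y x" "\<And>x. x \<in> U \<Longrightarrow> g x = h x"
  shows "Y \<in> fields_along C A h U"
proof (rule fields_alongI)
  fix D \<phi> assume c: "(D, \<phi>) \<in> A"
  have *: "U \<inter> h -` D = U \<inter> g -` D" using eq(2) by auto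
  show "smooth_fun C (U \<inter> h -` D) (\<lambda>x. dfun A \<phi> (h x) (Y x))"
    unfolding *
    by (rule smooth_map_cong[OF C open_Int_vimage[OF cont U chart_open[OF A c]] smooth_atlas_euclidean fields_alongD[OF X c]])
       (use eq in auto)
qed

text \<open>The chart behind \<open>dfun A f (g x)\<close> changes with \<open>x\<close>. The chain
  rule rewrites it, in one fixed chart \<open>\<phi>\<close> near \<open>g x\<close>, as the
  derivative of the coordinate expression of \<open>f\<close> applied to the components of
  \<open>X\<close>, and those are smooth by definition of \<open>fields_along\<close>.\<close>

lemma smooth_fun_dfun_along:
  assumes C: "smooth_atlas C" and A: "smooth_atlas A" and U: "open U" and V: "open V"
    and g: "smooth_map C A U g" and X: "X \<in> fields_along C A g U"
    and f: "smooth_fun A V f" and sub: "g ` U \<subseteq> V"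
  shows "smooth_fun C U (\<lambda>x. dfun A f (g x) (X x))"
proof (rule smooth_map_local[OF C smooth_atlas_euclidean])
  fix x assume x: "x \<in> U"
  obtain D \<phi> where c: "(D, \<phi>) \<in> A" "g x \<in> D" using chart_exists[OF A] .
  let ?N = "U \<inter> g -` D"
  have N: "open ?N" by (rule open_Int_vimage[OF smooth_map_continuous[OF g] U chart_open[OF A c(1)]])
  have oD: "open D" by (rule chart_open[OF A c(1)])
  let ?T = "\<phi> ` (D \<inter> V)"
  have oT: "open ?T" by (rule chart_image_Int_open[OF A c(1) V])
  let ?F = "\<lambda>y. f (inv_into D \<phi> y)"
  have F: "smooth_on ?T ?F" by (rule smooth_funD[OF A V f c(1)])
  have "smooth_fun C ?N (\<lambda>x. \<phi> (g x))"
    by (rule smooth_map_compose[OF C A smooth_atlas_euclidean N oD smooth_map_subset[OF g] smooth_fun_chart[OF A c(1)]]) auto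
  moreover have "(\<lambda>x. \<phi> (g x)) ` ?N \<subseteq> ?T" using sub by auto
  ultimately have s: "smooth_fun C ?N (\<lambda>x. frechet_derivative ?F (at (\<phi> (g x))) (dfun A \<phi> (g x) (X x)))"
    by (rule smooth_fun_frechet_derivative[OF C N _ fields_alongD[OF X c(1)] oT F])
  have "frechet_derivative ?F (at (\<phi> (g x))) (dfun A \<phi> (g x) (X x)) = dfun A f (g x) (X x)" if "x \<in> ?N" for x
  proof -
    have gx: "g x \<in> D \<inter> V" "\<phi> (g x) \<in> ?T" using that sub by auto
    have F': "smooth_fun euclidean_atlas ?T ?F" using F smooth_fun_euclidean[OF oT] by blast
    have "dfun A f (g x) (X x) = dfun A (\<lambda>x. ?F (\<phi> x)) (g x) (X x)"
      by (subst differential_cong[OF A open_Int[OF oD V] gx(1), of f "\<lambda>x. ?F (\<phi> x)"])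
         (simp_all add: chart_inv[OF A c(1)])
    also have "\<dots> = differential euclidean_atlas euclidean_atlas ?F (\<phi> (g x)) (dfun A \<phi> (g x) (X x))"
      by (rule differential_compose[OF A smooth_atlas_euclidean smooth_atlas_euclidean oD _ smooth_fun_chart[OF A c(1)] oT gx(2) F'])
         (use gx in auto)
    finally show ?thesis by simp
  qed
  then have "smooth_fun C ?N (\<lambda>x. dfun A f (g x) (X x))"
    by (rule smooth_map_cong[OF C N smooth_atlas_euclidean s])
  with N x c show "\<exists>N. open N \<and> x \<in> N \<and> smooth_fun C N (\<lambda>x. dfun A f (g x) (X x))" by blast
qed

text \<open>The components of the image field in a chart \<open>\<phi>\<close> of the target are the
  derivatives of the functions \<open>\<phi> (F x)\<close> along \<open>X\<close>.\<close>

lemma fields_along_differential: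
  assumes C: "smooth_atlas C" and A: "smooth_atlas A" and B: "smooth_atlas B" and U: "open U" and V: "open V"
    and g: "smooth_map C A U g" and X: "X \<in> fields_along C A g U"
    and F: "smooth_map A B V F" and sub: "g ` U \<subseteq> V"
  shows "(\<lambda>x. differential A B F (g x) (X x)) \<in> fields_along C B (\<lambda>x. F (g x)) U"
proof (rule fields_alongI)
  fix D \<phi> assume c: "(D, \<phi>) \<in> B"
  let ?V = "V \<inter> F -` D"
  let ?N = "U \<inter> g -` ?V"
  have V': "open ?V" by (rule open_Int_vimage[OF smooth_map_continuous[OF F] V chart_open[OF B c]])
  have N: "open ?N" by (rule open_Int_vimage[OF smooth_map_continuous[OF g] U V'])
  have eN: "?N = U \<inter> (\<lambda>x. F (g x)) -` D" using sub by auto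
  have sF: "smooth_map A B ?V F" by (rule smooth_map_subset[OF F]) simp
  have s\<phi>: "smooth_fun B D \<phi>" by (rule smooth_fun_chart[OF B c])
  have f: "smooth_fun A ?V (\<lambda>x. \<phi> (F x))"
    by (rule smooth_map_compose[OF A B smooth_atlas_euclidean V' chart_open[OF B c] sF s\<phi>]) auto
  have s: "smooth_fun C ?N (\<lambda>x. dfun A (\<lambda>x. \<phi> (F x)) (g x) (X x))"
    by (rule smooth_fun_dfun_along[OF C A N V' smooth_map_subset[OF g] fields_along_subset[OF X] f]) auto
  have "dfun A (\<lambda>x. \<phi> (F x)) (g x) (X x) = dfun B \<phi> (F (g x)) (differential A B F (g x) (X x))" if "x \<in> ?N" for x
    by (rule differential_compose[OF A B smooth_atlas_euclidean V' _ sF chart_open[OF B c] _ s\<phi>]) (use that in auto)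
  from smooth_map_cong[OF C N smooth_atlas_euclidean s this]
  show "smooth_fun C (U \<inter> (\<lambda>x. F (g x)) -` D) (\<lambda>x. dfun B \<phi> (F (g x)) (differential A B F (g x) (X x)))"
    unfolding eN .
qed

lemma fields_along_euclidean:
  "smooth_fun C U h \<Longrightarrow> h \<in> fields_along C euclidean_atlas g U"
  by (rule fields_alongI) simp

lemma fields_along_compose:
  assumes C: "smooth_atlas C" and A: "smooth_atlas A" and B: "smooth_atlas B" and U: "open U" and W: "open W"
    and g: "continuous_on U g" and X: "X \<in> fields_along C A g U" and k: "smooth_map B C W k" and sub: "k ` W \<subseteq> U"
  shows "(\<lambda>x. X (k x)) \<in> fields_along B A (\<lambda>x. g (k x)) W"
proof (rule fields_alongI)
  fix D \<phi> assume c: "(D, \<phi>) \<in> A"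
  let ?N = "U \<inter> g -` D"
  have N: "open ?N" by (rule open_Int_vimage[OF g U chart_open[OF A c]])
  have W': "open (W \<inter> k -` ?N)" by (rule open_Int_vimage[OF smooth_map_continuous[OF k] W N])
  have "W \<inter> k -` ?N = W \<inter> (\<lambda>x. g (k x)) -` D" using sub by auto
  moreover have "smooth_fun B (W \<inter> k -` ?N) (\<lambda>x. dfun A \<phi> (g (k x)) (X (k x)))"
    by (rule smooth_map_compose[OF B C smooth_atlas_euclidean W' N smooth_map_subset[OF k] fields_alongD[OF X c]]) auto
  ultimately show "smooth_fun B (W \<inter> (\<lambda>x. g (k x)) -` D) (\<lambda>x. dfun A \<phi> (g (k x)) (X (k x)))" by simp
qed

lemma dfun_chart_linear:
  assumes "smooth_atlas A" "(D, \<phi>) \<in> A" "z \<in> D"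
  shows "linear (dfun A \<phi> z)"
  by (rule differential_linear[OF assms(1) smooth_atlas_euclidean chart_open[OF assms(1,2)] assms(3) smooth_fun_chart[OF assms(1,2)]])

lemma fields_along_add:
  assumes C: "smooth_atlas C" and A: "smooth_atlas A" and U: "open U" and g: "continuous_on U g"
    and X: "X \<in> fields_along C A g U" and Y: "Y \<in> fields_along C A g U"
  shows "(\<lambda>x. X x + Y x) \<in> fields_along C A g U"
proof (rule fields_alongI)
  fix D \<phi> assume c: "(D, \<phi>) \<in> A"
  have o: "open (U \<inter> g -` D)" by (rule open_Int_vimage[OF g U chart_open[OF A c]])
  show "smooth_fun C (U \<inter> g -` D) (\<lambda>x. dfun A \<phi> (g x) (X x + Y x))"
    by (rule smooth_map_cong[OF C o smooth_atlas_euclidean smooth_fun_add[OF C o fields_alongD[OF X c] fields_alongD[OF Y c]]])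
       (simp add: linear_add[OF dfun_chart_linear[OF A c]])
qed

lemma fields_along_scaleR:
  assumes C: "smooth_atlas C" and A: "smooth_atlas A" and U: "open U" and g: "continuous_on U g"
    and f: "smooth_fun C U f" and X: "X \<in> fields_along C A g U"
  shows "(\<lambda>x. f x *\<^sub>R X x) \<in> fields_along C A g U"
proof (rule fields_alongI)
  fix D \<phi> assume c: "(D, \<phi>) \<in> A"
  have o: "open (U \<inter> g -` D)" by (rule open_Int_vimage[OF g U chart_open[OF A c]])
  have f': "smooth_fun C (U \<inter> g -` D) f" by (rule smooth_map_subset[OF f]) simp
  show "smooth_fun C (U \<inter> g -` D) (\<lambda>x. dfun A \<phi> (g x) (f x *\<^sub>R X x))"
    by (rule smooth_map_cong[OF C o smooth_atlas_euclidean smooth_fun_scaleR[OF C o f' fields_alongD[OF X c]]])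
       (simp add: linear_scale[OF dfun_chart_linear[OF A c]])
qed

lemma fields_along_zero:
  assumes C: "smooth_atlas C" and A: "smooth_atlas A" and U: "open U" and g: "continuous_on U g"
  shows "(\<lambda>x. 0) \<in> fields_along C A g U"
proof (rule fields_alongI)
  fix D \<phi> assume c: "(D, \<phi>) \<in> A"
  have o: "open (U \<inter> g -` D)" by (rule open_Int_vimage[OF g U chart_open[OF A c]])
  show "smooth_fun C (U \<inter> g -` D) (\<lambda>x. dfun A \<phi> (g x) 0)"
    by (rule smooth_map_cong[OF C o smooth_atlas_euclidean smooth_fun_const[OF C o, of 0]])
       (simp add: linear_0[OF dfun_chart_linear[OF A c]])
qed

text \<open>The vector field on \<open>D\<close> with constant components \<open>w\<close> in the chart \<open>(D, \<phi>)\<close>.\<close>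
definition chart_field ::
    "('a, 'e::euclidean_space) chart set \<Rightarrow> ('a, 'e) chart \<Rightarrow> 'e \<Rightarrow> 'a \<Rightarrow> 'e" where
  "chart_field A = (\<lambda>(D, \<phi>) w x. differential euclidean_atlas A (inv_into D \<phi>) (\<phi> x) w)"

lemma chart_field_smooth:
  assumes A: "smooth_atlas A" and c: "(D, \<phi>) \<in> A"
  shows "chart_field A (D, \<phi>) w \<in> fields_along A A id D"
proof -
  have oD: "open D" by (rule chart_open[OF A c])
  have smooth: "(\<lambda>x. differential euclidean_atlas A (inv_into D \<phi>) (\<phi> x) w) \<in> fields_along A A (\<lambda>x. inv_into D \<phi> (\<phi> x)) D"
    by (rule fields_along_differential[OF A smooth_atlas_euclidean A oD chart_image_open[OF A c] smooth_fun_chart[OF A c]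
          fields_along_euclidean[OF smooth_fun_const[OF A oD]] smooth_map_chart_inv[OF A c]]) simp
  have cont: "continuous_on D (\<lambda>x. inv_into D \<phi> (\<phi> x))"
    by (rule continuous_on_compose2[OF chart_inv_continuous[OF A c] chart_continuous[OF A c]]) simp
  show ?thesis
    by (rule fields_along_cong[OF A A cont oD smooth])
       (simp_all add: chart_field_def chart_inv[OF A c])
qed

lemma chart_field_dfun:
  assumes A: "smooth_atlas A" and c: "(D, \<phi>) \<in> A" and z: "z \<in> D"
  shows "chart_field A (D, \<phi>) (dfun A \<phi> z v) z = v"
proof -
  have oD: "open D" by (rule chart_open[OF A c])
  have "chart_field A (D, \<phi>) (dfun A \<phi> z v) z = differential A A (\<lambda>x. inv_into D \<phi> (\<phi> x)) z v"
    unfolding chart_field_def case_prod_conv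
    by (rule differential_compose[OF A smooth_atlas_euclidean A oD z smooth_fun_chart[OF A c] chart_image_open[OF A c] _
        smooth_map_chart_inv[OF A c], symmetric]) (use z in simp)
  also have "\<dots> = differential A A (\<lambda>x. x) z v"
    by (subst differential_cong[OF A oD z, of _ "\<lambda>x. x"]) (simp_all add: chart_inv[OF A c])
  finally show ?thesis by (simp add: differential_ident[OF A])
qed

lemma dfun_chart_field:
  assumes A: "smooth_atlas A" and c: "(D, \<phi>) \<in> A" and z: "z \<in> D"
  shows "dfun A \<phi> z (chart_field A (D, \<phi>) w z) = w"
proof -
  have oD: "open D" by (rule chart_open[OF A c])
  have oI: "open (\<phi> ` D)" by (rule chart_image_open[OF A c])
  have i: "inv_into D \<phi> (\<phi> z) = z" by (rule chart_inv[OF A c z])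
  have "differential euclidean_atlas euclidean_atlas (\<lambda>y. \<phi> (inv_into D \<phi> y)) (\<phi> z) w =
      dfun A \<phi> (inv_into D \<phi> (\<phi> z)) (differential euclidean_atlas A (inv_into D \<phi>) (\<phi> z) w)"
    by (rule differential_compose[OF smooth_atlas_euclidean A smooth_atlas_euclidean oI _ smooth_map_chart_inv[OF A c] oD _ smooth_fun_chart[OF A c]])
       (use z i in simp_all)
  moreover have "differential euclidean_atlas euclidean_atlas (\<lambda>y. \<phi> (inv_into D \<phi> y)) (\<phi> z)
      = differential euclidean_atlas (euclidean_atlas :: ('b, 'b) chart set) (\<lambda>y. y) (\<phi> z)"
    by (rule differential_cong[OF smooth_atlas_euclidean oI]) (use z in \<open>simp_all add: chart_inv_right\<close>)
  ultimately show ?thesis by (simp add: chart_field_def i)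
qed

lemma chart_field_linear:
  assumes A: "smooth_atlas A" and c: "(D, \<phi>) \<in> A" and z: "z \<in> D"
  shows "linear (\<lambda>w. chart_field A (D, \<phi>) w z)"
  unfolding chart_field_def case_prod_conv
  by (rule differential_linear[OF smooth_atlas_euclidean A chart_image_open[OF A c] _ smooth_map_chart_inv[OF A c]])
     (use z in simp)

text \<open>A tangent vector at \<open>z\<close> is by convention its list of components in exactly
  this chart.\<close>

lemma dfun_chart_at:
  assumes A: "smooth_atlas A" and c: "chart_at A z = (D, \<phi>)"
  shows "dfun A \<phi> z v = v"
proof -
  note cA = chart_at_props[OF A c]
  have "frechet_derivative (\<lambda>y. \<phi> (inv_into D \<phi> y)) (at (\<phi> z)) = frechet_derivative (\<lambda>x. x) (at (\<phi> z))"
    by (rule frechet_derivative_cong[OF chart_image_open[OF A cA(1)]])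
       (use cA in \<open>auto simp: chart_inv_right\<close>)
  then show ?thesis by (simp add: dfun_euclidean_chart[OF c])
qed

lemma chart_field_chart_at:
  assumes A: "smooth_atlas A" and c: "chart_at A z = (D, \<phi>)"
  shows "chart_field A (D, \<phi>) v z = v"
  using chart_field_dfun[OF A chart_at_props[OF A c], of v] by (simp add: dfun_chart_at[OF A c])

text \<open>Reduces identities between tangent vectors to identities between derivatives of
  coordinate functions, to which \<open>lie_bracket_dfun\<close> applies.\<close>

lemma tangent_eqI:
  assumes A: "smooth_atlas A"
    and "\<And>D \<phi>. (D, \<phi>) \<in> A \<Longrightarrow> z \<in> D \<Longrightarrow> dfun A \<phi> z u = dfun A \<phi> z v"
  shows "u = v"
proof (cases "chart_at A z")
  fix D \<phi> assume c: "chart_at A z = (D, \<phi>)"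
  from assms(2)[OF chart_at_props[OF A c]] show ?thesis by (simp add: dfun_chart_at[OF A c])
qed

lemma dfun_in_chart:
  assumes A: "smooth_atlas A" and c: "(D, \<phi>) \<in> A" and U: "open U" and f: "smooth_fun A U f" and z: "z \<in> D" "z \<in> U"
  shows "dfun A f z v = frechet_derivative (\<lambda>y. f (inv_into D \<phi> y)) (at (\<phi> z)) (dfun A \<phi> z v)"
proof -
  have oD: "open D" by (rule chart_open[OF A c])
  let ?F = "\<lambda>y. f (inv_into D \<phi> y)"
  have oT: "open (\<phi> ` (D \<inter> U))" by (rule chart_image_Int_open[OF A c U])
  have F': "smooth_fun euclidean_atlas (\<phi> ` (D \<inter> U)) ?F"
    using smooth_funD[OF A U f c] smooth_fun_euclidean[OF oT] by blast
  have "dfun A f z v = dfun A (\<lambda>x. ?F (\<phi> x)) z v"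
    by (subst differential_cong[OF A oD z(1), of f "\<lambda>x. ?F (\<phi> x)"])
       (simp_all add: chart_inv[OF A c])
  also have "\<dots> = differential euclidean_atlas euclidean_atlas ?F (\<phi> z) (dfun A \<phi> z v)"
    by (rule differential_compose[OF A smooth_atlas_euclidean smooth_atlas_euclidean oD z(1) smooth_fun_chart[OF A c] oT _ F'])
       (use z in auto)
  finally show ?thesis by simp
qed

lemma frechet_derivative_sum_scaleR:
  fixes f :: "'i \<Rightarrow> 'a::euclidean_space \<Rightarrow> real" and g :: "'i \<Rightarrow> 'a \<Rightarrow> 'b::real_normed_vector"
  assumes "\<And>i. i \<in> I \<Longrightarrow> f i differentiable (at x)" "\<And>i. i \<in> I \<Longrightarrow> g i differentiable (at x)"
  shows "frechet_derivative (\<lambda>y. \<Sum>i\<in>I. f i y *\<^sub>R g i y) (at x) v =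
    (\<Sum>i\<in>I. f i x *\<^sub>R frechet_derivative (g i) (at x) v + frechet_derivative (f i) (at x) v *\<^sub>R g i x)"
proof -
  have "((\<lambda>y. \<Sum>i\<in>I. f i y *\<^sub>R g i y) has_derivative
    (\<lambda>v. \<Sum>i\<in>I. f i x *\<^sub>R frechet_derivative (g i) (at x) v + frechet_derivative (f i) (at x) v *\<^sub>R g i x)) (at x)"
    by (rule has_derivative_sum, rule has_derivative_scaleR; rule has_derivative_frechet; rule assms)
  from frechet_derivative_at[OF this, symmetric] show ?thesis by simp
qed

lemma frechet_derivative_inner_left:
  assumes "f differentiable (at x)"
  shows "frechet_derivative (\<lambda>y. f y \<bullet> b) (at x) v = frechet_derivative f (at x) v \<bullet> b"
  using frechet_derivative_at[OF bounded_linear.has_derivative[OF bounded_linear_inner_left has_derivative_frechet[OF assms]], of b, symmetric]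
  by simp

text \<open>The product rule for a derivative applied to a varying vector. The basis expansion is
  carried out for \<open>Y\<close> and for the constant \<open>Y x\<close>; they differ precisely by
  the term that differentiates \<open>Y\<close>.\<close>

lemma frechet_derivative_frechet_derivative_apply:
  fixes F :: "'a::euclidean_space \<Rightarrow> 'b::euclidean_space" and Y :: "'a \<Rightarrow> 'a"
  assumes S: "open S" "x \<in> S" and F: "smooth_on S F" and Y: "Y differentiable (at x)"
  shows "frechet_derivative (\<lambda>y. frechet_derivative F (at y) (Y y)) (at x) v =
    frechet_derivative (\<lambda>y. frechet_derivative F (at y) (Y x)) (at x) v
    + frechet_derivative F (at x) (frechet_derivative Y (at x) v)"
proof -
  have lin: "linear (frechet_derivative F (at y))" if "y \<in> S" for y
    by (rule linear_frechet_derivative[OF smooth_on_imp_differentiable[OF F that]])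
  have d: "(\<lambda>y. frechet_derivative F (at y) b) differentiable (at x)" for b
    by (rule smooth_on_imp_differentiable[OF smooth_on_frechet_derivative[OF F] S(2)])
  have dY: "(\<lambda>y. Y y \<bullet> b) differentiable (at x)" for b
    using Y by simp
  have exp: "frechet_derivative (\<lambda>y. frechet_derivative F (at y) (Z y)) (at x) v =
    (\<Sum>b\<in>Basis. (Z x \<bullet> b) *\<^sub>R frechet_derivative (\<lambda>y. frechet_derivative F (at y) b) (at x) v
       + (frechet_derivative Z (at x) v \<bullet> b) *\<^sub>R frechet_derivative F (at x) b)"
    if Z: "Z differentiable (at x)" for Z :: "'a \<Rightarrow> 'a"
  proof -
    have "frechet_derivative (\<lambda>y. frechet_derivative F (at y) (Z y)) (at x) v
      = frechet_derivative (\<lambda>y. \<Sum>b\<in>Basis. (Z y \<bullet> b) *\<^sub>R frechet_derivative F (at y) b) (at x) v"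
      by (subst frechet_derivative_cong[OF S]) (rule linear_basis_expand[OF lin], simp_all)
    also have "\<dots> = (\<Sum>b\<in>Basis. (Z x \<bullet> b) *\<^sub>R frechet_derivative (\<lambda>y. frechet_derivative F (at y) b) (at x) v
       + frechet_derivative (\<lambda>y. Z y \<bullet> b) (at x) v *\<^sub>R frechet_derivative F (at x) b)"
      by (rule frechet_derivative_sum_scaleR) (use Z d in simp_all)
    finally show ?thesis by (simp add: frechet_derivative_inner_left[OF Z])
  qed
  show ?thesis
    unfolding exp[OF Y] exp[OF differentiable_const[of "Y x"]] 
    by (simp add: sum.distrib linear_basis_expand[OF lin[OF S(2)], of "frechet_derivative Y (at x) v"])
qed

lemma vector_field_in_chart_smooth:
  assumes A: "smooth_atlas A" and c: "(D, \<phi>) \<in> A" and U: "open U" and X: "X \<in> fields_along A A id U"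
  shows "smooth_on (\<phi> ` (D \<inter> U)) (field_in_chart A (D, \<phi>) X)"
proof -
  have "smooth_fun A (D \<inter> U) (\<lambda>x. dfun A \<phi> x (X x))"
    using fields_alongD[OF X c] by (simp add: Int_commute)
  from smooth_funD[OF A open_Int[OF chart_open[OF A c] U] this c] show ?thesis
    by (simp add: field_in_chart_def)
qed

lemma smooth_fun_dfun:
  assumes A: "smooth_atlas A" and U: "open U" and X: "X \<in> fields_along A A id U" and f: "smooth_fun A U f"
  shows "smooth_fun A U (\<lambda>x. dfun A f x (X x))"
  using smooth_fun_dfun_along[OF A A U U _ X f] smooth_map_id[OF A, of U] by (simp add: id_def)

text \<open>The derivation \<open>f \<mapsto> X(Yf) - Y(Xf)\<close> determines \<open>[X,Y]\<close> without reference to the chart chosen at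
  \<open>z\<close>; its second-order terms cancel by the symmetry of second derivatives.\<close>
lemma lie_bracket_dfun:
  assumes A: "smooth_atlas A" and U: "open U" and z: "z \<in> U"
    and X: "X \<in> fields_along A A id U" and Y: "Y \<in> fields_along A A id U" and f: "smooth_fun A U f"
  shows "dfun A f z (lie_bracket A X Y z) =
    dfun A (\<lambda>x. dfun A f x (Y x)) z (X z) - dfun A (\<lambda>x. dfun A f x (X x)) z (Y z)"
proof (cases "chart_at A z")
  fix D \<phi> assume c: "chart_at A z = (D, \<phi>)"
  note cA = chart_at_props[OF A c]
  let ?S = "\<phi> ` (D \<inter> U)" and ?y = "\<phi> z"
  let ?F = "\<lambda>y. f (inv_into D \<phi> y)"
  let ?X = "field_in_chart A (D, \<phi>)"
  have S: "open ?S" "?y \<in> ?S" using chart_image_Int_open[OF A cA(1) U] cA(2) z by auto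
  have F: "smooth_on ?S ?F" by (rule smooth_funD[OF A U f cA(1)])
  have at_z: "?X V ?y = V z" for V
    by (simp add: field_in_chart_def chart_inv[OF A cA] dfun_chart_at[OF A c])
  have D2: "dfun A (\<lambda>x. dfun A f x (V x)) z v =
      frechet_derivative (\<lambda>y. frechet_derivative ?F (at y) (V z)) (at ?y) v
      + frechet_derivative ?F (at ?y) (frechet_derivative (?X V) (at ?y) v)"
    if V: "V \<in> fields_along A A id U" for V v
  proof -
    have "dfun A (\<lambda>x. dfun A f x (V x)) z v =
        frechet_derivative (\<lambda>y. dfun A f (inv_into D \<phi> y) (V (inv_into D \<phi> y))) (at ?y) v"
      by (simp add: dfun_euclidean_chart[OF c])
    also have "\<dots> = frechet_derivative (\<lambda>y. frechet_derivative ?F (at y) (?X V y)) (at ?y) v"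
    proof (subst frechet_derivative_cong[OF S])
      fix y assume y: "y \<in> ?S"
      then have "inv_into D \<phi> y \<in> D" "inv_into D \<phi> y \<in> U" "\<phi> (inv_into D \<phi> y) = y"
        using chart_inv[OF A cA(1)] by auto
      then show "dfun A f (inv_into D \<phi> y) (V (inv_into D \<phi> y)) = frechet_derivative ?F (at y) (?X V y)"
        using dfun_in_chart[OF A cA(1) U f, of "inv_into D \<phi> y"] by (simp add: field_in_chart_def)
    qed simp
    also have "\<dots> = frechet_derivative (\<lambda>y. frechet_derivative ?F (at y) (?X V ?y)) (at ?y) v
      + frechet_derivative ?F (at ?y) (frechet_derivative (?X V) (at ?y) v)"
      by (rule frechet_derivative_frechet_derivative_apply[OF S F])
         (rule smooth_on_imp_differentiable[OF vector_field_in_chart_smooth[OF A cA(1) U V] S(2)])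
    finally show ?thesis by (simp only: at_z)
  qed
  have lin: "linear (frechet_derivative ?F (at ?y))"
    by (rule linear_frechet_derivative[OF smooth_on_imp_differentiable[OF F S(2)]])
  have bracket: "lie_bracket A X Y z =
      frechet_derivative (?X Y) (at ?y) (X z) - frechet_derivative (?X X) (at ?y) (Y z)"
    by (simp add: lie_bracket_def c Let_def at_z)
  have "dfun A f z (lie_bracket A X Y z) = frechet_derivative ?F (at ?y) (lie_bracket A X Y z)"
    by (simp add: dfun_euclidean_chart[OF c])
  then show ?thesis
    unfolding D2[OF X] D2[OF Y] bracket linear_diff[OF lin]
    using symmetric_second_derivative[OF S(1) F S(2), of "X z" "Y z"] by simp
qed

section \<open>One-forms and the Lie derivative\<close>

lemma dual_space_UNIV [simp]: "dual_space UNIV = UNIV"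
proof -
  have "x = 0" if "x \<in> UNIV\<^sup>\<bottom>" for x :: 'a
  proof -
    have "orthogonal x x" using that unfolding orthogonal_comp_def by blast
    then show ?thesis by (simp add: orthogonal_self)
  qed
  then have "blinfun_apply f x = 0" if "x \<in> UNIV\<^sup>\<bottom>" for f :: "'a \<Rightarrow>\<^sub>L real" and x
    using that by (metis blinfun.zero_right)
  then show ?thesis by (auto simp: dual_space_def)
qed

lemma tangent_bundle_simps [simp]:
  "fiber (tangent_bundle A) = (\<lambda>_. UNIV)" "sections (tangent_bundle A) = fields_along A A id"
  by (simp_all add: tangent_bundle_def)

abbreviation vector_fields where "vector_fields A U \<equiv> fields_along A A id U"
abbreviation one_forms where "one_forms A U \<equiv> dual_sections A (tangent_bundle A) U"
abbreviation gen_fields where "gen_fields A U \<equiv> gen_sections A (tangent_bundle A) U"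

lemma one_formsD:
  "\<eta> \<in> one_forms A U \<Longrightarrow> open V \<Longrightarrow> V \<subseteq> U \<Longrightarrow> X \<in> vector_fields A V \<Longrightarrow>
    smooth_fun A V (\<lambda>x. blinfun_apply (\<eta> x) (X x))"
  unfolding dual_sections_def by simp

lemma one_formsI:
  "(\<And>V X. open V \<Longrightarrow> V \<subseteq> U \<Longrightarrow> X \<in> vector_fields A V \<Longrightarrow> smooth_fun A V (\<lambda>x. blinfun_apply (\<eta> x) (X x)))
    \<Longrightarrow> \<eta> \<in> one_forms A U"
  unfolding dual_sections_def by simp

lemma one_forms_subset: "\<eta> \<in> one_forms A U \<Longrightarrow> V \<subseteq> U \<Longrightarrow> \<eta> \<in> one_forms A V"
  by (rule one_formsI, erule one_formsD) simp_all

lemma gen_fields_iff: "e \<in> gen_fields A U \<longleftrightarrow> (\<lambda>x. fst (e x)) \<in> vector_fields A U \<and> (\<lambda>x. snd (e x)) \<in> one_forms A U"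
  by (simp add: gen_sections_def comp_def)

lemma gen_fieldsD:
  assumes "e \<in> gen_fields A U"
  shows "(\<lambda>x. fst (e x)) \<in> vector_fields A U" "(\<lambda>x. snd (e x)) \<in> one_forms A U"
  using assms by (simp_all add: gen_fields_iff)

lemma gen_fields_subset: "e \<in> gen_fields A U \<Longrightarrow> V \<subseteq> U \<Longrightarrow> e \<in> gen_fields A V"
  unfolding gen_fields_iff by (auto intro: fields_along_subset one_forms_subset)

section \<open>Module operations on sections of the generalized tangent bundle\<close>

lemma one_forms_add:
  assumes A: "smooth_atlas A" and "\<eta> \<in> one_forms A U" "\<theta> \<in> one_forms A U"
  shows "(\<lambda>x. \<eta> x + \<theta> x) \<in> one_forms A U"
proof (rule one_formsI)
  fix V X assume "open V" "V \<subseteq> U" "X \<in> vector_fields A V"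
  then show "smooth_fun A V (\<lambda>x. blinfun_apply (\<eta> x + \<theta> x) (X x))"
    unfolding blinfun.add_left by (intro smooth_fun_add A one_formsD[OF assms(2)] one_formsD[OF assms(3)])
qed

lemma one_forms_scaleR:
  assumes A: "smooth_atlas A" and "\<eta> \<in> one_forms A U" "smooth_fun A U f"
  shows "(\<lambda>x. f x *\<^sub>R \<eta> x) \<in> one_forms A U"
proof (rule one_formsI)
  fix V X assume V: "open V" "V \<subseteq> U" "X \<in> vector_fields A V"
  show "smooth_fun A V (\<lambda>x. blinfun_apply (f x *\<^sub>R \<eta> x) (X x))"
    unfolding blinfun.scaleR_left
    by (rule smooth_fun_scaleR[OF A V(1) smooth_map_subset[OF assms(3) V(2)] one_formsD[OF assms(2) V]])
qed

lemma gen_fields_add: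
  assumes A: "smooth_atlas A" and U: "open U" and "a \<in> gen_fields A U" "b \<in> gen_fields A U"
  shows "(\<lambda>x. a x + b x) \<in> gen_fields A U"
  unfolding gen_fields_iff fst_add snd_add
  by (intro conjI fields_along_add[OF A A U] one_forms_add[OF A] gen_fieldsD assms)
     (simp_all add: id_def)

lemma gen_fields_scaleR:
  assumes A: "smooth_atlas A" and U: "open U" and "smooth_fun A U f" "a \<in> gen_fields A U"
  shows "(\<lambda>x. f x *\<^sub>R a x) \<in> gen_fields A U"
  unfolding gen_fields_iff fst_scaleR snd_scaleR
  by (intro conjI fields_along_scaleR[OF A A U] one_forms_scaleR[OF A] gen_fieldsD assms)
     (simp_all add: id_def)

lemma gen_fields_minus:
  assumes A: "smooth_atlas A" and U: "open U" and "a \<in> gen_fields A U"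
  shows "(\<lambda>x. - a x) \<in> gen_fields A U"
  using gen_fields_scaleR[OF A U smooth_fun_const[OF A U, of "-1"] assms(3)] by simp

lemma gen_fields_diff:
  assumes A: "smooth_atlas A" and U: "open U" and "a \<in> gen_fields A U" "b \<in> gen_fields A U"
  shows "(\<lambda>x. a x - b x) \<in> gen_fields A U"
  using gen_fields_add[OF A U assms(3) gen_fields_minus[OF A U assms(4)]] by simp

lemma gen_fields_zero:
  assumes A: "smooth_atlas A" and U: "open U"
  shows "(\<lambda>x. 0) \<in> gen_fields A U"
  unfolding gen_fields_iff
  by (auto intro!: fields_along_zero[OF A A U] one_formsI smooth_fun_const[OF A] simp: id_def)

lemma gen_fields_sum:
  assumes A: "smooth_atlas A" and U: "open U" and "\<And>i. i \<in> I \<Longrightarrow> a i \<in> gen_fields A U"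
  shows "(\<lambda>x. \<Sum>i\<in>I. a i x) \<in> gen_fields A U"
  using assms(3)
proof (induction I rule: infinite_finite_induct)
  case (insert i I)
  have "(\<lambda>x. a i x + (\<Sum>i\<in>I. a i x)) \<in> gen_fields A U"
    by (rule gen_fields_add[OF A U]; (rule insert.IH)?; rule insert.prems; simp)
  with insert.hyps show ?case by simp
qed (simp_all add: gen_fields_zero[OF A U])

section \<open>One-forms in a chart and the Lie derivative\<close>

lemma form_in_chart_eq:
  assumes "y \<in> \<phi> ` D"
  shows "form_in_chart A (D, \<phi>) \<eta> w y = blinfun_apply (\<eta> (inv_into D \<phi> y)) (chart_field A (D, \<phi>) w (inv_into D \<phi> y))"
  using assms by (simp add: form_in_chart_def chart_field_def chart_inv_right)

lemma form_in_chart_smooth: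
  assumes A: "smooth_atlas A" and c: "(D, \<phi>) \<in> A" and U: "open U" and \<eta>: "\<eta> \<in> one_forms A U"
  shows "smooth_on (\<phi> ` (D \<inter> U)) (form_in_chart A (D, \<phi>) \<eta> w)"
proof -
  have o: "open (D \<inter> U)" by (rule open_Int[OF chart_open[OF A c] U])
  have "smooth_fun A (D \<inter> U) (\<lambda>x. blinfun_apply (\<eta> x) (chart_field A (D, \<phi>) w x))"
    by (rule one_formsD[OF \<eta> o _ fields_along_subset[OF chart_field_smooth[OF A c]]]) simp_all
  from smooth_funD[OF A o this c]
  have "smooth_on (\<phi> ` (D \<inter> U)) (\<lambda>y. blinfun_apply (\<eta> (inv_into D \<phi> y)) (chart_field A (D, \<phi>) w (inv_into D \<phi> y)))"
    by simp
  then show ?thesis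
    by (rule smooth_on_congI[OF _ chart_image_Int_open[OF A c U]], subst form_in_chart_eq) auto
qed

text \<open>Replaces the coordinate definition by an invariant formula. Differentiating
  \<open>\<eta>(W)\<close> produces a term with the derivative of \<open>W\<close>, and the bracket
  \<open>[X, W]\<close> removes it, so only the value \<open>W z\<close> survives.\<close>

lemma lie_derivative_apply:
  assumes A: "smooth_atlas A" and U: "open U" and z: "z \<in> U"
    and X: "X \<in> vector_fields A U" and \<eta>: "\<eta> \<in> one_forms A U" and W: "W \<in> vector_fields A U"
  shows "blinfun_apply (lie_derivative A X \<eta> z) (W z) =
    dfun A (\<lambda>x. blinfun_apply (\<eta> x) (W x)) z (X z) - blinfun_apply (\<eta> z) (lie_bracket A X W z)"
proof (cases "chart_at A z")
  fix D \<phi> assume c: "chart_at A z = (D, \<phi>)"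
  note cA = chart_at_props[OF A c]
  let ?S = "\<phi> ` (D \<inter> U)" and ?y = "\<phi> z"
  let ?F = "form_in_chart A (D, \<phi>) \<eta>"
  let ?X = "field_in_chart A (D, \<phi>)"
  have S: "open ?S" "?y \<in> ?S" using chart_image_Int_open[OF A cA(1) U] cA(2) z by auto
  have at_z: "?X V ?y = V z" for V
    by (simp add: field_in_chart_def chart_inv[OF A cA] dfun_chart_at[OF A c])
  have Fz: "?F v ?y = blinfun_apply (\<eta> z) v" for v
    using cA(2) by (simp add: form_in_chart_eq chart_inv[OF A cA] chart_field_chart_at[OF A c])
  have dF: "?F w differentiable (at ?y)" for w
    by (rule smooth_on_imp_differentiable[OF form_in_chart_smooth[OF A cA(1) U \<eta>] S(2)])
  have F_expand: "?F w y = (\<Sum>b\<in>Basis. (w \<bullet> b) *\<^sub>R ?F b y)" if y: "y \<in> ?S" for w y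
  proof -
    have y': "inv_into D \<phi> y \<in> D" "y \<in> \<phi> ` D" using y chart_inv[OF A cA(1)] by auto
    have "linear (\<lambda>w. ?F w y)"
      unfolding form_in_chart_eq[OF y'(2)]
      using linear_compose[OF chart_field_linear[OF A cA(1) y'(1)] bounded_linear.linear[OF blinfun.bounded_linear_right]]
      by (simp add: comp_def)
    then show ?thesis by (rule linear_basis_expand)
  qed
  have DF: "frechet_derivative (?F w) (at ?y) v = (\<Sum>b\<in>Basis. (w \<bullet> b) *\<^sub>R frechet_derivative (?F b) (at ?y) v)" for w v
  proof -
    have "frechet_derivative (?F w) (at ?y) v
        = frechet_derivative (\<lambda>y. \<Sum>b\<in>Basis. (w \<bullet> b) *\<^sub>R ?F b y) (at ?y) v"
      by (subst frechet_derivative_cong[OF S F_expand]) simp_all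
    also have "\<dots> = (\<Sum>b\<in>Basis. (w \<bullet> b) *\<^sub>R frechet_derivative (?F b) (at ?y) v
        + frechet_derivative (\<lambda>y. w \<bullet> b) (at ?y) v *\<^sub>R ?F b ?y)"
      by (rule frechet_derivative_sum_scaleR) (simp_all add: dF)
    finally show ?thesis by simp
  qed
  \<comment> \<open>\<open>Blinfun\<close> is meaningful only on bounded linear maps. Linearity of
    the differentiated summand in \<open>w\<close> is not visible from
    \<open>frechet_derivative\<close>; it comes from the expansion \<open>DF\<close>.\<close>
  define G where "G = (\<lambda>w. frechet_derivative (?F w) (at ?y) (X z) + ?F (frechet_derivative (?X X) (at ?y) w) ?y)"
  have dV: "?X V differentiable (at ?y)" if "V \<in> vector_fields A U" for V
    by (rule smooth_on_imp_differentiable[OF vector_field_in_chart_smooth[OF A cA(1) U that] S(2)])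
  let ?d = "frechet_derivative (?X X) (at ?y)"
  have l1: "linear (\<lambda>w. \<Sum>b\<in>Basis. (w \<bullet> b) *\<^sub>R frechet_derivative (?F b) (at ?y) (X z))"
    by (rule linearI) (simp_all add: inner_add_left sum.distrib distrib_right sum_distrib_left mult.assoc)
  have l2: "linear (\<lambda>w. blinfun_apply (\<eta> z) (?d w))"
    using linear_compose[OF linear_frechet_derivative[OF dV[OF X]] bounded_linear.linear[OF blinfun.bounded_linear_right[of "\<eta> z"]]]
    by (simp add: comp_def)
  have "G = (\<lambda>w. (\<Sum>b\<in>Basis. (w \<bullet> b) *\<^sub>R frechet_derivative (?F b) (at ?y) (X z)) + blinfun_apply (\<eta> z) (?d w))"
    unfolding G_def Fz by (rule ext, subst DF) (rule refl)
  with linear_compose_add[OF l1 l2] have "linear G" by simp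
  then have G: "blinfun_apply (Blinfun G) w = G w" for w
    by (simp add: bounded_linear_Blinfun_apply linear_linear)
  have "dfun A (\<lambda>x. blinfun_apply (\<eta> x) (W x)) z (X z) =
      frechet_derivative (\<lambda>y. blinfun_apply (\<eta> (inv_into D \<phi> y)) (W (inv_into D \<phi> y))) (at ?y) (X z)"
    by (simp add: dfun_euclidean_chart[OF c])
  also have "\<dots> = frechet_derivative (\<lambda>y. \<Sum>b\<in>Basis. (?X W y \<bullet> b) *\<^sub>R ?F b y) (at ?y) (X z)"
  proof (subst frechet_derivative_cong[OF S])
    fix y assume y: "y \<in> ?S"
    then have y': "inv_into D \<phi> y \<in> D" "y \<in> \<phi> ` D" using chart_inv[OF A cA(1)] by auto
    have "?F (?X W y) y = blinfun_apply (\<eta> (inv_into D \<phi> y)) (W (inv_into D \<phi> y))"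
      unfolding form_in_chart_eq[OF y'(2)]
      by (simp add: field_in_chart_def chart_field_dfun[OF A cA(1) y'(1)])
    with F_expand[OF y, of "?X W y"]
    show "blinfun_apply (\<eta> (inv_into D \<phi> y)) (W (inv_into D \<phi> y)) = (\<Sum>b\<in>Basis. (?X W y \<bullet> b) *\<^sub>R ?F b y)"
      by simp
  qed simp
  also have "\<dots> = (\<Sum>b\<in>Basis. (?X W ?y \<bullet> b) *\<^sub>R frechet_derivative (?F b) (at ?y) (X z)
        + frechet_derivative (\<lambda>y. ?X W y \<bullet> b) (at ?y) (X z) *\<^sub>R ?F b ?y)"
    by (rule frechet_derivative_sum_scaleR) (simp_all add: dF dV[OF W])
  also have "\<dots> = frechet_derivative (?F (W z)) (at ?y) (X z) + ?F (frechet_derivative (?X W) (at ?y) (X z)) ?y"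
    by (simp add: sum.distrib DF[of "W z"] F_expand[OF S(2), of "frechet_derivative (?X W) (at ?y) (X z)"]
        frechet_derivative_inner_left[OF dV[OF W]] at_z)
  finally have 1: "dfun A (\<lambda>x. blinfun_apply (\<eta> x) (W x)) z (X z) = 
      frechet_derivative (?F (W z)) (at ?y) (X z) + ?F (frechet_derivative (?X W) (at ?y) (X z)) ?y" .
  have 2: "lie_bracket A X W z =
      frechet_derivative (?X W) (at ?y) (X z) - frechet_derivative (?X X) (at ?y) (W z)"
    by (simp add: lie_bracket_def c Let_def at_z)
  have "lie_derivative A X \<eta> z = Blinfun G"
    by (simp add: lie_derivative_def c Let_def at_z G_def)
  then have "blinfun_apply (lie_derivative A X \<eta> z) (W z) = G (W z)" by (simp add: G)
  then show ?thesis unfolding 1 2 by (simp add: G_def Fz blinfun.diff_right)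
qed

text \<open>Every tangent vector at \<open>z\<close> is the value of a field with constant
  components in the chart at \<open>z\<close>, so covectors may be compared on smooth fields
  only.\<close>

lemma blinfun_eqI_vector_fields:
  assumes A: "smooth_atlas A" and U: "open U" and z: "z \<in> U"
    and "\<And>W V. open V \<Longrightarrow> z \<in> V \<Longrightarrow> V \<subseteq> U \<Longrightarrow> W \<in> vector_fields A V \<Longrightarrow> blinfun_apply \<xi> (W z) = blinfun_apply \<eta> (W z)"
  shows "\<xi> = \<eta>"
proof (rule blinfun_eqI)
  fix v
  obtain D \<phi> where c: "chart_at A z = (D, \<phi>)" by (cases "chart_at A z")
  note cA = chart_at_props[OF A c]
  have "chart_field A (D, \<phi>) v \<in> vector_fields A (D \<inter> U)"
    by (rule fields_along_subset[OF chart_field_smooth[OF A cA(1)]]) simp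
  from assms(4)[OF open_Int[OF chart_open[OF A cA(1)] U] _ _ this]
  show "blinfun_apply \<xi> v = blinfun_apply \<eta> v"
    using cA z by (simp add: chart_field_chart_at[OF A c])
qed

text \<open>The bracket is computed in a chart that may jump with the point. Its components in a
  fixed chart \<open>\<phi>\<close> are \<open>X(Y\<phi>) - Y(X\<phi>)\<close>, which are visibly
  smooth.\<close>

lemma lie_bracket_smooth:
  assumes A: "smooth_atlas A" and U: "open U" and X: "X \<in> vector_fields A U" and Y: "Y \<in> vector_fields A U"
  shows "lie_bracket A X Y \<in> vector_fields A U"
proof (rule fields_alongI)
  fix D \<phi> assume c: "(D, \<phi>) \<in> A"
  let ?V = "U \<inter> D"
  have V: "open ?V" by (rule open_Int[OF U chart_open[OF A c]])
  have X': "X \<in> vector_fields A ?V" and Y': "Y \<in> vector_fields A ?V"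
    by (rule fields_along_subset[OF X] fields_along_subset[OF Y]; simp)+
  have \<phi>: "smooth_fun A ?V \<phi>" by (rule smooth_map_subset[OF smooth_fun_chart[OF A c]]) simp
  have s: "smooth_fun A ?V (\<lambda>z. dfun A (\<lambda>x. dfun A \<phi> x (Y x)) z (X z) - dfun A (\<lambda>x. dfun A \<phi> x (X x)) z (Y z))"
    by (intro smooth_fun_diff[OF A V] smooth_fun_dfun[OF A V] X' Y' \<phi>)
  have "smooth_fun A ?V (\<lambda>x. dfun A \<phi> x (lie_bracket A X Y x))"
    by (rule smooth_map_cong[OF A V smooth_atlas_euclidean s]) (simp add: lie_bracket_dfun[OF A V _ X' Y' \<phi>])
  then show "smooth_fun A (U \<inter> id -` D) (\<lambda>x. dfun A \<phi> (id x) (lie_bracket A X Y x))" by simp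
qed

lemma d_fun_apply:
  assumes A: "smooth_atlas A" and U: "open U" "z \<in> U" and h: "smooth_fun A U h"
  shows "blinfun_apply (d_fun A h z) v = dfun A h z v"
  using differential_linear[OF A smooth_atlas_euclidean U h]
  by (simp add: d_fun_def bounded_linear_Blinfun_apply linear_linear)

lemma fst_courant: "fst (courant A a b z) = lie_bracket A (\<lambda>x. fst (a x)) (\<lambda>x. fst (b x)) z"
  by (simp add: courant_def Let_def comp_def)

lemma gen_fields_contraction_smooth:
  assumes A: "smooth_atlas A" and U: "open U" and a: "a \<in> gen_fields A U" and b: "b \<in> gen_fields A U"
  shows "smooth_fun A U (\<lambda>x. blinfun_apply (snd (a x)) (fst (b x)))"
  by (rule one_formsD[OF gen_fieldsD(2)[OF a] U _ gen_fieldsD(1)[OF b]]) simp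

lemma gen_fields_contraction_diff_smooth:
  assumes A: "smooth_atlas A" and U: "open U" and a: "a \<in> gen_fields A U" and b: "b \<in> gen_fields A U"
  shows "smooth_fun A U (\<lambda>x. blinfun_apply (snd (a x)) (fst (b x)) - blinfun_apply (snd (b x)) (fst (a x)))"
  by (intro smooth_fun_diff[OF A U] gen_fields_contraction_smooth[OF A U] a b)

text \<open>The working form of the one-form part: evaluated on a test field, it consists of
  derivatives of functions and Lie brackets, with no chart left.\<close>

lemma snd_courant_apply:
  assumes A: "smooth_atlas A" and U: "open U" and z: "z \<in> U"
    and a: "a \<in> gen_fields A U" and b: "b \<in> gen_fields A U" and W: "W \<in> vector_fields A U"
  shows "blinfun_apply (snd (courant A a b z)) (W z) =
    (dfun A (\<lambda>x. blinfun_apply (snd (b x)) (W x)) z (fst (a z))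
      - blinfun_apply (snd (b z)) (lie_bracket A (\<lambda>x. fst (a x)) W z))
    - (dfun A (\<lambda>x. blinfun_apply (snd (a x)) (W x)) z (fst (b z))
      - blinfun_apply (snd (a z)) (lie_bracket A (\<lambda>x. fst (b x)) W z))
    + 1/2 * dfun A (\<lambda>x. blinfun_apply (snd (a x)) (fst (b x)) - blinfun_apply (snd (b x)) (fst (a x))) z (W z)"
  using lie_derivative_apply[OF A U z gen_fieldsD(1)[OF a] gen_fieldsD(2)[OF b] W]
    lie_derivative_apply[OF A U z gen_fieldsD(1)[OF b] gen_fieldsD(2)[OF a] W]
    d_fun_apply[OF A U z gen_fields_contraction_diff_smooth[OF A U a b]]
  by (simp add: courant_def Let_def comp_def blinfun.add_left blinfun.diff_left blinfun.scaleR_left)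

section \<open>The Courant bracket\<close>

lemma courant_smooth:
  assumes A: "smooth_atlas A" and U: "open U" and a: "a \<in> gen_fields A U" and b: "b \<in> gen_fields A U"
  shows "courant A a b \<in> gen_fields A U"
  unfolding gen_fields_iff fst_courant
proof
  show "lie_bracket A (\<lambda>x. fst (a x)) (\<lambda>x. fst (b x)) \<in> vector_fields A U"
    by (intro lie_bracket_smooth[OF A U] gen_fieldsD a b)
  show "(\<lambda>x. snd (courant A a b x)) \<in> one_forms A U"
  proof (rule one_formsI)
    fix V W assume V: "open V" "V \<subseteq> U" "W \<in> vector_fields A V"
    have a': "a \<in> gen_fields A V" and b': "b \<in> gen_fields A V"
      using a b V(2) by (auto intro: gen_fields_subset)
    note vf = gen_fieldsD(1)[OF a'] gen_fieldsD(1)[OF b'] V(3)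
    note forms = gen_fieldsD(2)[OF a'] gen_fieldsD(2)[OF b']
    have pr: "smooth_fun A V (\<lambda>x. blinfun_apply (\<eta> x) (Y x))"
      if "\<eta> \<in> one_forms A V" "Y \<in> vector_fields A V" for \<eta> Y
      by (rule one_formsD[OF that(1) V(1) _ that(2)]) simp
    have s: "smooth_fun A V (\<lambda>z. (dfun A (\<lambda>x. blinfun_apply (snd (b x)) (W x)) z (fst (a z))
      - blinfun_apply (snd (b z)) (lie_bracket A (\<lambda>x. fst (a x)) W z))
    - (dfun A (\<lambda>x. blinfun_apply (snd (a x)) (W x)) z (fst (b z))
      - blinfun_apply (snd (a z)) (lie_bracket A (\<lambda>x. fst (b x)) W z))
    + 1/2 * dfun A (\<lambda>x. blinfun_apply (snd (a x)) (fst (b x)) - blinfun_apply (snd (b x)) (fst (a x))) z (W z))"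
      by (intro smooth_fun_add[OF A V(1)] smooth_fun_diff[OF A V(1)] smooth_fun_dfun[OF A V(1)] pr forms
          lie_bracket_smooth[OF A V(1)] smooth_fun_bounded_linear[OF A V(1) bounded_linear_mult_right] vf)
    show "smooth_fun A V (\<lambda>x. blinfun_apply (snd (courant A a b x)) (W x))"
      by (rule smooth_map_cong[OF A V(1) smooth_atlas_euclidean s])
         (simp only: snd_courant_apply[OF A V(1) _ a' b' V(3)])
  qed
qed

lemma lie_bracket_cong:
  assumes A: "smooth_atlas A" and U: "open U" and z: "z \<in> U"
    and eq: "\<And>x. x \<in> U \<Longrightarrow> X x = X' x" "\<And>x. x \<in> U \<Longrightarrow> Y x = Y' x"
  shows "lie_bracket A X Y z = lie_bracket A X' Y' z"
proof (cases "chart_at A z")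
  fix D \<phi> assume c: "chart_at A z = (D, \<phi>)"
  note cA = chart_at_props[OF A c]
  have S: "open (\<phi> ` (D \<inter> U))" "\<phi> z \<in> \<phi> ` (D \<inter> U)" using chart_image_Int_open[OF A cA(1) U] cA(2) z by auto
  have f: "field_in_chart A (D, \<phi>) V y = field_in_chart A (D, \<phi>) V' y"
    if "\<And>x. x \<in> U \<Longrightarrow> V x = V' x" "y \<in> \<phi> ` (D \<inter> U)" for V V' y
  proof -
    from that(2) have "inv_into D \<phi> y \<in> U" using chart_inv[OF A cA(1)] by auto
    then show ?thesis by (simp add: field_in_chart_def that(1))
  qed
  show ?thesis
    using frechet_derivative_cong[OF S f[OF eq(1)]] frechet_derivative_cong[OF S f[OF eq(2)]] f[OF eq(1) S(2)] f[OF eq(2) S(2)]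
    by (simp add: lie_bracket_def c Let_def)
qed

lemma lie_derivative_cong:
  assumes A: "smooth_atlas A" and U: "open U" and z: "z \<in> U"
    and eq: "\<And>x. x \<in> U \<Longrightarrow> X x = X' x" "\<And>x. x \<in> U \<Longrightarrow> \<eta> x = \<eta>' x"
  shows "lie_derivative A X \<eta> z = lie_derivative A X' \<eta>' z"
proof (cases "chart_at A z")
  fix D \<phi> assume c: "chart_at A z = (D, \<phi>)"
  note cA = chart_at_props[OF A c]
  have S: "open (\<phi> ` (D \<inter> U))" "\<phi> z \<in> \<phi> ` (D \<inter> U)" using chart_image_Int_open[OF A cA(1) U] cA(2) z by auto
  have inU: "inv_into D \<phi> y \<in> U" if "y \<in> \<phi> ` (D \<inter> U)" for y
    using that chart_inv[OF A cA(1)] by auto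
  have f: "field_in_chart A (D, \<phi>) X y = field_in_chart A (D, \<phi>) X' y" if "y \<in> \<phi> ` (D \<inter> U)" for y
    by (simp add: field_in_chart_def eq(1)[OF inU[OF that]])
  have g: "form_in_chart A (D, \<phi>) \<eta> w y = form_in_chart A (D, \<phi>) \<eta>' w y" if "y \<in> \<phi> ` (D \<inter> U)" for w y
    by (simp add: form_in_chart_def eq(2)[OF inU[OF that]])
  show ?thesis
    by (simp add: lie_derivative_def c Let_def frechet_derivative_cong[OF S f] frechet_derivative_cong[OF S g]
       f[OF S(2)] g[OF S(2)])
qed

text \<open>Values of sections outside their open set are arbitrary, so sections are constantly
  replaced by others that agree with them near \<open>z\<close>.\<close>

lemma courant_cong:
  assumes A: "smooth_atlas A" and U: "open U" and z: "z \<in> U"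
    and eq: "\<And>x. x \<in> U \<Longrightarrow> a x = a' x" "\<And>x. x \<in> U \<Longrightarrow> b x = b' x"
  shows "courant A a b z = courant A a' b' z"
proof -
  have "dfun A (\<lambda>x. blinfun_apply (snd (a x)) (fst (b x)) - blinfun_apply (snd (b x)) (fst (a x))) z =
      dfun A (\<lambda>x. blinfun_apply (snd (a' x)) (fst (b' x)) - blinfun_apply (snd (b' x)) (fst (a' x))) z"
    by (rule differential_cong[OF A U z]) (simp add: eq)
  moreover have "lie_bracket A (\<lambda>x. fst (a x)) (\<lambda>x. fst (b x)) z = lie_bracket A (\<lambda>x. fst (a' x)) (\<lambda>x. fst (b' x)) z"
    by (rule lie_bracket_cong[OF A U z]) (simp_all add: eq)
  moreover have "lie_derivative A (\<lambda>x. fst (a x)) (\<lambda>x. snd (b x)) z = lie_derivative A (\<lambda>x. fst (a' x)) (\<lambda>x. snd (b' x)) z"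
    by (rule lie_derivative_cong[OF A U z]) (simp_all add: eq)
  moreover have "lie_derivative A (\<lambda>x. fst (b x)) (\<lambda>x. snd (a x)) z = lie_derivative A (\<lambda>x. fst (b' x)) (\<lambda>x. snd (a' x)) z"
    by (rule lie_derivative_cong[OF A U z]) (simp_all add: eq)
  ultimately show ?thesis by (simp add: courant_def Let_def comp_def d_fun_def)
qed

section \<open>Algebraic rules for the brackets\<close>

lemma lie_bracket_skew: "lie_bracket A X Y z = - lie_bracket A Y X z"
  by (simp add: lie_bracket_def Let_def)

lemma courant_skew:
  assumes A: "smooth_atlas A" and U: "open U" and z: "z \<in> U"
    and a: "a \<in> gen_fields A U" and b: "b \<in> gen_fields A U"
  shows "courant A a b z = - courant A b a z"
proof -
  let ?h = "\<lambda>x. blinfun_apply (snd (a x)) (fst (b x)) - blinfun_apply (snd (b x)) (fst (a x))"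
  have "d_fun A (\<lambda>x. blinfun_apply (snd (b x)) (fst (a x)) - blinfun_apply (snd (a x)) (fst (b x))) z = - d_fun A ?h z"
  proof (rule blinfun_eqI)
    fix v
    have "dfun A (\<lambda>x. - ?h x) z v = - dfun A ?h z v"
      by (rule dfun_bounded_linear[OF A U z gen_fields_contraction_diff_smooth[OF A U a b] bounded_linear_minus[OF bounded_linear_ident]])
    then show "blinfun_apply (d_fun A (\<lambda>x. blinfun_apply (snd (b x)) (fst (a x)) - blinfun_apply (snd (a x)) (fst (b x))) z) v
        = blinfun_apply (- d_fun A ?h z) v"
      by (simp add: d_fun_apply[OF A U z gen_fields_contraction_diff_smooth[OF A U b a]] blinfun.minus_left
          d_fun_apply[OF A U z gen_fields_contraction_diff_smooth[OF A U a b]])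
  qed
  then show ?thesis
    using lie_bracket_skew[of A "\<lambda>x. fst (a x)" "\<lambda>x. fst (b x)" z]
    by (simp add: courant_def Let_def comp_def)
qed

lemma lie_bracket_add_right:
  assumes A: "smooth_atlas A" and U: "open U" and z: "z \<in> U"
    and X: "X \<in> vector_fields A U" and Y: "Y \<in> vector_fields A U" and Y': "Y' \<in> vector_fields A U"
  shows "lie_bracket A X (\<lambda>x. Y x + Y' x) z = lie_bracket A X Y z + lie_bracket A X Y' z"
proof (rule tangent_eqI[OF A])
  fix D \<phi> assume c: "(D, \<phi>) \<in> A" "z \<in> D"
  let ?V = "U \<inter> D"
  have V: "open ?V" "z \<in> ?V" using open_Int[OF U chart_open[OF A c(1)]] c z by auto
  have r: "X \<in> vector_fields A ?V" "Y \<in> vector_fields A ?V" "Y' \<in> vector_fields A ?V"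
    by (rule fields_along_subset[OF X] fields_along_subset[OF Y] fields_along_subset[OF Y']; simp)+
  have \<phi>: "smooth_fun A ?V \<phi>" by (rule smooth_map_subset[OF smooth_fun_chart[OF A c(1)]]) simp
  have sum: "(\<lambda>x. Y x + Y' x) \<in> vector_fields A ?V"
    by (rule fields_along_add[OF A A V(1) _ r(2,3)]) (simp add: id_def)
  note lin = dfun_chart_linear[OF A c(1)]
  have "dfun A (\<lambda>x. dfun A \<phi> x (Y x + Y' x)) z (X z) = dfun A (\<lambda>x. dfun A \<phi> x (Y x) + dfun A \<phi> x (Y' x)) z (X z)"
    by (subst differential_cong[OF A V]) (simp_all add: linear_add[OF lin])
  also have "\<dots> = dfun A (\<lambda>x. dfun A \<phi> x (Y x)) z (X z) + dfun A (\<lambda>x. dfun A \<phi> x (Y' x)) z (X z)"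
    by (intro dfun_add[OF A V] smooth_fun_dfun[OF A V(1)] r \<phi>)
  finally have 1: "dfun A (\<lambda>x. dfun A \<phi> x (Y x + Y' x)) z (X z) =
    dfun A (\<lambda>x. dfun A \<phi> x (Y x)) z (X z) + dfun A (\<lambda>x. dfun A \<phi> x (Y' x)) z (X z)" .
  have "linear (dfun A (\<lambda>x. dfun A \<phi> x (X x)) z)"
    by (rule differential_linear[OF A smooth_atlas_euclidean V smooth_fun_dfun[OF A V(1) r(1) \<phi>]])
  from linear_add[OF this] show "dfun A \<phi> z (lie_bracket A X (\<lambda>x. Y x + Y' x) z) = dfun A \<phi> z (lie_bracket A X Y z + lie_bracket A X Y' z)"
    unfolding linear_add[OF lin[OF c(2)]] lie_bracket_dfun[OF A V r(1) sum \<phi>] lie_bracket_dfun[OF A V r(1) r(2) \<phi>]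
      lie_bracket_dfun[OF A V r(1) r(3) \<phi>] 1 by simp
qed

lemma lie_bracket_scaleR_right:
  assumes A: "smooth_atlas A" and U: "open U" and z: "z \<in> U"
    and X: "X \<in> vector_fields A U" and Y: "Y \<in> vector_fields A U" and f: "smooth_fun A U f"
  shows "lie_bracket A X (\<lambda>x. f x *\<^sub>R Y x) z = f z *\<^sub>R lie_bracket A X Y z + dfun A f z (X z) *\<^sub>R Y z"
proof (rule tangent_eqI[OF A])
  fix D \<phi> assume c: "(D, \<phi>) \<in> A" "z \<in> D"
  let ?V = "U \<inter> D"
  have V: "open ?V" "z \<in> ?V" using open_Int[OF U chart_open[OF A c(1)]] c z by auto
  have r: "X \<in> vector_fields A ?V" "Y \<in> vector_fields A ?V"
    by (rule fields_along_subset[OF X] fields_along_subset[OF Y]; simp)+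
  have f': "smooth_fun A ?V f" by (rule smooth_map_subset[OF f]) simp
  have \<phi>: "smooth_fun A ?V \<phi>" by (rule smooth_map_subset[OF smooth_fun_chart[OF A c(1)]]) simp
  have sc: "(\<lambda>x. f x *\<^sub>R Y x) \<in> vector_fields A ?V"
    by (rule fields_along_scaleR[OF A A V(1) _ f' r(2)]) (simp add: id_def)
  note lin = dfun_chart_linear[OF A c(1)]
  have "dfun A (\<lambda>x. dfun A \<phi> x (f x *\<^sub>R Y x)) z (X z) = dfun A (\<lambda>x. f x *\<^sub>R dfun A \<phi> x (Y x)) z (X z)"
    by (subst differential_cong[OF A V]) (simp_all add: linear_scale[OF lin])
  also have "\<dots> = f z *\<^sub>R dfun A (\<lambda>x. dfun A \<phi> x (Y x)) z (X z) + dfun A f z (X z) *\<^sub>R dfun A \<phi> z (Y z)"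
    by (intro dfun_bounded_bilinear[OF A V] smooth_fun_dfun[OF A V(1)] r \<phi> f' bounded_bilinear_scaleR)
  finally have 1: "dfun A (\<lambda>x. dfun A \<phi> x (f x *\<^sub>R Y x)) z (X z) =
    f z *\<^sub>R dfun A (\<lambda>x. dfun A \<phi> x (Y x)) z (X z) + dfun A f z (X z) *\<^sub>R dfun A \<phi> z (Y z)" .
  have "linear (dfun A (\<lambda>x. dfun A \<phi> x (X x)) z)"
    by (rule differential_linear[OF A smooth_atlas_euclidean V smooth_fun_dfun[OF A V(1) r(1) \<phi>]])
  from linear_scale[OF this] show "dfun A \<phi> z (lie_bracket A X (\<lambda>x. f x *\<^sub>R Y x) z) =
      dfun A \<phi> z (f z *\<^sub>R lie_bracket A X Y z + dfun A f z (X z) *\<^sub>R Y z)"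
    unfolding linear_add[OF lin[OF c(2)]] linear_scale[OF lin[OF c(2)]] lie_bracket_dfun[OF A V r(1) sc \<phi>] lie_bracket_dfun[OF A V r(1) r(2) \<phi>] 1
    by (simp add: scaleR_diff_right)
qed

lemma courant_add_right:
  assumes A: "smooth_atlas A" and U: "open U" and z: "z \<in> U"
    and a: "a \<in> gen_fields A U" and b: "b \<in> gen_fields A U" and c: "c \<in> gen_fields A U"
  shows "courant A a (\<lambda>x. b x + c x) z = courant A a b z + courant A a c z"
proof (rule prod_eqI)
  show "fst (courant A a (\<lambda>x. b x + c x) z) = fst (courant A a b z + courant A a c z)"
    unfolding fst_add fst_courant
    by (rule lie_bracket_add_right[OF A U z]) (intro gen_fieldsD a b c)+
  show "snd (courant A a (\<lambda>x. b x + c x) z) = snd (courant A a b z + courant A a c z)"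
  proof (rule blinfun_eqI_vector_fields[OF A U z])
    fix W V assume V: "open V" "z \<in> V" "V \<subseteq> U" "W \<in> vector_fields A V"
    have a': "a \<in> gen_fields A V" and b': "b \<in> gen_fields A V" and c': "c \<in> gen_fields A V"
      using a b c V(3) by (auto intro: gen_fields_subset)
    have bc: "(\<lambda>x. b x + c x) \<in> gen_fields A V" by (rule gen_fields_add[OF A V(1) b' c'])
    have s: "smooth_fun A V (\<lambda>x. blinfun_apply (snd (e x)) (W x))" if "e \<in> gen_fields A V" for e
      by (rule one_formsD[OF gen_fieldsD(2)[OF that] V(1) _ V(4)]) simp
    have 1: "dfun A (\<lambda>x. blinfun_apply (snd (b x)) (W x) + blinfun_apply (snd (c x)) (W x)) z v
        = dfun A (\<lambda>x. blinfun_apply (snd (b x)) (W x)) z v + dfun A (\<lambda>x. blinfun_apply (snd (c x)) (W x)) z v" for v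
      by (intro dfun_add[OF A V(1,2)] s b' c')
    have 2: "dfun A (\<lambda>x. (blinfun_apply (snd (a x)) (fst (b x)) + blinfun_apply (snd (a x)) (fst (c x)))
            - (blinfun_apply (snd (b x)) (fst (a x)) + blinfun_apply (snd (c x)) (fst (a x)))) z v
        = dfun A (\<lambda>x. blinfun_apply (snd (a x)) (fst (b x)) - blinfun_apply (snd (b x)) (fst (a x))) z v
         + dfun A (\<lambda>x. blinfun_apply (snd (a x)) (fst (c x)) - blinfun_apply (snd (c x)) (fst (a x))) z v" for v
      using dfun_add[OF A V(1,2) gen_fields_contraction_diff_smooth[OF A V(1) a' b'] gen_fields_contraction_diff_smooth[OF A V(1) a' c'], of v]
      by (simp add: algebra_simps)
    have 3: "lie_bracket A (\<lambda>x. fst (b x) + fst (c x)) W z = lie_bracket A (\<lambda>x. fst (b x)) W z + lie_bracket A (\<lambda>x. fst (c x)) W z"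
      unfolding lie_bracket_skew[of A _ W]
      by (simp add: lie_bracket_add_right[OF A V(1,2,4) gen_fieldsD(1)[OF b'] gen_fieldsD(1)[OF c']])
    have 4: "linear (dfun A (\<lambda>x. blinfun_apply (snd (a x)) (W x)) z)"
      by (rule differential_linear[OF A smooth_atlas_euclidean V(1,2) s[OF a']])
    show "blinfun_apply (snd (courant A a (\<lambda>x. b x + c x) z)) (W z)
        = blinfun_apply (snd (courant A a b z + courant A a c z)) (W z)"
      unfolding snd_add blinfun.add_left snd_courant_apply[OF A V(1,2) a' bc V(4)]
        snd_courant_apply[OF A V(1,2) a' b' V(4)] snd_courant_apply[OF A V(1,2) a' c' V(4)]
        fst_add blinfun.add_right 1 2 3 linear_add[OF 4]
      by (simp add: algebra_simps)
  qed
qed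

text \<open>Write \<open>a = X + \<xi>\<close> and \<open>b = Y + \<eta>\<close>. The Lie derivative
  of \<open>\<xi>\<close> along \<open>f Y\<close> contributes \<open>- \<xi>(Y) df\<close>, and the
  exact term contributes \<open>1/2 (\<xi>(Y) - \<eta>(X)) df\<close>. Together they give
  \<open>- 1/2 (\<xi>(Y) + \<eta>(X)) df\<close>, which is the pairing with its own sign.\<close>

lemma courant_scaleR_right:
  assumes A: "smooth_atlas A" and U: "open U" and z: "z \<in> U"
    and a: "a \<in> gen_fields A U" and b: "b \<in> gen_fields A U" and f: "smooth_fun A U f"
  shows "courant A a (\<lambda>x. f x *\<^sub>R b x) z =
    f z *\<^sub>R courant A a b z + dfun A f z (fst (a z)) *\<^sub>R b z + pairing (a z) (b z) *\<^sub>R (0, d_fun A f z)"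
proof (rule prod_eqI)
  show "fst (courant A a (\<lambda>x. f x *\<^sub>R b x) z) =
      fst (f z *\<^sub>R courant A a b z + dfun A f z (fst (a z)) *\<^sub>R b z + pairing (a z) (b z) *\<^sub>R (0, d_fun A f z))"
    unfolding fst_add fst_scaleR fst_courant
    using lie_bracket_scaleR_right[OF A U z gen_fieldsD(1)[OF a] gen_fieldsD(1)[OF b] f] by simp
  show "snd (courant A a (\<lambda>x. f x *\<^sub>R b x) z) =
      snd (f z *\<^sub>R courant A a b z + dfun A f z (fst (a z)) *\<^sub>R b z + pairing (a z) (b z) *\<^sub>R (0, d_fun A f z))"
  proof (rule blinfun_eqI_vector_fields[OF A U z])
    fix W V assume V: "open V" "z \<in> V" "V \<subseteq> U" "W \<in> vector_fields A V"
    have a': "a \<in> gen_fields A V" and b': "b \<in> gen_fields A V"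
      using a b V(3) by (auto intro: gen_fields_subset)
    have f': "smooth_fun A V f" by (rule smooth_map_subset[OF f V(3)])
    have fb: "(\<lambda>x. f x *\<^sub>R b x) \<in> gen_fields A V" by (rule gen_fields_scaleR[OF A V(1) f' b'])
    have s: "smooth_fun A V (\<lambda>x. blinfun_apply (snd (e x)) (W x))" if "e \<in> gen_fields A V" for e
      by (rule one_formsD[OF gen_fieldsD(2)[OF that] V(1) _ V(4)]) simp
    have 1: "dfun A (\<lambda>x. f x *\<^sub>R blinfun_apply (snd (b x)) (W x)) z v
        = f z *\<^sub>R dfun A (\<lambda>x. blinfun_apply (snd (b x)) (W x)) z v + dfun A f z v *\<^sub>R blinfun_apply (snd (b z)) (W z)" for v
      by (intro dfun_bounded_bilinear[OF A V(1,2)] s b' f' bounded_bilinear_scaleR)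
    have 2: "dfun A (\<lambda>x. f x *\<^sub>R blinfun_apply (snd (a x)) (fst (b x)) - f x *\<^sub>R blinfun_apply (snd (b x)) (fst (a x))) z v
        = f z *\<^sub>R dfun A (\<lambda>x. blinfun_apply (snd (a x)) (fst (b x)) - blinfun_apply (snd (b x)) (fst (a x))) z v
         + dfun A f z v *\<^sub>R (blinfun_apply (snd (a z)) (fst (b z)) - blinfun_apply (snd (b z)) (fst (a z)))" for v
      unfolding scaleR_diff_right[symmetric]
      by (intro dfun_bounded_bilinear[OF A V(1,2)] gen_fields_contraction_diff_smooth[OF A V(1)] a' b' f' bounded_bilinear_scaleR)
    have 3: "lie_bracket A (\<lambda>x. f x *\<^sub>R fst (b x)) W z = f z *\<^sub>R lie_bracket A (\<lambda>x. fst (b x)) W z - dfun A f z (W z) *\<^sub>R fst (b z)"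
      unfolding lie_bracket_skew[of A _ W]
      by (simp add: lie_bracket_scaleR_right[OF A V(1,2,4) gen_fieldsD(1)[OF b'] f'])
    have 4: "linear (dfun A (\<lambda>x. blinfun_apply (snd (a x)) (W x)) z)"
      by (rule differential_linear[OF A smooth_atlas_euclidean V(1,2) s[OF a']])
    show "blinfun_apply (snd (courant A a (\<lambda>x. f x *\<^sub>R b x) z)) (W z)
        = blinfun_apply (snd (f z *\<^sub>R courant A a b z + dfun A f z (fst (a z)) *\<^sub>R b z + pairing (a z) (b z) *\<^sub>R (0, d_fun A f z))) (W z)"
      unfolding snd_add snd_scaleR snd_conv blinfun.add_left blinfun.scaleR_left snd_courant_apply[OF A V(1,2) a' fb V(4)]
        snd_courant_apply[OF A V(1,2) a' b' V(4)]
        fst_scaleR blinfun.scaleR_right 1 2 3 linear_scale[OF 4] blinfun.diff_right d_fun_apply[OF A V(1,2) f']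
      by (simp add: pairing_def case_prod_beta algebra_simps)
  qed
qed

section \<open>The Nijenhuis tensor\<close>

lemma courant_minus_right:
  assumes A: "smooth_atlas A" and U: "open U" and z: "z \<in> U"
    and a: "a \<in> gen_fields A U" and b: "b \<in> gen_fields A U"
  shows "courant A a (\<lambda>x. - b x) z = - courant A a b z"
proof -
  have c: "smooth_fun A U (\<lambda>x. -1 :: real)" by (rule smooth_fun_const[OF A U])
  have "d_fun A (\<lambda>x. -1) z = 0"
    by (rule blinfun_eqI) (simp add: d_fun_apply[OF A U z c] dfun_const)
  with courant_scaleR_right[OF A U z a b c] show ?thesis
    by (simp add: dfun_const flip: zero_prod_def)
qed

lemma courant_minus_left:
  assumes A: "smooth_atlas A" and U: "open U" and z: "z \<in> U"
    and a: "a \<in> gen_fields A U" and b: "b \<in> gen_fields A U"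
  shows "courant A (\<lambda>x. - a x) b z = - courant A a b z"
  using courant_skew[OF A U z gen_fields_minus[OF A U a] b] courant_minus_right[OF A U z b a]
    courant_skew[OF A U z a b] by simp

definition nijenhuis ::
    "('x::topological_space, 'e::euclidean_space) chart set \<Rightarrow>
     ('x \<Rightarrow> 'e \<times> ('e \<Rightarrow>\<^sub>L real) \<Rightarrow> 'e \<times> ('e \<Rightarrow>\<^sub>L real)) \<Rightarrow>
     ('x \<Rightarrow> 'e \<times> ('e \<Rightarrow>\<^sub>L real)) \<Rightarrow> ('x \<Rightarrow> 'e \<times> ('e \<Rightarrow>\<^sub>L real)) \<Rightarrow> 'x \<Rightarrow> 'e \<times> ('e \<Rightarrow>\<^sub>L real)" where
  "nijenhuis A J a b z =
     courant A (\<lambda>x. J x (a x)) (\<lambda>x. J x (b x)) z - courant A a b z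
     - J z (courant A a (\<lambda>x. J x (b x)) z) - J z (courant A (\<lambda>x. J x (a x)) b z)"

locale tangent_gacs =
  fixes A :: "('x::{t2_space, second_countable_topology}, 'e::euclidean_space) chart set"
    and J :: "'x \<Rightarrow> 'e \<times> ('e \<Rightarrow>\<^sub>L real) \<Rightarrow> 'e \<times> ('e \<Rightarrow>\<^sub>L real)"
  assumes atlas: "smooth_atlas A"
    and gacs: "gen_almost_complex A (tangent_bundle A) J"
begin

lemma gen_fiber_tangent [simp]: "a \<in> gen_fiber (tangent_bundle A) x"
  by (simp add: gen_fiber_def mem_Times_iff)

lemma
  shows J_add: "J x (a + b) = J x a + J x b"
    and J_scaleR: "J x (r *\<^sub>R a) = r *\<^sub>R J x a"
    and J_pairing: "pairing (J x a) (J x b) = pairing a b"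
    and J_square: "J x (J x a) = - a"
    and J_smooth: "open U \<Longrightarrow> e \<in> gen_fields A U \<Longrightarrow> (\<lambda>x. J x (e x)) \<in> gen_fields A U"
  using gacs unfolding gen_almost_complex_def by simp_all

lemma J_linear: "linear (J x)"
  by (rule linearI) (simp_all add: J_add J_scaleR)

lemmas J_minus = linear_neg[OF J_linear]
  and J_diff = linear_diff[OF J_linear]
  and J_zero = linear_0[OF J_linear]

text \<open>Orthogonality applied to \<open>J x a\<close> and \<open>b\<close>, combined with
  \<open>J_square\<close>.\<close>

lemma J_skew: "pairing (J x a) b = - pairing a (J x b)"
proof -
  have "pairing (J x a) b = pairing (- a) (J x b)"
    using J_pairing[of x "J x a" b] by (simp add: J_square)
  also have "\<dots> = - pairing a (J x b)"
    by (simp add: pairing_def case_prod_beta blinfun.minus_left blinfun.minus_right algebra_simps)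
  finally show ?thesis .
qed

lemma nijenhuis_cong:
  assumes U: "open U" "z \<in> U" and "\<And>x. x \<in> U \<Longrightarrow> a x = a' x" "\<And>x. x \<in> U \<Longrightarrow> b x = b' x"
  shows "nijenhuis A J a b z = nijenhuis A J a' b' z"
proof -
  have "courant A (\<lambda>x. J x (a x)) (\<lambda>x. J x (b x)) z = courant A (\<lambda>x. J x (a' x)) (\<lambda>x. J x (b' x)) z"
    "courant A a b z = courant A a' b' z"
    "courant A a (\<lambda>x. J x (b x)) z = courant A a' (\<lambda>x. J x (b' x)) z"
    "courant A (\<lambda>x. J x (a x)) b z = courant A (\<lambda>x. J x (a' x)) b' z"
    by (rule courant_cong[OF atlas U]; simp add: assms)+
  then show ?thesis by (simp add: nijenhuis_def)
qed

lemma nijenhuis_skew: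
  assumes "open U" "z \<in> U" "a \<in> gen_fields A U" "b \<in> gen_fields A U"
  shows "nijenhuis A J a b z = - nijenhuis A J b a z"
  unfolding nijenhuis_def
  using courant_skew[OF atlas assms] courant_skew[OF atlas assms(1,2) J_smooth[OF assms(1,3)] J_smooth[OF assms(1,4)]]
    courant_skew[OF atlas assms(1,2,3) J_smooth[OF assms(1,4)]]
    courant_skew[OF atlas assms(1,2) J_smooth[OF assms(1,3)] assms(4)]
  by (simp add: J_minus)

lemma nijenhuis_add_right:
  assumes "open U" "z \<in> U" "a \<in> gen_fields A U" "b \<in> gen_fields A U" "c \<in> gen_fields A U"
  shows "nijenhuis A J a (\<lambda>x. b x + c x) z = nijenhuis A J a b z + nijenhuis A J a c z"
  unfolding nijenhuis_def J_add courant_add_right[OF atlas assms]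
    courant_add_right[OF atlas assms(1,2) J_smooth[OF assms(1,3)] assms(4,5)]
    courant_add_right[OF atlas assms(1,2,3) J_smooth[OF assms(1,4)] J_smooth[OF assms(1,5)]]
    courant_add_right[OF atlas assms(1,2) J_smooth[OF assms(1,3)] J_smooth[OF assms(1,4)] J_smooth[OF assms(1,5)]]
  by (simp add: algebra_simps)

text \<open>The pairing terms of the Leibniz rule cancel because \<open>J\<close> is skew for the pairing.\<close>
lemma nijenhuis_scaleR_right:
  assumes "open U" "z \<in> U" "a \<in> gen_fields A U" "b \<in> gen_fields A U" "smooth_fun A U f"
  shows "nijenhuis A J a (\<lambda>x. f x *\<^sub>R b x) z = f z *\<^sub>R nijenhuis A J a b z"
proof -
  have p: "pairing (J z (a z)) (b z) = - pairing (a z) (J z (b z))" by (rule J_skew)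
  show ?thesis
    unfolding nijenhuis_def J_scaleR courant_scaleR_right[OF atlas assms]
      courant_scaleR_right[OF atlas assms(1,2) J_smooth[OF assms(1,3)] assms(4,5)]
      courant_scaleR_right[OF atlas assms(1,2,3) J_smooth[OF assms(1,4)] assms(5)]
      courant_scaleR_right[OF atlas assms(1,2) J_smooth[OF assms(1,3)] J_smooth[OF assms(1,4)] assms(5)]
      J_add J_scaleR J_pairing J_square p
    by (simp add: algebra_simps)
qed

lemma nijenhuis_sum_right:
  assumes U: "open U" "z \<in> U" "a \<in> gen_fields A U"
    and "\<And>i. i \<in> I \<Longrightarrow> b i \<in> gen_fields A U" "\<And>i. i \<in> I \<Longrightarrow> smooth_fun A U (f i)"
    and I: "finite I"
  shows "nijenhuis A J a (\<lambda>x. \<Sum>i\<in>I. f i x *\<^sub>R b i x) z = (\<Sum>i\<in>I. f i z *\<^sub>R nijenhuis A J a (b i) z)"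
  using I assms(4,5)
proof (induction I)
  case empty
  have "nijenhuis A J a (\<lambda>x. 0 *\<^sub>R a x) z = 0 *\<^sub>R nijenhuis A J a a z"
    by (rule nijenhuis_scaleR_right[OF U U(3) smooth_fun_const[OF atlas U(1)]])
  then show ?case by simp
next
  case (insert i I)
  have s: "(\<lambda>x. f j x *\<^sub>R b j x) \<in> gen_fields A U" if "j \<in> insert i I" for j
    by (rule gen_fields_scaleR[OF atlas U(1) insert.prems(2)[OF that] insert.prems(1)[OF that]])
  have s2: "(\<lambda>x. \<Sum>i\<in>I. f i x *\<^sub>R b i x) \<in> gen_fields A U"
    by (rule gen_fields_sum[OF atlas U(1)]) (rule s, simp)
  have "nijenhuis A J a (\<lambda>x. f i x *\<^sub>R b i x + (\<Sum>i\<in>I. f i x *\<^sub>R b i x)) z =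
      nijenhuis A J a (\<lambda>x. f i x *\<^sub>R b i x) z + nijenhuis A J a (\<lambda>x. \<Sum>i\<in>I. f i x *\<^sub>R b i x) z"
    by (rule nijenhuis_add_right[OF U s s2]) simp
  also have "nijenhuis A J a (\<lambda>x. f i x *\<^sub>R b i x) z = f i z *\<^sub>R nijenhuis A J a (b i) z"
    by (rule nijenhuis_scaleR_right[OF U]) (rule insert.prems, simp)+
  also have "nijenhuis A J a (\<lambda>x. \<Sum>i\<in>I. f i x *\<^sub>R b i x) z = (\<Sum>i\<in>I. f i z *\<^sub>R nijenhuis A J a (b i) z)"
    by (rule insert.IH) (rule insert.prems, simp)+
  finally show ?case using insert.hyps by simp
qed

text \<open>Since \<open>J\<close> squares to minus the identity, replacing \<open>a\<close> by
  \<open>J a\<close> permutes the four brackets up to signs and a factor \<open>J\<close>.\<close>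

lemma nijenhuis_J_left:
  assumes "open U" "z \<in> U" "a \<in> gen_fields A U" "b \<in> gen_fields A U"
  shows "nijenhuis A J (\<lambda>x. J x (a x)) b z = - J z (nijenhuis A J a b z)"
  unfolding nijenhuis_def J_square J_diff courant_minus_left[OF atlas assms]
    courant_minus_left[OF atlas assms(1,2,3) J_smooth[OF assms(1,4)]] J_minus
  by (simp add: algebra_simps)

text \<open>The brackets of the frame need to vanish at \<open>z\<close> only, because the
  expression is tensorial; the expansions of \<open>a\<close> and \<open>b\<close> are required on
  all of \<open>U\<close>, because it differentiates its arguments. The four combinations of a frame
  sum or its image under \<open>J\<close> in either slot all reduce to \<open>SS\<close>.\<close>

lemma nijenhuis_eq_0_frame:
  assumes U: "open U" "z \<in> U" and I: "finite I"
    and E: "\<And>i. i \<in> I \<Longrightarrow> E i \<in> gen_fields A U"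
    and 0: "\<And>i j. i \<in> I \<Longrightarrow> j \<in> I \<Longrightarrow> nijenhuis A J (E i) (E j) z = 0"
    and f: "\<forall>i\<in>I. smooth_fun A U (f i)" and g: "\<forall>i\<in>I. smooth_fun A U (g i)"
    and f': "\<forall>i\<in>I. smooth_fun A U (f' i)" and g': "\<forall>i\<in>I. smooth_fun A U (g' i)"
    and a: "\<And>x. x \<in> U \<Longrightarrow> a x = (\<Sum>i\<in>I. f i x *\<^sub>R E i x) + J x (\<Sum>i\<in>I. g i x *\<^sub>R E i x)"
    and b: "\<And>x. x \<in> U \<Longrightarrow> b x = (\<Sum>i\<in>I. f' i x *\<^sub>R E i x) + J x (\<Sum>i\<in>I. g' i x *\<^sub>R E i x)"
  shows "nijenhuis A J a b z = 0"
proof -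
  define S where "S = (\<lambda>h x. \<Sum>i\<in>I. h i x *\<^sub>R E i x)"
  have S: "S h \<in> gen_fields A U" if "\<forall>i\<in>I. smooth_fun A U (h i)" for h
    unfolding S_def by (intro gen_fields_sum[OF atlas U(1)] gen_fields_scaleR[OF atlas U(1)] bspec[OF that] E)
  have SE: "nijenhuis A J (E i) (S h) z = 0"
    if "i \<in> I" "\<forall>i\<in>I. smooth_fun A U (h i)" for i h
    unfolding S_def by (subst nijenhuis_sum_right[OF U E[OF that(1)] E bspec[OF that(2)] I]) (simp_all add: 0 that)
  have SS: "nijenhuis A J (S k) (S h) z = 0"
    if k: "\<forall>i\<in>I. smooth_fun A U (k i)" and h: "\<forall>i\<in>I. smooth_fun A U (h i)" for k h
  proof -
    have "nijenhuis A J (S k) (E i) z = 0" if "i \<in> I" for i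
      using SE[of i k] nijenhuis_skew[OF U S[OF k] E[OF that]] k that by simp
    moreover have "S h = (\<lambda>x. \<Sum>i\<in>I. h i x *\<^sub>R E i x)" by (simp add: S_def)
    ultimately show ?thesis by (simp, subst nijenhuis_sum_right[OF U S[OF k] E bspec[OF h] I]) simp_all
  qed
  let ?J = "\<lambda>a x. J x (a x)"
  have JS: "nijenhuis A J (?J (S k)) (S h) z = 0"
    if k: "\<forall>i\<in>I. smooth_fun A U (k i)" and h: "\<forall>i\<in>I. smooth_fun A U (h i)" for k h
    unfolding nijenhuis_J_left[OF U S[OF k] S[OF h]] SS[OF k h] by (simp add: J_zero)
  have SJ: "nijenhuis A J (S k) (?J (S h)) z = 0"
    if k: "\<forall>i\<in>I. smooth_fun A U (k i)" and h: "\<forall>i\<in>I. smooth_fun A U (h i)" for k h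
    unfolding nijenhuis_skew[OF U S[OF k] J_smooth[OF U(1) S[OF h]]] JS[OF h k] by simp
  have JJ: "nijenhuis A J (?J (S k)) (?J (S h)) z = 0"
    if k: "\<forall>i\<in>I. smooth_fun A U (k i)" and h: "\<forall>i\<in>I. smooth_fun A U (h i)" for k h
    unfolding nijenhuis_J_left[OF U S[OF k] J_smooth[OF U(1) S[OF h]]] SJ[OF k h] by (simp add: J_zero)
  have full: "(\<lambda>x. S k x + ?J (S h) x) \<in> gen_fields A U"
    if k: "\<forall>i\<in>I. smooth_fun A U (k i)" and h: "\<forall>i\<in>I. smooth_fun A U (h i)" for k h
    by (rule gen_fields_add[OF atlas U(1) S[OF k] J_smooth[OF U(1) S[OF h]]])
  have 1: "nijenhuis A J (S k) (\<lambda>x. S f x + ?J (S g) x) z = 0"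
    if k: "\<forall>i\<in>I. smooth_fun A U (k i)" for k
    unfolding nijenhuis_add_right[OF U S[OF k] S[OF f] J_smooth[OF U(1) S[OF g]]] SS[OF k f] SJ[OF k g] by simp
  have 2: "nijenhuis A J (?J (S k)) (\<lambda>x. S f x + ?J (S g) x) z = 0"
    if k: "\<forall>i\<in>I. smooth_fun A U (k i)" for k
    unfolding nijenhuis_add_right[OF U J_smooth[OF U(1) S[OF k]] S[OF f] J_smooth[OF U(1) S[OF g]]] JS[OF k f] JJ[OF k g] by simp
  have "nijenhuis A J a b z = nijenhuis A J (\<lambda>x. S f x + ?J (S g) x) (\<lambda>x. S f' x + ?J (S g') x) z"
    by (rule nijenhuis_cong[OF U]) (simp_all add: a b S_def)
  also have "\<dots> = nijenhuis A J (\<lambda>x. S f x + ?J (S g) x) (S f') z + nijenhuis A J (\<lambda>x. S f x + ?J (S g) x) (?J (S g')) z"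
    by (rule nijenhuis_add_right[OF U full[OF f g] S[OF f'] J_smooth[OF U(1) S[OF g']]])
  also have "\<dots> = 0"
    unfolding nijenhuis_skew[OF U full[OF f g] S[OF f']] nijenhuis_skew[OF U full[OF f g] J_smooth[OF U(1) S[OF g']]]
      1[OF f'] 2[OF g'] by simp
  finally show ?thesis .
qed

text \<open>The bracket of \<open>a - i J a\<close> and \<open>b - i J b\<close> has real part
  \<open>[a, b] - [J a, J b]\<close> and imaginary part \<open>- [a, J b] - [J a, b]\<close>. It
  lies in the eigenbundle when \<open>J\<close> maps the real part to minus the imaginary part, and
  one more application of \<open>J\<close> turns this condition into
  \<open>N(a, b) = 0\<close>.\<close>

lemma integrable_iff_nijenhuis:
  "integrable_gacs A J \<longleftrightarrow>
     (\<forall>U a b z. open U \<longrightarrow> a \<in> gen_fields A U \<longrightarrow> b \<in> gen_fields A U \<longrightarrow> z \<in> U \<longrightarrow> nijenhuis A J a b z = 0)"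
proof (intro iffI allI impI)
  fix U a b z
  assume int: "integrable_gacs A J" and U: "open U" and a: "a \<in> gen_fields A U" and b: "b \<in> gen_fields A U" and z: "z \<in> U"
  let ?Ja = "\<lambda>x. J x (a x)" and ?Jb = "\<lambda>x. J x (b x)"
  have eig: "(c, \<lambda>x. - J x (c x)) \<in> eigen_sections A J U" if "c \<in> gen_fields A U" for c
    using gen_fields_minus[OF atlas U J_smooth[OF U that]] that
    by (simp add: eigen_sections_def times_i_def J_minus J_square)
  have "courant_complex A (a, \<lambda>x. - ?Ja x) (b, \<lambda>x. - ?Jb x) \<in> eigen_sections A J U"
    using int U eig[OF a] eig[OF b] unfolding integrable_gacs_def by blast
  then have "J z (courant A a b z - courant A (\<lambda>x. - ?Ja x) (\<lambda>x. - ?Jb x) z)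
      = - (courant A a (\<lambda>x. - ?Jb x) z + courant A (\<lambda>x. - ?Ja x) b z)"
    using z by (simp add: courant_complex_def eigen_sections_def times_i_def)
  then have "J z (courant A a b z - courant A ?Ja ?Jb z) = courant A a ?Jb z + courant A ?Ja b z"
    by (simp add: courant_minus_left[OF atlas U z J_smooth[OF U a] gen_fields_minus[OF atlas U J_smooth[OF U b]]]
        courant_minus_right[OF atlas U z J_smooth[OF U a] J_smooth[OF U b]]
        courant_minus_right[OF atlas U z a J_smooth[OF U b]] courant_minus_left[OF atlas U z J_smooth[OF U a] b])
  \<comment> \<open>Applying \<open>J\<close> undoes the outer \<open>J\<close> on the left up to
    sign and leaves the terms of \<open>nijenhuis\<close>.\<close>
  then have "J z (J z (courant A a b z - courant A ?Ja ?Jb z)) = J z (courant A a ?Jb z) + J z (courant A ?Ja b z)"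
    by (simp add: J_add)
  then show "nijenhuis A J a b z = 0"
    by (simp add: nijenhuis_def J_square algebra_simps)
next
  assume N: "\<forall>U a b z. open U \<longrightarrow> a \<in> gen_fields A U \<longrightarrow> b \<in> gen_fields A U \<longrightarrow> z \<in> U \<longrightarrow> nijenhuis A J a b z = 0"
  show "integrable_gacs A J"
    unfolding integrable_gacs_def
  proof (intro allI impI ballI)
    fix U e f assume U: "open U" and "e \<in> eigen_sections A J U" "f \<in> eigen_sections A J U"
    moreover obtain a b where e: "e = (a, b)" by (cases e)
    moreover obtain c d where f: "f = (c, d)" by (cases f)
    ultimately have s: "a \<in> gen_fields A U" "b \<in> gen_fields A U" "c \<in> gen_fields A U" "d \<in> gen_fields A U"
      and J: "\<And>x. x \<in> U \<Longrightarrow> J x (a x) = - b x" "\<And>x. x \<in> U \<Longrightarrow> J x (c x) = - d x"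
      by (simp_all add: eigen_sections_def times_i_def)
    \<comment> \<open>Membership in \<open>eigen_sections\<close> includes smoothness of both parts
      of the bracket.\<close>
    have R: "(\<lambda>z. courant A a c z - courant A b d z) \<in> gen_fields A U"
      by (intro gen_fields_diff[OF atlas U] courant_smooth[OF atlas U] s)
    have I: "(\<lambda>z. courant A a d z + courant A b c z) \<in> gen_fields A U"
      by (intro gen_fields_add[OF atlas U] courant_smooth[OF atlas U] s)
    have main: "J z (courant A a c z - courant A b d z) = - (courant A a d z + courant A b c z)" if z: "z \<in> U" for z
    proof -
      have "nijenhuis A J a c z = 0" using N U s z by blast
      moreover have "courant A (\<lambda>x. J x (a x)) (\<lambda>x. J x (c x)) z = courant A (\<lambda>x. - b x) (\<lambda>x. - d x) z"
        "courant A a (\<lambda>x. J x (c x)) z = courant A a (\<lambda>x. - d x) z"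
        "courant A (\<lambda>x. J x (a x)) c z = courant A (\<lambda>x. - b x) c z"
        by (rule courant_cong[OF atlas U z]; simp add: J)+
      ultimately have "courant A b d z - courant A a c z + J z (courant A a d z) + J z (courant A b c z) = 0"
        unfolding nijenhuis_def
        by (simp add: courant_minus_left[OF atlas U z s(2) gen_fields_minus[OF atlas U s(4)]]
          courant_minus_right[OF atlas U z s(2,4)] courant_minus_right[OF atlas U z s(1,4)]
          courant_minus_left[OF atlas U z s(2,3)] J_minus)
      then have "courant A b d z - courant A a c z + J z (courant A a d z + courant A b c z) = 0"
        by (simp add: J_add algebra_simps)
      from minus_unique[OF this]
      have "courant A a c z - courant A b d z = J z (courant A a d z + courant A b c z)" by (simp only: minus_diff_eq)
      then show ?thesis by (simp add: J_square)
    qed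
    \<comment> \<open>The second half of the eigenvector condition is \<open>J\<close> applied to
      the first.\<close>
    have "J z (courant A a d z + courant A b c z) = courant A a c z - courant A b d z" if "z \<in> U" for z
    proof -
      have "J z (courant A a d z + courant A b c z) = - J z (J z (courant A a c z - courant A b d z))"
        unfolding main[OF that] J_minus by simp
      then show ?thesis unfolding J_square by simp
    qed
    with R I main show "courant_complex A e f \<in> eigen_sections A J U"
      by (simp add: e f courant_complex_def eigen_sections_def times_i_def)
  qed
qed

end

section \<open>Local trivializations of a torus bundle\<close>

lemma smooth_map_const:
  assumes "smooth_atlas C" "smooth_atlas A" "open T"
  shows "smooth_map C A T (\<lambda>t. c)"
  unfolding smooth_map_def by (auto simp: comp_def smooth_on_const)

lemma differential_const: "differential C A (\<lambda>t. c) t v = 0"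
  by (cases "chart_at C t") (simp add: differential_def comp_def)

lemma smooth_fun_ident_euclidean: "smooth_fun euclidean_atlas T (\<lambda>t. t)"
  by (rule smooth_map_id[OF smooth_atlas_euclidean])

lemma smooth_fun_linear_euclidean:
  "open T \<Longrightarrow> bounded_linear L \<Longrightarrow> smooth_fun euclidean_atlas T L"
  using smooth_fun_bounded_linear[OF smooth_atlas_euclidean _ _ smooth_fun_ident_euclidean] .

lemma locally_constant_Ints:
  fixes k :: "'a::topological_space \<Rightarrow> real ^ 'n"
  assumes T: "open T" "t \<in> T" and k: "continuous_on T k"
    and int: "\<And>t' i. t' \<in> T \<Longrightarrow> k t' $ i \<in> \<int>"
  shows "\<exists>N. open N \<and> t \<in> N \<and> N \<subseteq> T \<and> (\<forall>t'\<in>N. k t' = k t)"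
proof (intro exI conjI ballI)
  \<comment> \<open>Radius 1, since integers at distance less than 1 coincide.\<close>
  let ?N = "T \<inter> k -` ball (k t) 1"
  show "open ?N" by (rule continuous_open_preimage[OF k T(1) open_ball])
  show "t \<in> ?N" using T by simp
  show "?N \<subseteq> T" by simp
  fix t' assume t': "t' \<in> ?N"
  show "k t' = k t"
  proof (subst vec_eq_iff, intro allI)
    fix i
    have "\<bar>k t' $ i - k t $ i\<bar> \<le> norm (k t' - k t)"
      using component_le_norm_cart[of "k t' - k t" i] by simp
    also have "\<dots> < 1" using t' by (simp add: dist_norm norm_minus_commute)
    finally show "k t' $ i = k t $ i"
      using Ints_eq_abs_less1[OF int int[OF T(2)], of t' i i] t' by simp
  qed
qed

locale torus =
  fixes B :: "('m::{t2_space, second_countable_topology}, 'f::euclidean_space,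
               'z::{t2_space, second_countable_topology}, 'e::euclidean_space, 'n::finite) torus_bundle"
  assumes torus: "torus_bundle B"
begin

abbreviation M where "M \<equiv> base B"
abbreviation Z where "Z \<equiv> tot B"
abbreviation p where "p \<equiv> prj B"
abbreviation s0 where "s0 \<equiv> zero_section B"

lemma
  shows M_atlas: "smooth_atlas M" and Z_atlas: "smooth_atlas Z"
    and p_smooth: "smooth_map Z M UNIV p" and s0_smooth: "smooth_map M Z UNIV s0"
  using torus by (simp_all add: torus_bundle_def)

lemma trivs_cover:
  obtains U \<psi> where "(U, \<psi>) \<in> trivs B" "x \<in> U"
proof -
  have "x \<in> (\<Union>(U, \<psi>)\<in>trivs B. U)" using torus by (simp add: torus_bundle_def)
  then show thesis using that by auto
qed

lemma trivs_transition:
  assumes "(U, \<psi>) \<in> trivs B" "(U', \<psi>') \<in> trivs B" "x \<in> U" "x \<in> U'"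
  obtains N P where "open N" "x \<in> N" "N \<subseteq> U \<inter> U'" "P \<in> GL_int" "\<And>x y. x \<in> N \<Longrightarrow> \<psi>' x y = \<psi> x (P *v y)"
proof -
  have "\<forall>(U, \<psi>)\<in>trivs B. \<forall>(U', \<psi>')\<in>trivs B. \<forall>x0\<in>U \<inter> U'.
        \<exists>N P. open N \<and> x0 \<in> N \<and> N \<subseteq> U \<inter> U' \<and> P \<in> GL_int \<and> (\<forall>x\<in>N. \<forall>y. \<psi>' x y = \<psi> x (P *v y))"
    using torus by (simp add: torus_bundle_def)
  from bspec[OF this assms(1), simplified, THEN bspec, OF assms(2), simplified, THEN bspec, of x] assms(3,4)
  show thesis using that by auto
qed

end

locale torus_triv = torus B
  for B :: "('m::{t2_space, second_countable_topology}, 'f::euclidean_space,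
             'z::{t2_space, second_countable_topology}, 'e::euclidean_space, 'n::finite) torus_bundle" +
  fixes U :: "'m set" and \<psi> :: "'m \<Rightarrow> real ^ 'n \<Rightarrow> 'z"
  assumes triv: "(U, \<psi>) \<in> trivs B"
begin

lemma local_triv: "local_triv B U \<psi>" and \<psi>_zero: "x \<in> U \<Longrightarrow> \<psi> x 0 = s0 x"
proof -
  have "\<forall>(U, \<psi>)\<in>trivs B. local_triv B U \<psi> \<and> (\<forall>x\<in>U. s0 x = \<psi> x 0)"
    using torus by (simp add: torus_bundle_def)
  from bspec[OF this triv] have "local_triv B U \<psi> \<and> (\<forall>x\<in>U. s0 x = \<psi> x 0)" by simp
  then show "local_triv B U \<psi>" "x \<in> U \<Longrightarrow> \<psi> x 0 = s0 x" by auto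
qed

lemma
  shows U_open: "open U"
    and \<psi>_smooth_product: "smooth_map (product_atlas M euclidean_atlas) Z (U \<times> UNIV) (\<lambda>(x, y). \<psi> x y)"
    and p_\<psi>: "x \<in> U \<Longrightarrow> p (\<psi> x y) = x"
    and \<psi>_eq_iff: "x \<in> U \<Longrightarrow> \<psi> x y = \<psi> x y' \<longleftrightarrow> (\<forall>i. (y - y') $ i \<in> \<int>)"
  using local_triv by (simp_all add: local_triv_def)

lemma local_inverse:
  assumes "p z \<in> U"
  obtains W l where "open W" "z \<in> W" "smooth_fun Z W l" "\<And>z'. z' \<in> W \<Longrightarrow> p z' \<in> U \<and> \<psi> (p z') (l z') = z'"
proof -
  have "\<exists>W l. open W \<and> z \<in> W \<and> smooth_map (tot B) euclidean_atlas W l \<and>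
               (\<forall>z'\<in>W. prj B z' \<in> U \<and> \<psi> (prj B z') (l z') = z')"
    using local_triv assms by (simp add: local_triv_def)
  then show thesis using that by auto
qed

section \<open>The trivialization in coordinates and its partial differentials\<close>

definition \<Psi> where "\<Psi> D \<kappa> = (\<lambda>(a, y). \<psi> (inv_into D \<kappa> a) y)"

text \<open>The chart \<open>\<kappa>\<close> times the identity is one of the charts over which
  \<open>\<psi>_smooth_product\<close> quantifies. Reading \<open>\<psi>\<close> in it gives a map
  from a Euclidean open set, to which the composition and chain rules for smooth atlases apply
  directly.\<close>

lemma \<Psi>_smooth:
  assumes c: "(D, \<kappa>) \<in> M"
  shows "smooth_map euclidean_atlas Z (\<kappa> ` (D \<inter> U) \<times> UNIV) (\<Psi> D \<kappa>)"
  unfolding smooth_map_def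
proof (intro conjI)
  let ?S = "\<kappa> ` (D \<inter> U) \<times> (UNIV :: (real ^ 'n) set)"
  let ?f = "\<lambda>(x, y). \<psi> x y"
  have S: "open ?S" by (intro open_Times open_UNIV chart_image_Int_open[OF M_atlas c U_open])
  have ci: "continuous_on ?S (\<lambda>q. (inv_into D \<kappa> (fst q), snd q))"
    by (intro continuous_on_Pair continuous_on_compose2[OF chart_inv_continuous[OF M_atlas c]]
        continuous_on_fst continuous_on_snd continuous_on_id) auto
  have im: "(\<lambda>q. (inv_into D \<kappa> (fst q), snd q)) ` ?S \<subseteq> U \<times> UNIV"
    using chart_inv[OF M_atlas c] by auto
  show cont: "continuous_on ?S (\<Psi> D \<kappa>)"
    using continuous_on_compose2[OF smooth_map_continuous[OF \<psi>_smooth_product] ci im]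
    by (simp add: \<Psi>_def case_prod_beta)
  show "\<forall>(D1, \<phi>1)\<in>euclidean_atlas. \<forall>(D', \<phi>')\<in>Z.
      smooth_on (\<phi>1 ` (D1 \<inter> ?S \<inter> \<Psi> D \<kappa> -` D')) (\<phi>' \<circ> \<Psi> D \<kappa> \<circ> inv_into D1 \<phi>1)"
  proof (simp, clarify)
    fix D' \<phi>' assume c': "(D', \<phi>') \<in> Z"
    have pc: "(D \<times> UNIV, map_prod \<kappa> id) \<in> product_atlas M (euclidean_atlas :: (real ^ 'n, real ^ 'n) chart set)"
      unfolding product_atlas_def using c by auto
    let ?T = "map_prod \<kappa> id ` (D \<times> UNIV \<inter> U \<times> UNIV \<inter> ?f -` D')"
    have inj: "inj_on \<kappa> D" using chart_inv[OF M_atlas c] by (metis inj_on_inverseI)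
    have inv: "inv_into (D \<times> UNIV) (map_prod \<kappa> id) (a, y) = (inv_into D \<kappa> a, y)" if "a \<in> \<kappa> ` D" for a and y :: "real ^ 'n"
    proof (rule inv_into_f_eq)
      show "inj_on (map_prod \<kappa> id) (D \<times> (UNIV :: (real ^ 'n) set))" using inj by (auto simp: inj_on_def)
      show "(inv_into D \<kappa> a, y) \<in> D \<times> UNIV" using that by (simp add: inv_into_into)
      show "map_prod \<kappa> id (inv_into D \<kappa> a, y) = (a, y)" using that by (simp add: chart_inv_right)
    qed
    have T: "?T = ?S \<inter> \<Psi> D \<kappa> -` D'"
    proof (intro equalityI subsetI)
      fix q assume "q \<in> ?T"
      then obtain x y where "q = (\<kappa> x, y)" "x \<in> D" "x \<in> U" "\<psi> x y \<in> D'" by auto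
      then show "q \<in> ?S \<inter> \<Psi> D \<kappa> -` D'" by (simp add: \<Psi>_def chart_inv[OF M_atlas c])
    next
      fix q assume "q \<in> ?S \<inter> \<Psi> D \<kappa> -` D'"
      then obtain x y where q: "q = (\<kappa> x, y)" "x \<in> D" "x \<in> U" "\<Psi> D \<kappa> (\<kappa> x, y) \<in> D'" by auto
      then have "\<psi> x y \<in> D'" by (simp add: \<Psi>_def chart_inv[OF M_atlas c])
      then show "q \<in> ?T" using q by (intro image_eqI[of _ _ "(x, y)"]) auto
    qed
    have o: "open (?S \<inter> \<Psi> D \<kappa> -` D')"
      by (rule continuous_open_preimage[OF cont S chart_open[OF Z_atlas c']])
    have "smooth_on (?S \<inter> \<Psi> D \<kappa> -` D') (\<phi>' \<circ> ?f \<circ> inv_into (D \<times> UNIV) (map_prod \<kappa> id))"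
      using smooth_map_in_charts[OF \<psi>_smooth_product pc c'] unfolding T .
    then show "smooth_on (?S \<inter> \<Psi> D \<kappa> -` D') (\<phi>' \<circ> \<Psi> D \<kappa>)"
    proof (rule smooth_on_congI[OF _ o])
      fix q assume "q \<in> ?S \<inter> \<Psi> D \<kappa> -` D'"
      then obtain a y where q: "q = (a, y)" "a \<in> \<kappa> ` D" by auto
      show "(\<phi>' \<circ> ?f \<circ> inv_into (D \<times> UNIV) (map_prod \<kappa> id)) q = (\<phi>' \<circ> \<Psi> D \<kappa>) q"
        by (simp add: q(1) inv[OF q(2)] \<Psi>_def)
    qed
  qed
qed

lemma \<Psi>_domain_open: "(D, \<kappa>) \<in> M \<Longrightarrow> open (\<kappa> ` (D \<inter> U) \<times> (UNIV :: (real ^ 'n) set))"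
  by (intro open_Times open_UNIV chart_image_Int_open[OF M_atlas _ U_open])

lemma \<Psi>_chart: "(D, \<kappa>) \<in> M \<Longrightarrow> x \<in> D \<Longrightarrow> \<Psi> D \<kappa> (\<kappa> x, y) = \<psi> x y"
  by (simp add: \<Psi>_def chart_inv[OF M_atlas])

text \<open>For a smooth family \<open>t \<mapsto> (u t, h t)\<close> in \<open>U \<times> \<real>\<^sup>n\<close> and a chart \<open>\<kappa>\<close> of the base,
  \<open>\<psi> (u t) (h t)\<close> is the composite of \<open>\<Psi>\<close> with the smooth map \<open>(\<kappa> \<circ> u, h)\<close> to a Euclidean space.\<close>

lemma chart_family_smooth:
  assumes C: "smooth_atlas C" and T: "open T" and u: "smooth_map C M T u" and h: "smooth_fun C T h"
    and sub: "u ` T \<subseteq> U" and c: "(D, \<kappa>) \<in> M"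
  shows "open (T \<inter> u -` D)"
    and "smooth_fun C (T \<inter> u -` D) (\<lambda>t. (\<kappa> (u t), h t))"
    and "(\<lambda>t. (\<kappa> (u t), h t)) ` (T \<inter> u -` D) \<subseteq> \<kappa> ` (D \<inter> U) \<times> UNIV"
proof -
  let ?N = "T \<inter> u -` D"
  show N: "open ?N" by (rule open_Int_vimage[OF smooth_map_continuous[OF u] T chart_open[OF M_atlas c]])
  have "smooth_fun C ?N (\<lambda>t. \<kappa> (u t))"
    by (rule smooth_map_compose[OF C M_atlas smooth_atlas_euclidean N chart_open[OF M_atlas c] smooth_map_subset[OF u] smooth_fun_chart[OF M_atlas c]]) auto
  then show "smooth_fun C ?N (\<lambda>t. (\<kappa> (u t), h t))"
    by (rule smooth_fun_Pair[OF C N _ smooth_map_subset[OF h]]) simp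
  show "(\<lambda>t. (\<kappa> (u t), h t)) ` ?N \<subseteq> \<kappa> ` (D \<inter> U) \<times> UNIV" using sub by auto
qed

lemma \<psi>_smooth:
  assumes C: "smooth_atlas C" and T: "open T" and u: "smooth_map C M T u" and h: "smooth_fun C T h"
    and sub: "u ` T \<subseteq> U"
  shows "smooth_map C Z T (\<lambda>t. \<psi> (u t) (h t))"
proof (rule smooth_map_local[OF C Z_atlas])
  fix t assume t: "t \<in> T"
  obtain D \<kappa> where c: "(D, \<kappa>) \<in> M" "u t \<in> D" using chart_exists[OF M_atlas] .
  note f = chart_family_smooth[OF C T u h sub c(1)]
  have "smooth_map C Z (T \<inter> u -` D) (\<lambda>t. \<Psi> D \<kappa> (\<kappa> (u t), h t))"
    by (rule smooth_map_compose[OF C smooth_atlas_euclidean Z_atlas f(1) \<Psi>_domain_open[OF c(1)] f(2) \<Psi>_smooth[OF c(1)] f(3)])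
  then have "smooth_map C Z (T \<inter> u -` D) (\<lambda>t. \<psi> (u t) (h t))"
    by (rule smooth_map_cong[OF C f(1) Z_atlas]) (simp add: \<Psi>_chart[OF c(1)])
  with f(1) t c(2) show "\<exists>N. open N \<and> t \<in> N \<and> smooth_map C Z N (\<lambda>t. \<psi> (u t) (h t))" by blast
qed

text \<open>The partial differentials of \<open>\<psi>\<close> along the fibre and along the base.
  The sheets \<open>y = const\<close> turn out to be the leaves of the flat connection, so that
  \<open>Hd\<close> computes the horizontal lift (\<open>horiz_lift_eq\<close>).\<close>

definition Vd where "Vd x y v = differential euclidean_atlas Z (\<psi> x) y v"
definition Hd where "Hd x y w = differential M Z (\<lambda>x. \<psi> x y) x w"

lemma \<psi>_smooth_vertical: "x \<in> U \<Longrightarrow> smooth_map euclidean_atlas Z UNIV (\<psi> x)"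
  using \<psi>_smooth[OF smooth_atlas_euclidean open_UNIV smooth_map_const[OF smooth_atlas_euclidean M_atlas open_UNIV] smooth_fun_ident_euclidean, of x]
  by simp

lemma \<psi>_smooth_horizontal: "smooth_map M Z U (\<lambda>x. \<psi> x y)"
  using \<psi>_smooth[OF M_atlas U_open smooth_map_id[OF M_atlas] smooth_fun_const[OF M_atlas U_open]] by simp

lemma Vd_linear: "x \<in> U \<Longrightarrow> linear (Vd x y)"
  unfolding Vd_def by (rule differential_linear[OF smooth_atlas_euclidean Z_atlas open_UNIV UNIV_I \<psi>_smooth_vertical])

lemma Hd_linear: "x \<in> U \<Longrightarrow> linear (Hd x y)"
  unfolding Hd_def by (rule differential_linear[OF M_atlas Z_atlas U_open _ \<psi>_smooth_horizontal])

lemma Vd_\<Psi>: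
  assumes c: "(D, \<kappa>) \<in> M" and x: "x \<in> D" "x \<in> U"
  shows "Vd x y v = differential euclidean_atlas Z (\<Psi> D \<kappa>) (\<kappa> x, y) (0, v)"
proof -
  let ?g = "\<lambda>y :: real ^ 'n. (\<kappa> x, y)"
  have g: "smooth_fun euclidean_atlas UNIV ?g"
    by (rule smooth_fun_Pair[OF smooth_atlas_euclidean open_UNIV smooth_fun_const[OF smooth_atlas_euclidean open_UNIV] smooth_fun_ident_euclidean])
  have "(?g has_derivative (\<lambda>v. (0, v))) (at y)"
    by (intro has_derivative_Pair has_derivative_const has_derivative_ident)
  from frechet_derivative_at[OF this, symmetric]
  have d: "differential euclidean_atlas euclidean_atlas ?g y v = (0, v)" by simp
  have "Vd x y v = differential euclidean_atlas Z (\<lambda>y. \<Psi> D \<kappa> (?g y)) y v"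
    by (simp add: Vd_def \<Psi>_chart[OF c x(1)])
  also have "\<dots> = differential euclidean_atlas Z (\<Psi> D \<kappa>) (?g y) (differential euclidean_atlas euclidean_atlas ?g y v)"
    by (rule differential_compose[OF smooth_atlas_euclidean smooth_atlas_euclidean Z_atlas open_UNIV UNIV_I g \<Psi>_domain_open[OF c] _ \<Psi>_smooth[OF c]])
       (use x in auto)
  finally show ?thesis unfolding d .
qed

lemma Hd_\<Psi>:
  assumes c: "(D, \<kappa>) \<in> M" and x: "x \<in> D" "x \<in> U"
  shows "Hd x y w = differential euclidean_atlas Z (\<Psi> D \<kappa>) (\<kappa> x, y) (dfun M \<kappa> x w, 0)"
proof -
  let ?N = "D \<inter> U"
  have N: "open ?N" "x \<in> ?N" using open_Int[OF chart_open[OF M_atlas c] U_open] x by auto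
  let ?g = "\<lambda>x. (\<kappa> x, y)"
  have \<kappa>: "smooth_fun M ?N \<kappa>" by (rule smooth_map_subset[OF smooth_fun_chart[OF M_atlas c]]) simp
  have cst: "smooth_fun M ?N (\<lambda>x. y)" by (rule smooth_fun_const[OF M_atlas N(1)])
  have g: "smooth_fun M ?N ?g" by (rule smooth_fun_Pair[OF M_atlas N(1) \<kappa> cst])
  have d: "dfun M ?g x w = (dfun M \<kappa> x w, 0)"
  proof -
    have "fst (dfun M ?g x w) = dfun M (\<lambda>x. fst (?g x)) x w" "snd (dfun M ?g x w) = dfun M (\<lambda>x. snd (?g x)) x w"
      by (rule dfun_bounded_linear[OF M_atlas N g bounded_linear_fst, symmetric]
          dfun_bounded_linear[OF M_atlas N g bounded_linear_snd, symmetric])+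
    then show ?thesis by (simp add: prod_eq_iff dfun_const)
  qed
  have "Hd x y w = differential M Z (\<lambda>x. \<Psi> D \<kappa> (?g x)) x w"
    unfolding Hd_def by (subst differential_cong[OF M_atlas N]) (simp_all add: \<Psi>_chart[OF c])
  also have "\<dots> = differential euclidean_atlas Z (\<Psi> D \<kappa>) (?g x) (dfun M ?g x w)"
    by (rule differential_compose[OF M_atlas smooth_atlas_euclidean Z_atlas N g \<Psi>_domain_open[OF c] _ \<Psi>_smooth[OF c]])
       (use x in auto)
  finally show ?thesis unfolding d .
qed

lemma differential_\<Psi>:
  assumes c: "(D, \<kappa>) \<in> M" and x: "x \<in> D" "x \<in> U"
  shows "differential euclidean_atlas Z (\<Psi> D \<kappa>) (\<kappa> x, y) (dfun M \<kappa> x w, v) = Hd x y w + Vd x y v"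
proof -
  have "linear (differential euclidean_atlas Z (\<Psi> D \<kappa>) (\<kappa> x, y))"
    by (rule differential_linear[OF smooth_atlas_euclidean Z_atlas \<Psi>_domain_open[OF c] _ \<Psi>_smooth[OF c]]) (use x in auto)
  from linear_add[OF this, of "(dfun M \<kappa> x w, 0)" "(0, v)"] show ?thesis
    by (simp add: Hd_\<Psi>[OF c x] Vd_\<Psi>[OF c x])
qed

lemma dfun_Pair:
  assumes "smooth_atlas C" "open T" "t \<in> T" "smooth_fun C T f" "smooth_fun C T g"
  shows "dfun C (\<lambda>t. (f t, g t)) t v = (dfun C f t v, dfun C g t v)"
  using dfun_bounded_linear[OF assms(1-3) smooth_fun_Pair[OF assms(1,2,4,5)] bounded_linear_fst, of v]
    dfun_bounded_linear[OF assms(1-3) smooth_fun_Pair[OF assms(1,2,4,5)] bounded_linear_snd, of v]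
  by (simp add: prod_eq_iff)

lemma differential_\<psi>:
  assumes C: "smooth_atlas C" and T: "open T" "t \<in> T" and u: "smooth_map C M T u" and h: "smooth_fun C T h"
    and sub: "u ` T \<subseteq> U"
  shows "differential C Z (\<lambda>t. \<psi> (u t) (h t)) t v = Hd (u t) (h t) (differential C M u t v) + Vd (u t) (h t) (dfun C h t v)"
proof -
  obtain D \<kappa> where c: "(D, \<kappa>) \<in> M" "u t \<in> D" using chart_exists[OF M_atlas] .
  note f = chart_family_smooth[OF C T(1) u h sub c(1)]
  let ?N = "T \<inter> u -` D" and ?g = "\<lambda>t. (\<kappa> (u t), h t)"
  have t: "t \<in> ?N" "u t \<in> U" using T c sub by auto
  have gt: "?g t \<in> \<kappa> ` (D \<inter> U) \<times> UNIV" using f(3) t by blast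
  have h': "smooth_fun C ?N h" by (rule smooth_map_subset[OF h]) simp
  have \<kappa>u: "smooth_fun C ?N (\<lambda>t. \<kappa> (u t))" using smooth_fun_bounded_linear[OF C f(1) bounded_linear_fst f(2)] by simp
  have "dfun C (\<lambda>t. \<kappa> (u t)) t v = dfun M \<kappa> (u t) (differential C M u t v)"
    by (rule differential_compose[OF C M_atlas smooth_atlas_euclidean T u chart_open[OF M_atlas c(1)] c(2) smooth_fun_chart[OF M_atlas c(1)]])
  then have dg: "dfun C ?g t v = (dfun M \<kappa> (u t) (differential C M u t v), dfun C h t v)"
    by (simp add: dfun_Pair[OF C f(1) t(1) \<kappa>u h'])
  have "differential C Z (\<lambda>t. \<psi> (u t) (h t)) t v = differential C Z (\<lambda>t. \<Psi> D \<kappa> (?g t)) t v"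
    by (subst differential_cong[OF C f(1) t(1)]) (simp_all add: \<Psi>_chart[OF c(1)])
  also have "\<dots> = differential euclidean_atlas Z (\<Psi> D \<kappa>) (?g t) (dfun C ?g t v)"
    by (rule differential_compose[OF C smooth_atlas_euclidean Z_atlas f(1) t(1) f(2) \<Psi>_domain_open[OF c(1)] gt \<Psi>_smooth[OF c(1)]])
  finally show ?thesis unfolding dg by (simp add: differential_\<Psi>[OF c t(2)])
qed

text \<open>Near each parameter the field is the image under the differential of
  \<open>\<Psi>\<close> of a smooth field in Euclidean space, namely the components of
  \<open>w\<close> in \<open>\<kappa>\<close> together with \<open>k\<close>.\<close>

lemma HV_fields_along:
  assumes C: "smooth_atlas C" and T: "open T" and u: "smooth_map C M T u" and h: "smooth_fun C T h"
    and sub: "u ` T \<subseteq> U" and w: "w \<in> fields_along C M u T" and k: "smooth_fun C T k"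
  shows "(\<lambda>t. Hd (u t) (h t) (w t) + Vd (u t) (h t) (k t)) \<in> fields_along C Z (\<lambda>t. \<psi> (u t) (h t)) T"
proof (rule fields_along_local[OF C Z_atlas smooth_map_continuous[OF \<psi>_smooth[OF C T u h sub]] T])
  fix t assume t: "t \<in> T"
  obtain D \<kappa> where c: "(D, \<kappa>) \<in> M" "u t \<in> D" using chart_exists[OF M_atlas] .
  note f = chart_family_smooth[OF C T u h sub c(1)]
  let ?N = "T \<inter> u -` D" and ?g = "\<lambda>t. (\<kappa> (u t), h t)"
  have X: "smooth_fun C ?N (\<lambda>t. (dfun M \<kappa> (u t) (w t), k t))"
    by (rule smooth_fun_Pair[OF C f(1) fields_alongD[OF w c(1)] smooth_map_subset[OF k]]) simp
  have s: "(\<lambda>t. differential euclidean_atlas Z (\<Psi> D \<kappa>) (?g t) (dfun M \<kappa> (u t) (w t), k t)) \<in> fields_along C Z (\<lambda>t. \<Psi> D \<kappa> (?g t)) ?N"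
    by (rule fields_along_differential[OF C smooth_atlas_euclidean Z_atlas f(1) \<Psi>_domain_open[OF c(1)] f(2) fields_along_euclidean[OF X] \<Psi>_smooth[OF c(1)] f(3)])
  have cont: "continuous_on ?N (\<lambda>t. \<Psi> D \<kappa> (?g t))"
    by (rule smooth_map_continuous[OF smooth_map_compose[OF C smooth_atlas_euclidean Z_atlas f(1) \<Psi>_domain_open[OF c(1)] f(2) \<Psi>_smooth[OF c(1)] f(3)]])
  have "(\<lambda>t. Hd (u t) (h t) (w t) + Vd (u t) (h t) (k t)) \<in> fields_along C Z (\<lambda>t. \<psi> (u t) (h t)) ?N"
    by (rule fields_along_cong[OF C Z_atlas cont f(1) s]) (use sub in \<open>auto simp: differential_\<Psi>[OF c(1)] \<Psi>_chart[OF c(1)]\<close>)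
  with f(1) t c(2) show "\<exists>N. open N \<and> t \<in> N \<and> (\<lambda>t. Hd (u t) (h t) (w t) + Vd (u t) (h t) (k t)) \<in> fields_along C Z (\<lambda>t. \<psi> (u t) (h t)) N"
    by blast
qed

lemma dp_Vd: "x \<in> U \<Longrightarrow> differential Z M p (\<psi> x y) (Vd x y v) = 0"
proof -
  assume x: "x \<in> U"
  have "differential euclidean_atlas M (\<lambda>y. p (\<psi> x y)) y v = differential Z M p (\<psi> x y) (Vd x y v)"
    unfolding Vd_def
    by (rule differential_compose[OF smooth_atlas_euclidean Z_atlas M_atlas open_UNIV UNIV_I \<psi>_smooth_vertical[OF x] open_UNIV UNIV_I p_smooth])
  then show ?thesis by (simp add: p_\<psi>[OF x] differential_const)
qed

lemma dp_Hd: "x \<in> U \<Longrightarrow> differential Z M p (\<psi> x y) (Hd x y w) = w"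
proof -
  assume x: "x \<in> U"
  have "differential M M (\<lambda>x. p (\<psi> x y)) x w = differential Z M p (\<psi> x y) (Hd x y w)"
    unfolding Hd_def
    by (rule differential_compose[OF M_atlas Z_atlas M_atlas U_open x \<psi>_smooth_horizontal open_UNIV UNIV_I p_smooth])
  moreover have "differential M M (\<lambda>x. p (\<psi> x y)) x w = differential M M (\<lambda>x. x) x w"
    by (subst differential_cong[OF M_atlas U_open x]) (simp_all add: p_\<psi>)
  ultimately show ?thesis by (simp add: differential_ident[OF M_atlas])
qed

text \<open>Two lifts of the same family of points of \<open>Z\<close> differ by a locally constant integral vector.\<close>
lemma dfun_lift_unique:
  assumes C: "smooth_atlas C" and T: "open T" "t \<in> T" and u: "\<And>t. t \<in> T \<Longrightarrow> u t \<in> U"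
    and h: "smooth_fun C T h" and k: "smooth_fun C T k"
    and eq: "\<And>t. t \<in> T \<Longrightarrow> \<psi> (u t) (h t) = \<psi> (u t) (k t)"
  shows "dfun C h t v = dfun C k t v"
proof -
  let ?d = "\<lambda>t. h t - k t"
  have d: "smooth_fun C T ?d" by (rule smooth_fun_diff[OF C T(1) h k])
  have int: "?d t $ i \<in> \<int>" if "t \<in> T" for t i
    using eq[OF that] \<psi>_eq_iff[OF u[OF that]] by blast
  obtain N where N: "open N" "t \<in> N" "\<forall>t'\<in>N. ?d t' = ?d t"
    using locally_constant_Ints[OF T smooth_map_continuous[OF d] int] by auto
  have "dfun C ?d t v = dfun C (\<lambda>_. ?d t) t v"
    by (subst differential_cong[OF C N(1,2)]) (use N(3) in auto)
  then show ?thesis by (simp add: dfun_diff[OF C T h k] dfun_const)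
qed

end

section \<open>The flat connection and the splitting\<close>

lemma dfun_Ints_valued:
  fixes k :: "'a::{t2_space, second_countable_topology} \<Rightarrow> real ^ 'n"
  assumes C: "smooth_atlas C" and T: "open T" "t \<in> T" and k: "smooth_fun C T k"
    and int: "\<And>t i. t \<in> T \<Longrightarrow> k t $ i \<in> \<int>"
  shows "dfun C k t v = 0"
proof -
  obtain N where N: "open N" "t \<in> N" "\<forall>t'\<in>N. k t' = k t"
    using locally_constant_Ints[OF T smooth_map_continuous[OF k] int] by auto
  have "dfun C k t v = dfun C (\<lambda>_. k t) t v"
    by (subst differential_cong[OF C N(1,2)]) (use N(3) in auto)
  then show ?thesis by (simp add: dfun_const)
qed

context torus_triv
begin

text \<open>A local lift of the fibre coordinate from the torus to \<open>\<real>^n\<close>. It is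
  determined up to a locally constant integral vector, hence its differential \<open>dl\<close> is
  canonical although \<open>l\<close> is not.\<close>

definition local_coord where
  "local_coord W l \<longleftrightarrow> open W \<and> smooth_fun Z W l \<and> (\<forall>z\<in>W. p z \<in> U \<and> \<psi> (p z) (l z) = z)"

lemma local_coordD:
  assumes "local_coord W l"
  shows "open W" "smooth_fun Z W l" "z \<in> W \<Longrightarrow> p z \<in> U" "z \<in> W \<Longrightarrow> \<psi> (p z) (l z) = z" "p ` W \<subseteq> U"
  using assms by (auto simp: local_coord_def)

lemma local_coord_exists:
  assumes x: "x \<in> U"
  obtains W l where "local_coord W l" "\<psi> x y \<in> W" "l (\<psi> x y) = y"
proof -
  let ?z = "\<psi> x y"
  have pz: "p ?z = x" by (rule p_\<psi>[OF x])
  obtain W l where W: "open W" "?z \<in> W" "smooth_fun Z W l" "\<And>z'. z' \<in> W \<Longrightarrow> p z' \<in> U \<and> \<psi> (p z') (l z') = z'"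
    using local_inverse[of ?z] pz x by metis
  \<comment> \<open>An integral vector, so shifting by it gives another lift, now with the
    prescribed value \<open>y\<close> at \<open>?z\<close>.\<close>
  let ?c = "y - l ?z"
  have c: "\<forall>i. ?c $ i \<in> \<int>" using W(4)[OF W(2)] \<psi>_eq_iff[OF x, of y "l ?z"] by (simp add: pz)
  have "smooth_fun Z W (\<lambda>z. l z + ?c)"
    by (intro smooth_fun_add[OF Z_atlas W(1)] W(3) smooth_fun_const[OF Z_atlas W(1)])
  moreover have "\<psi> (p z) (l z + ?c) = z" if "z \<in> W" for z
    using \<psi>_eq_iff[of "p z" "l z + ?c" "l z"] W(4)[OF that] c by simp
  ultimately have "local_coord W (\<lambda>z. l z + ?c)" using W by (simp add: local_coord_def)
  then show thesis using that[of W "\<lambda>z. l z + ?c"] W(2) by simp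
qed

text \<open>Along the family, \<open>l\<close> of the point and \<open>h\<close> are two lifts of
  the same points, so their derivatives agree.\<close>

lemma dl_family:
  assumes lc: "local_coord W l" and C: "smooth_atlas C" and T: "open T" "t \<in> T"
    and u: "smooth_map C M T u" and h: "smooth_fun C T h" and sub: "u ` T \<subseteq> U"
    and W: "\<psi> (u t) (h t) \<in> W"
  shows "dfun Z l (\<psi> (u t) (h t)) (differential C Z (\<lambda>t. \<psi> (u t) (h t)) t v) = dfun C h t v"
proof -
  note l = local_coordD[OF lc]
  let ?c = "\<lambda>t. \<psi> (u t) (h t)"
  have c: "smooth_map C Z T ?c" by (rule \<psi>_smooth[OF C T(1) u h sub])
  let ?N = "T \<inter> ?c -` W"
  have N: "open ?N" "t \<in> ?N" using open_Int_vimage[OF smooth_map_continuous[OF c] T(1) l(1)] T W by auto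
  have c': "smooth_map C Z ?N ?c" by (rule smooth_map_subset[OF c]) simp
  have lc': "smooth_fun C ?N (\<lambda>t. l (?c t))"
    by (rule smooth_map_compose[OF C Z_atlas smooth_atlas_euclidean N(1) l(1) c' l(2)]) auto
  have h': "smooth_fun C ?N h" by (rule smooth_map_subset[OF h]) simp
  have "dfun C (\<lambda>t. l (?c t)) t v = dfun C h t v"
  proof (rule dfun_lift_unique[OF C N _ lc' h'])
    fix t assume t: "t \<in> ?N"
    then show "u t \<in> U" using sub by auto
    then have "p (?c t) = u t" by (rule p_\<psi>)
    with l(4)[of "?c t"] t show "\<psi> (u t) (l (?c t)) = ?c t" by simp
  qed
  moreover have "dfun C (\<lambda>t. l (?c t)) t v = dfun Z l (?c t) (differential C Z ?c t v)"
    by (rule differential_compose[OF C Z_atlas smooth_atlas_euclidean N c' l(1) W l(2)])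
  ultimately show ?thesis by simp
qed

lemma dl_Vd:
  assumes "local_coord W l" "x \<in> U" "\<psi> x y \<in> W"
  shows "dfun Z l (\<psi> x y) (Vd x y v) = v"
  using dl_family[OF assms(1) smooth_atlas_euclidean open_UNIV UNIV_I
      smooth_map_const[OF smooth_atlas_euclidean M_atlas open_UNIV] smooth_fun_ident_euclidean, of x y] assms(2,3)
  by (simp add: Vd_def)

lemma dl_Hd:
  assumes "local_coord W l" "x \<in> U" "\<psi> x y \<in> W"
  shows "dfun Z l (\<psi> x y) (Hd x y w) = 0"
  using dl_family[OF assms(1) M_atlas U_open assms(2) smooth_map_id[OF M_atlas] smooth_fun_const[OF M_atlas U_open, of y]] assms(2,3)
  by (simp add: Hd_def dfun_const)

text \<open>Differentiate the identity \<open>\<psi> (p z) (l z) = z\<close>.\<close>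

lemma Hd_Vd_decompose:
  assumes lc: "local_coord W l" and z: "z \<in> W"
  shows "Hd (p z) (l z) (differential Z M p z v) + Vd (p z) (l z) (dfun Z l z v) = v"
proof -
  note l = local_coordD[OF lc]
  have "differential Z Z (\<lambda>z. \<psi> (p z) (l z)) z v = differential Z Z (\<lambda>z. z) z v"
    by (subst differential_cong[OF Z_atlas l(1) z]) (simp_all add: l)
  moreover have "differential Z Z (\<lambda>z. \<psi> (p z) (l z)) z v =
      Hd (p z) (l z) (differential Z M p z v) + Vd (p z) (l z) (dfun Z l z v)"
    by (rule differential_\<psi>[OF Z_atlas l(1) z smooth_map_subset[OF p_smooth subset_UNIV] l(2,5)])
  ultimately show ?thesis by (simp add: differential_ident[OF Z_atlas])
qed

lemma p_s0: "x \<in> U \<Longrightarrow> p (s0 x) = x"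
  using p_\<psi>[of x 0] by (simp add: \<psi>_zero)

text \<open>The flat frame of \<open>V\<close> over \<open>U\<close>, and its inverse.\<close>
definition fr where "fr x y = Vd x 0 y"
definition cf where "cf x v = (THE y. fr x y = v)"

lemma fr_linear: "x \<in> U \<Longrightarrow> linear (fr x)"
  using Vd_linear[of x 0] by (simp add: fr_def[abs_def])

lemma fr_vert: "x \<in> U \<Longrightarrow> fr x y \<in> vert B x"
  using dp_Vd[of x 0 y] by (simp add: vert_def fr_def \<psi>_zero)

lemma dl_fr: "local_coord W l \<Longrightarrow> x \<in> U \<Longrightarrow> s0 x \<in> W \<Longrightarrow> dfun Z l (s0 x) (fr x y) = y"
  using dl_Vd[of W l x 0 y] by (simp add: fr_def \<psi>_zero)

lemma fr_inj:
  assumes "x \<in> U" "fr x y = fr x y'"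
  shows "y = y'"
proof -
  obtain W l where "local_coord W l" "\<psi> x 0 \<in> W" using local_coord_exists[OF assms(1)] .
  then show ?thesis using dl_fr[of W l x] assms by (metis \<psi>_zero)
qed

lemma cf_fr: "x \<in> U \<Longrightarrow> cf x (fr x y) = y"
  unfolding cf_def by (rule the_equality) (auto dest: fr_inj)

text \<open>With the lift normalized to \<open>l (s0 x) = 0\<close>, the decomposition of a vector
  in the kernel of \<open>dp\<close> at \<open>s0 x\<close> has only its vertical term, which is an
  \<open>fr\<close>.\<close>

lemma fr_cf:
  assumes x: "x \<in> U" and v: "v \<in> vert B x"
  shows "fr x (cf x v) = v"
proof -
  obtain W l where W: "local_coord W l" "\<psi> x 0 \<in> W" "l (\<psi> x 0) = 0" using local_coord_exists[OF x] .
  have "differential Z M p (s0 x) v = 0" using v by (simp add: vert_def)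
  moreover have "l (s0 x) = 0" using W(3) \<psi>_zero[OF x] by simp
  ultimately have "fr x (dfun Z l (s0 x) v) = v"
    using Hd_Vd_decompose[OF W(1,2), of v]
    by (simp add: \<psi>_zero[OF x] p_s0[OF x] fr_def linear_0[OF Hd_linear[OF x]])
  then show ?thesis using cf_fr[OF x] by metis
qed

lemma cf_dl:
  assumes "local_coord W l" "x \<in> U" "s0 x \<in> W" "v \<in> vert B x"
  shows "cf x v = dfun Z l (s0 x) v"
  using dl_fr[OF assms(1-3), of "cf x v"] fr_cf[OF assms(2,4)] by simp

lemma fr_fields_along:
  assumes C: "smooth_atlas C" and T: "open T" and g: "smooth_map C M T g" and sub: "g ` T \<subseteq> U" and k: "smooth_fun C T k"
  shows "(\<lambda>t. fr (g t) (k t)) \<in> fields_along C Z (\<lambda>t. s0 (g t)) T"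
proof -
  note c0 = smooth_fun_const[OF C T, of 0]
  have s: "(\<lambda>t. Hd (g t) 0 0 + Vd (g t) 0 (k t)) \<in> fields_along C Z (\<lambda>t. \<psi> (g t) 0) T"
    by (rule HV_fields_along[OF C T g c0 sub fields_along_zero[OF C M_atlas T smooth_map_continuous[OF g]] k])
  show ?thesis
    by (rule fields_along_cong[OF C Z_atlas smooth_map_continuous[OF \<psi>_smooth[OF C T g c0 sub]] T s])
       (use sub in \<open>auto simp: fr_def linear_0[OF Hd_linear] \<psi>_zero subset_iff\<close>)
qed

text \<open>\<open>cf\<close> is a pointwise description without visible regularity; on vertical
  vectors at the zero section it coincides with the differential of the smooth function
  \<open>l\<close>.\<close>

lemma cf_smooth:
  assumes C: "smooth_atlas C" and T: "open T" and g: "smooth_map C M T g" and sub: "g ` T \<subseteq> U"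
    and \<sigma>: "\<sigma> \<in> fields_along C Z (\<lambda>t. s0 (g t)) T" and v: "\<And>t. t \<in> T \<Longrightarrow> \<sigma> t \<in> vert B (g t)"
  shows "smooth_fun C T (\<lambda>t. cf (g t) (\<sigma> t))"
proof (rule smooth_map_local[OF C smooth_atlas_euclidean])
  fix t assume t: "t \<in> T"
  then have gt: "g t \<in> U" using sub by auto
  obtain W l where W: "local_coord W l" "\<psi> (g t) 0 \<in> W" using local_coord_exists[OF gt] .
  note l = local_coordD[OF W(1)]
  have sg: "smooth_map C Z T (\<lambda>t. s0 (g t))"
    by (rule smooth_map_compose[OF C M_atlas Z_atlas T open_UNIV g s0_smooth]) simp
  let ?N = "T \<inter> (\<lambda>t. s0 (g t)) -` W"
  have N: "open ?N" "t \<in> ?N"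
    using open_Int_vimage[OF smooth_map_continuous[OF sg] T l(1)] t W(2) \<psi>_zero[OF gt] by auto
  have s: "smooth_fun C ?N (\<lambda>t. dfun Z l (s0 (g t)) (\<sigma> t))"
    by (rule smooth_fun_dfun_along[OF C Z_atlas N(1) l(1) smooth_map_subset[OF sg] fields_along_subset[OF \<sigma>] l(2)]) auto
  have "smooth_fun C ?N (\<lambda>t. cf (g t) (\<sigma> t))"
    by (rule smooth_map_cong[OF C N(1) smooth_atlas_euclidean s]) (use sub cf_dl[OF W(1)] v in auto)
  with N show "\<exists>N. open N \<and> t \<in> N \<and> smooth_fun C N (\<lambda>t. cf (g t) (\<sigma> t))" by blast
qed

section \<open>Exponential map, group law and lattice in a trivialization\<close>

lemma transition:
  assumes t': "(U', \<psi>') \<in> trivs B" and x: "x \<in> U" "x \<in> U'"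
  shows "\<exists>P. \<forall>y. \<psi>' x y = \<psi> x (P *v y)"
proof -
  obtain N P where N: "x \<in> N" "\<And>x y. x \<in> N \<Longrightarrow> \<psi>' x y = \<psi> x (P *v y)"
    using trivs_transition[OF triv t' x] by metis
  show ?thesis by (rule exI[of _ P], rule allI, rule N(2)[OF N(1)])
qed

lemma differential_ray:
  assumes x: "x \<in> U"
  shows "differential euclidean_atlas Z (\<lambda>t::real. \<psi> x (y + t *\<^sub>R v)) 0 1 = Vd x y v"
proof -
  let ?g = "\<lambda>t::real. y + t *\<^sub>R v"
  have "(?g has_derivative (\<lambda>t. t *\<^sub>R v)) (at 0)" by (auto intro!: derivative_eq_intros)
  from frechet_derivative_at[OF this, symmetric]
  have d: "frechet_derivative ?g (at 0) 1 = v" by simp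
  have g: "smooth_fun euclidean_atlas UNIV ?g"
    by (intro smooth_fun_add[OF smooth_atlas_euclidean open_UNIV] smooth_fun_const[OF smooth_atlas_euclidean open_UNIV]
        smooth_fun_linear_euclidean[OF open_UNIV] bounded_linear_scaleR_left)
  have "differential euclidean_atlas Z (\<lambda>t. \<psi> x (?g t)) 0 1
      = differential euclidean_atlas Z (\<psi> x) (?g 0) (differential euclidean_atlas euclidean_atlas ?g 0 1)"
    by (rule differential_compose[OF smooth_atlas_euclidean smooth_atlas_euclidean Z_atlas open_UNIV UNIV_I g open_UNIV UNIV_I \<psi>_smooth_vertical[OF x]])
  then show ?thesis by (simp add: d Vd_def)
qed

lemma differential_ray_0:
  assumes x: "x \<in> U"
  shows "differential euclidean_atlas Z (\<lambda>t::real. \<psi> x (t *\<^sub>R v)) 0 1 = fr x v"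
  using differential_ray[OF x, of 0 v] by (simp add: fr_def)

text \<open>Another trivialization differs on the fibre by a linear map \<open>P\<close>, which
  sends the ray through \<open>y'\<close> to the ray through \<open>P *v y'\<close>. The initial
  velocity then determines \<open>P *v y'\<close> by injectivity of \<open>fr\<close>, so the
  endpoint is independent of the trivialization.\<close>

lemma fiber_exp_fr:
  assumes x: "x \<in> U"
  shows "fiber_exp B x (fr x y) = \<psi> x y"
  unfolding fiber_exp_def
proof (rule the_equality)
  show "\<exists>(U1, \<psi>1)\<in>trivs B. x \<in> U1 \<and>
     (\<exists>y'. differential euclidean_atlas Z (\<lambda>t::real. \<psi>1 x (t *\<^sub>R y')) 0 1 = fr x y \<and> \<psi> x y = \<psi>1 x y')"
    using triv x differential_ray_0[OF x, of y] by blast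
next
  fix z assume "\<exists>(U, \<psi>)\<in>trivs B. x \<in> U \<and>
     (\<exists>y'. differential euclidean_atlas Z (\<lambda>t::real. \<psi> x (t *\<^sub>R y')) 0 1 = fr x y \<and> z = \<psi> x y')"
  then obtain U' \<psi>' y' where t': "(U', \<psi>') \<in> trivs B" "x \<in> U'"
    and y': "differential euclidean_atlas Z (\<lambda>t::real. \<psi>' x (t *\<^sub>R y')) 0 1 = fr x y" "z = \<psi>' x y'" by auto
  obtain P where P: "\<forall>y. \<psi>' x y = \<psi> x (P *v y)" using transition[OF t'(1) x t'(2)] ..
  have "fr x (P *v y') = fr x y"
    using y'(1) by (simp add: P matrix_vector_mult_scaleR differential_ray_0[OF x])
  from fr_inj[OF x this] show "z = \<psi> x y" using y'(2) P by simp
qed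

text \<open>In a second trivialization the summands are \<open>P *v a\<close> and
  \<open>P *v b\<close>, which agree with \<open>y\<close> and \<open>y'\<close> modulo integral
  vectors; additivity of \<open>P\<close> finishes.\<close>

lemma fiber_add_\<psi>:
  assumes x: "x \<in> U"
  shows "fiber_add B (\<psi> x y) (\<psi> x y') = \<psi> x (y + y')"
  unfolding fiber_add_def
proof (rule the_equality)
  show "\<exists>(U1, \<psi>1)\<in>trivs B. \<exists>x'\<in>U1. \<exists>a b. \<psi> x y = \<psi>1 x' a \<and> \<psi> x y' = \<psi>1 x' b \<and> \<psi> x (y + y') = \<psi>1 x' (a + b)"
    using triv x by blast
next
  fix z assume "\<exists>(U1, \<psi>1)\<in>trivs B. \<exists>x'\<in>U1. \<exists>a b. \<psi> x y = \<psi>1 x' a \<and> \<psi> x y' = \<psi>1 x' b \<and> z = \<psi>1 x' (a + b)"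
  then obtain U' \<psi>' x' a b where t': "(U', \<psi>') \<in> trivs B" "x' \<in> U'"
    and e: "\<psi> x y = \<psi>' x' a" "\<psi> x y' = \<psi>' x' b" "z = \<psi>' x' (a + b)" by auto
  interpret t': torus_triv B U' \<psi>' by unfold_locales (rule t')
  have x': "x' = x" using p_\<psi>[OF x, of y] t'.p_\<psi>[OF t'(2), of a] e(1) by simp
  obtain P where P: "\<forall>y. \<psi>' x y = \<psi> x (P *v y)" using transition[OF t'(1) x] t'(2) x' by auto
  have "\<forall>i. (y - P *v a) $ i \<in> \<int>" "\<forall>i. (y' - P *v b) $ i \<in> \<int>"
    using e(1,2) P x' \<psi>_eq_iff[OF x] by metis+
  then have "\<forall>i. ((P *v a + P *v b) - (y + y')) $ i \<in> \<int>"
  proof (intro allI)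
    fix i assume "\<forall>i. (y - P *v a) $ i \<in> \<int>" "\<forall>i. (y' - P *v b) $ i \<in> \<int>"
    then have "- ((y - P *v a) $ i + (y' - P *v b) $ i) \<in> \<int>" by (intro Ints_minus Ints_add) auto
    then show "((P *v a + P *v b) - (y + y')) $ i \<in> \<int>" by (simp add: algebra_simps)
  qed
  then have "\<psi> x (P *v a + P *v b) = \<psi> x (y + y')" using \<psi>_eq_iff[OF x] by blast
  then show "z = \<psi> x (y + y')" using e(3) P x' by (simp add: matrix_vector_right_distrib)
qed

text \<open>Translation by \<open>\<psi> x y\<close> carries the ray through 0 in direction
  \<open>v\<close> to the ray from \<open>y\<close> in the same direction.\<close>

lemma vert_incl_fr:
  assumes x: "x \<in> U"
  shows "vert_incl B (\<psi> x y) (fr x v) = Vd x y v"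
proof -
  have "t *\<^sub>R fr x v = fr x (t *\<^sub>R v)" for t by (simp add: linear_scale[OF fr_linear[OF x]])
  then show ?thesis
    unfolding vert_incl_def using differential_ray[OF x, of y v]
    by (simp add: p_\<psi>[OF x] fiber_exp_fr[OF x] fiber_add_\<psi>[OF x])
qed

lemma vert_lattice_iff:
  assumes x: "x \<in> U"
  shows "fr x y \<in> vert_lattice B x \<longleftrightarrow> (\<forall>i. y $ i \<in> \<int>)"
  using \<psi>_eq_iff[OF x, of y 0] by (simp add: vert_lattice_def fr_vert[OF x] fiber_exp_fr[OF x] \<psi>_zero[OF x])

lemma fr_expand:
  assumes x: "x \<in> U"
  shows "fr x y = (\<Sum>i\<in>UNIV. (y $ i) *\<^sub>R fr x (axis i 1))"
proof -
  have "fr x y = fr x (\<Sum>i\<in>UNIV. (y $ i) *\<^sub>R axis i 1)"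
    using basis_expansion[of y] by (simp add: scalar_mult_eq_scaleR)
  then show ?thesis by (simp add: linear_sum[OF fr_linear[OF x]] linear_scale[OF fr_linear[OF x]])
qed

section \<open>The connection and the splitting in the flat frame\<close>

lemma sections_vert_bundle:
  "\<sigma> \<in> sections (vert_bundle B) T \<longleftrightarrow> (\<forall>x\<in>T. \<sigma> x \<in> vert B x) \<and> \<sigma> \<in> fields_along M Z s0 T"
  by (simp add: vert_bundle_def vert_pullback_def comp_def)

lemma fr_section:
  assumes T: "open T" "T \<subseteq> U" and k: "smooth_fun M T k"
  shows "(\<lambda>x. fr x (k x)) \<in> sections (vert_bundle B) T"
  unfolding sections_vert_bundle
  using fr_fields_along[OF M_atlas T(1) smooth_map_id[OF M_atlas] _ k] T(2) fr_vert by auto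

lemma cf_section_smooth:
  assumes T: "open T" "T \<subseteq> U" and \<sigma>: "\<sigma> \<in> sections (vert_bundle B) T"
  shows "smooth_fun M T (\<lambda>x. cf x (\<sigma> x))"
  using \<sigma> cf_smooth[OF M_atlas T(1) smooth_map_id[OF M_atlas], of \<sigma>] T(2) unfolding sections_vert_bundle by auto

lemma lattice_frame_fr: "lattice_frame B U (\<lambda>i x. fr x (axis i 1))"
proof -
  have "(\<lambda>x. fr x (axis i 1)) \<in> sections (vert_bundle B) U" for i
    by (rule fr_section[OF U_open subset_refl smooth_fun_const[OF M_atlas U_open]])
  moreover have "fr x (axis i 1) \<in> vert_lattice B x" if "x \<in> U" for x i
    by (simp add: vert_lattice_iff[OF that] axis_def)
  moreover have "bij_betw (\<lambda>c. \<Sum>i\<in>UNIV. (c $ i) *\<^sub>R fr x (axis i 1)) UNIV (vert B x)" if x: "x \<in> U" for x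
    unfolding fr_expand[OF x, symmetric]
    by (rule bij_betwI[of _ _ _ "cf x"]) (auto simp: fr_vert[OF x] cf_fr[OF x] fr_cf[OF x])
  ultimately show ?thesis by (simp add: lattice_frame_def U_open)
qed

text \<open>The description ranges over all lattice frames. The standard frame gives the stated
  value; any other frame must be shown to give the same.\<close>

lemma pull_conn_fr:
  assumes C: "smooth_atlas C" and W: "open W" "a \<in> W" and g: "smooth_map C M W g" and sub: "g ` W \<subseteq> U"
    and k: "smooth_fun C W k" and \<sigma>: "\<And>b. b \<in> W \<Longrightarrow> \<sigma> b = fr (g b) (k b)"
  shows "pull_conn B C g a u \<sigma> = fr (g a) (dfun C k a u)"
  unfolding pull_conn_def
proof (rule the_equality)
  have ga: "g a \<in> U" using W sub by auto
  have "dfun C (\<lambda>b. k b $ i) a u = dfun C k a u $ i" for i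
    by (rule dfun_bounded_linear[OF C W k bounded_linear_vec_nth])
  then have "fr (g a) (dfun C k a u) = (\<Sum>i\<in>UNIV. dfun C (\<lambda>b. k b $ i) a u *\<^sub>R fr (g a) (axis i 1))"
    by (simp add: fr_expand[OF ga, of "dfun C k a u"])
  moreover have "\<sigma> b = (\<Sum>i\<in>UNIV. (k b $ i) *\<^sub>R fr (g b) (axis i 1))" if "b \<in> W" for b
  proof -
    have "g b \<in> U" using that sub by auto
    from \<sigma>[OF that] fr_expand[OF this, of "k b"] show ?thesis by simp
  qed
  moreover have "smooth_fun C W (\<lambda>b. k b $ i)" for i
    by (rule smooth_fun_bounded_linear[OF C W(1) bounded_linear_vec_nth k])
  ultimately show "\<exists>U lam W h. lattice_frame B U lam \<and> open W \<and> a \<in> W \<and> g ` W \<subseteq> U \<and> (\<forall>i. smooth_fun C W (h i)) \<and>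
     (\<forall>b\<in>W. \<sigma> b = (\<Sum>i\<in>UNIV. h i b *\<^sub>R lam i (g b))) \<and>
     fr (g a) (dfun C k a u) = (\<Sum>i\<in>UNIV. dfun C (h i) a u *\<^sub>R lam i (g a))"
    using lattice_frame_fr W sub
    by (intro exI[of _ U] exI[of _ "\<lambda>i x. fr x (axis i 1)"] exI[of _ W] exI[of _ "\<lambda>i b. k b $ i"]) auto
next
  fix v assume "\<exists>U lam W h. lattice_frame B U lam \<and> open W \<and> a \<in> W \<and> g ` W \<subseteq> U \<and> (\<forall>i. smooth_fun C W (h i)) \<and>
     (\<forall>b\<in>W. \<sigma> b = (\<Sum>i\<in>UNIV. h i b *\<^sub>R lam i (g b))) \<and>
     v = (\<Sum>i\<in>UNIV. dfun C (h i) a u *\<^sub>R lam i (g a))"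
  then obtain U' lam W' h where lf: "lattice_frame B U' lam" and W': "open W'" "a \<in> W'" "g ` W' \<subseteq> U'"
    and h: "\<forall>i. smooth_fun C W' (h i)" and \<sigma>': "\<forall>b\<in>W'. \<sigma> b = (\<Sum>i\<in>UNIV. h i b *\<^sub>R lam i (g b))"
    and v: "v = (\<Sum>i\<in>UNIV. dfun C (h i) a u *\<^sub>R lam i (g a))" by blast
  let ?X = "U \<inter> U'"
  have X: "open ?X" using U_open lf by (auto simp: lattice_frame_def)
  have lam: "lam i \<in> sections (vert_bundle B) U'" "\<And>x. x \<in> U' \<Longrightarrow> lam i x \<in> vert_lattice B x" for i
    using lf by (auto simp: lattice_frame_def)
  have lamv: "lam i x \<in> vert B x" if "x \<in> U'" for i x
    using lam(2)[OF that] by (simp add: vert_lattice_def)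
  have "lam i \<in> sections (vert_bundle B) ?X" for i
    using lam(1)[of i] fields_along_subset[of "lam i" M Z s0 U' ?X] by (simp add: sections_vert_bundle)
  then have m: "smooth_fun M ?X (\<lambda>x. cf x (lam i x))" for i by (intro cf_section_smooth X) auto
  let ?T = "W \<inter> W'"
  have T: "open ?T" "a \<in> ?T" using W W' by auto
  have gT: "g ` ?T \<subseteq> ?X" using sub W' by auto
  have g': "smooth_map C M ?T g" by (rule smooth_map_subset[OF g]) simp
  have mg: "smooth_fun C ?T (\<lambda>b. cf (g b) (lam i (g b)))" for i
    by (rule smooth_map_compose[OF C M_atlas smooth_atlas_euclidean T(1) X g' m gT])
  \<comment> \<open>Lattice sections have integral coordinates in the flat frame. Being continuous,
    these are locally constant, so the change of frame contributes nothing to the Leibniz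
    rule.\<close>
  have mg0: "dfun C (\<lambda>b. cf (g b) (lam i (g b))) a u = 0" for i
  proof (rule dfun_Ints_valued[OF C T mg])
    fix t j assume "t \<in> ?T"
    then have gt: "g t \<in> U" "g t \<in> U'" using gT by auto
    show "cf (g t) (lam i (g t)) $ j \<in> \<int>"
      using vert_lattice_iff[OF gt(1), of "cf (g t) (lam i (g t))"] lam(2)[OF gt(2)] lamv[OF gt(2)]
      by (simp add: fr_cf[OF gt(1)])
  qed
  have h': "smooth_fun C ?T (h i)" for i by (rule smooth_map_subset[OF spec[OF h]]) simp
  have k_eq: "k b = (\<Sum>i\<in>UNIV. h i b *\<^sub>R cf (g b) (lam i (g b)))" if b: "b \<in> ?T" for b
  proof -
    have gb: "g b \<in> U" "g b \<in> U'" using b gT by auto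
    have "fr (g b) (\<Sum>i\<in>UNIV. h i b *\<^sub>R cf (g b) (lam i (g b))) = (\<Sum>i\<in>UNIV. h i b *\<^sub>R lam i (g b))"
      by (simp add: linear_sum[OF fr_linear[OF gb(1)]] linear_scale[OF fr_linear[OF gb(1)]] fr_cf[OF gb(1) lamv[OF gb(2)]])
    also have "\<dots> = fr (g b) (k b)" using \<sigma>[of b] \<sigma>' b by simp
    finally show ?thesis using fr_inj[OF gb(1)] by metis
  qed
  have ga: "g a \<in> U" "g a \<in> U'" using T gT by auto
  have "dfun C k a u = dfun C (\<lambda>b. \<Sum>i\<in>UNIV. h i b *\<^sub>R cf (g b) (lam i (g b))) a u"
    by (subst differential_cong[OF C T k_eq]) simp_all
  also have "\<dots> = (\<Sum>i\<in>UNIV. dfun C (\<lambda>b. h i b *\<^sub>R cf (g b) (lam i (g b))) a u)"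
    by (rule dfun_sum[OF C T smooth_fun_scaleR[OF C T(1) h' mg]])
  also have "\<dots> = (\<Sum>i\<in>UNIV. dfun C (h i) a u *\<^sub>R cf (g a) (lam i (g a)))"
    by (rule sum.cong[OF refl]) (simp add: dfun_bounded_bilinear[OF C T h' mg bounded_bilinear_scaleR] mg0)
  finally have "fr (g a) (dfun C k a u) = (\<Sum>i\<in>UNIV. dfun C (h i) a u *\<^sub>R fr (g a) (cf (g a) (lam i (g a))))"
    by (simp add: linear_sum[OF fr_linear[OF ga(1)]] linear_scale[OF fr_linear[OF ga(1)]])
  then show "v = fr (g a) (dfun C k a u)" by (simp add: v fr_cf[OF ga(1) lamv[OF ga(2)]])
qed

text \<open>The section \<open>fr (p z) (l z)\<close> inverts the exponential map. For any other
  such section \<open>la\<close>, the coordinates \<open>cf (p b) (la b)\<close> are again a lift of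
  the identity, so they have the same differential as \<open>l\<close>.\<close>

lemma vert_split_eq:
  assumes lc: "local_coord W l" and z: "z \<in> W"
  shows "vert_split B z w = fr (p z) (dfun Z l z w)"
  unfolding vert_split_def
proof (rule the_equality)
  note l = local_coordD[OF lc]
  have p': "smooth_map Z M W p" by (rule smooth_map_subset[OF p_smooth subset_UNIV])
  have "(\<lambda>z. fr (p z) (l z)) \<in> sections (vert_pullback B Z p) W"
    using fr_fields_along[OF Z_atlas l(1) p' l(5,2)] fr_vert l(3) by (auto simp: vert_pullback_def comp_def)
  moreover have "fiber_exp B (p z') (fr (p z') (l z')) = z'" if "z' \<in> W" for z'
    by (simp add: fiber_exp_fr[OF l(3)[OF that]] l(4)[OF that])
  moreover have "fr (p z) (dfun Z l z w) = pull_conn B Z p z w (\<lambda>z. fr (p z) (l z))"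
    by (rule pull_conn_fr[OF Z_atlas l(1) z p' l(5,2), symmetric]) simp
  ultimately show "\<exists>W la. open W \<and> z \<in> W \<and> la \<in> sections (vert_pullback B Z p) W \<and>
     (\<forall>z'\<in>W. fiber_exp B (p z') (la z') = z') \<and> fr (p z) (dfun Z l z w) = pull_conn B Z p z w la"
    using l(1) z by blast
next
  note l = local_coordD[OF lc]
  fix v assume "\<exists>W la. open W \<and> z \<in> W \<and> la \<in> sections (vert_pullback B Z p) W \<and>
     (\<forall>z'\<in>W. fiber_exp B (p z') (la z') = z') \<and> v = pull_conn B Z p z w la"
  then obtain W' la where W': "open W'" "z \<in> W'" and la: "la \<in> sections (vert_pullback B Z p) W'"
    and ex: "\<And>z'. z' \<in> W' \<Longrightarrow> fiber_exp B (p z') (la z') = z'" and v: "v = pull_conn B Z p z w la" by auto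
  let ?T = "W \<inter> W'"
  have T: "open ?T" "z \<in> ?T" using W' l z by auto
  have pT: "smooth_map Z M ?T p" "p ` ?T \<subseteq> U" using smooth_map_subset[OF p_smooth subset_UNIV] l(5) by auto
  have lav: "la b \<in> vert B (p b)" if "b \<in> ?T" for b using la that by (auto simp: vert_pullback_def)
  have "la \<in> fields_along Z Z (\<lambda>b. s0 (p b)) W'" using la by (simp add: vert_pullback_def comp_def)
  then have "la \<in> fields_along Z Z (\<lambda>b. s0 (p b)) ?T" by (rule fields_along_subset) simp
  from cf_smooth[OF Z_atlas T(1) pT this lav]
  have k: "smooth_fun Z ?T (\<lambda>b. cf (p b) (la b))" by simp
  have l': "smooth_fun Z ?T l" by (rule smooth_map_subset[OF l(2)]) simp
  have "v = fr (p z) (dfun Z (\<lambda>b. cf (p b) (la b)) z w)"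
    unfolding v by (rule pull_conn_fr[OF Z_atlas T pT k]) (use l(3) lav fr_cf in auto)
  also have "dfun Z (\<lambda>b. cf (p b) (la b)) z w = dfun Z l z w"
  proof (rule dfun_lift_unique[OF Z_atlas T _ k l'])
    fix b assume b: "b \<in> ?T"
    then show pb: "p b \<in> U" using l(3) by auto
    have "\<psi> (p b) (cf (p b) (la b)) = fiber_exp B (p b) (fr (p b) (cf (p b) (la b)))"
      by (rule fiber_exp_fr[OF pb, symmetric])
    also have "\<dots> = b" using fr_cf[OF pb lav[OF b]] ex b by simp
    finally show "\<psi> (p b) (cf (p b) (la b)) = \<psi> (p b) (l b)" using l(4) b by simp
  qed
  finally show "v = fr (p z) (dfun Z l z w)" .
qed

text \<open>The kernel of the splitting is the kernel of \<open>dl\<close>, on which the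
  decomposition of a vector leaves only the \<open>Hd\<close> term.\<close>

lemma horiz_lift_eq:
  assumes lc: "local_coord W l" and z: "z \<in> W"
  shows "horiz_lift B z u = Hd (p z) (l z) u"
  unfolding horiz_lift_def vert_split_eq[OF lc z]
proof (rule the_equality)
  note l = local_coordD[OF lc]
  have pz: "p z \<in> U" "\<psi> (p z) (l z) = z" using l(3,4)[OF z] by auto
  show "differential Z M p z (Hd (p z) (l z) u) = u \<and> fr (p z) (dfun Z l z (Hd (p z) (l z) u)) = 0"
    using dp_Hd[OF pz(1), of "l z" u] dl_Hd[OF lc pz(1), of "l z" u] z by (simp add: pz linear_0[OF fr_linear[OF pz(1)]])
  fix w assume w: "differential Z M p z w = u \<and> fr (p z) (dfun Z l z w) = 0"
  then have "dfun Z l z w = 0" using fr_inj[OF pz(1), of "dfun Z l z w" 0] by (simp add: linear_0[OF fr_linear[OF pz(1)]])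
  with Hd_Vd_decompose[OF lc z, of w] w show "w = Hd (p z) (l z) u"
    by (simp add: linear_0[OF Vd_linear[OF pz(1)]])
qed

end

section \<open>The isomorphism with the pulled-back bundle\<close>

lemma orthogonal_comp_iff: "v \<in> S\<^sup>\<bottom> \<longleftrightarrow> (\<forall>w\<in>S. w \<bullet> v = 0)"
  by (simp add: orthogonal_comp_def orthogonal_def)

text \<open>The Moore-Penrose inverse \<open>(A\<^sup>T A)\<^sup>-\<^sup>1 A\<^sup>T\<close>.\<close>
lemma linear_inj_pseudo_inverse:
  fixes A :: "'a::euclidean_space \<Rightarrow> 'b::euclidean_space"
  assumes A: "linear A" and inj: "inj A"
  shows "\<exists>Q. linear Q \<and> (\<forall>y. Q (A y) = y) \<and> (\<forall>v\<in>(range A)\<^sup>\<bottom>. Q v = 0) \<and> (\<forall>v. v - A (Q v) \<in> (range A)\<^sup>\<bottom>)"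
proof -
  let ?T = "adjoint A"
  have T: "linear ?T" by (rule adjoint_linear[OF A])
  have N: "linear (\<lambda>y. ?T (A y))" using linear_compose[OF A T] by (simp add: comp_def)
  have "inj (\<lambda>y. ?T (A y))"
  proof (subst linear_injective_0[OF N], intro allI impI)
    fix y assume "?T (A y) = 0"
    then have "A y \<bullet> A y = 0" using adjoint_works[OF A, of y "A y"] by simp
    then have "A y = A 0" by (simp add: linear_0[OF A])
    then show "y = 0" using inj by (simp add: inj_eq)
  qed
  then obtain g where g: "linear g" "\<forall>y. g (?T (A y)) = y" "\<forall>y. ?T (A (g y)) = y"
    using linear_injective_isomorphism[OF N] by blast
  have "linear (\<lambda>v. g (?T v))" using linear_compose[OF T g(1)] by (simp add: comp_def)
  moreover have "g (?T v) = 0" if v: "v \<in> (range A)\<^sup>\<bottom>" for v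
  proof -
    have "y \<bullet> ?T v = 0" for y using v by (simp add: adjoint_works[OF A] orthogonal_comp_iff)
    then have "?T v = 0" by (metis inner_eq_zero_iff)
    then show ?thesis by (simp add: linear_0[OF g(1)])
  qed
  moreover have "v - A (g (?T v)) \<in> (range A)\<^sup>\<bottom>" for v
  proof -
    have "A y \<bullet> (v - A (g (?T v))) = 0" for y
      by (simp add: inner_diff_right flip: adjoint_works[OF A]) (simp add: g(3))
    then show ?thesis by (auto simp: orthogonal_comp_iff)
  qed
  ultimately show ?thesis using g(2) by (intro exI[of _ "\<lambda>v. g (?T v)"]) simp
qed

text \<open>Elements of \<open>dual_space S\<close> vanish on the orthogonal complement, so once
  every vector splits along \<open>S\<close> and its complement they are determined on
  \<open>S\<close>, and the description in \<open>to_dual\<close> has a unique solution.\<close>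

lemma to_dual_eqI:
  assumes \<theta>: "\<theta> \<in> dual_space S" and f: "\<And>v. v \<in> S \<Longrightarrow> blinfun_apply \<theta> v = f v"
    and split: "\<And>v. \<exists>w\<in>S. v - w \<in> S\<^sup>\<bottom>"
  shows "to_dual S f = \<theta>"
  unfolding to_dual_def
proof (rule the_equality)
  show "\<theta> \<in> dual_space S \<and> (\<forall>v\<in>S. blinfun_apply \<theta> v = f v)" using \<theta> f by blast
next
  fix g assume g: "g \<in> dual_space S \<and> (\<forall>v\<in>S. blinfun_apply g v = f v)"
  show "g = \<theta>"
  proof (rule blinfun_eqI)
    fix v
    obtain w where w: "w \<in> S" "v - w \<in> S\<^sup>\<bottom>" using split by blast
    have "blinfun_apply g (v - w) = 0" "blinfun_apply \<theta> (v - w) = 0"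
      using g \<theta> w(2) by (auto simp: dual_space_def)
    with g f[OF w(1)] w(1) show "blinfun_apply g v = blinfun_apply \<theta> v" by (simp add: blinfun.diff_right)
  qed
qed

lemma inner_vec_axis_expand:
  fixes c :: "real ^ 'n"
  assumes "linear (f :: real ^ 'n \<Rightarrow> real)"
  shows "(\<chi> i. f (axis i 1)) \<bullet> c = f c"
proof -
  have "f c = f (\<Sum>i\<in>UNIV. (c $ i) *\<^sub>R axis i 1)"
    using basis_expansion[of c] by (simp add: scalar_mult_eq_scaleR)
  then show ?thesis by (simp add: linear_sum[OF assms] linear_scale[OF assms] inner_vec_def mult.commute)
qed

lemma incl_V_linear: "linear incl_V"
  by (rule linearI) (auto simp: incl_V_def blinfun.add_left blinfun.scaleR_left intro!: blinfun_eqI)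

lemma incl_T_linear: "linear incl_T"
  by (rule linearI) (auto simp: incl_T_def blinfun.add_left blinfun.scaleR_left intro!: blinfun_eqI)

context torus_triv
begin

section \<open>The dual frame and coordinates on the generalized fibre\<close>

lemma range_fr: "x \<in> U \<Longrightarrow> range (fr x) = vert B x"
  using fr_vert fr_cf by (metis (no_types, lifting) image_subset_iff rangeI subsetI subset_antisym)

text \<open>A linear retraction onto the fibre coordinates which vanishes on the orthogonal complement of
  the fibre, as required of elements of \<open>dual_space\<close>.\<close>
definition Q where
  "Q x = (SOME q. linear q \<and> (\<forall>y. q (fr x y) = y) \<and> (\<forall>v\<in>(vert B x)\<^sup>\<bottom>. q v = 0) \<and> (\<forall>v. v - fr x (q v) \<in> (vert B x)\<^sup>\<bottom>))"

lemma
  assumes x: "x \<in> U"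
  shows Q_linear: "linear (Q x)" and Q_fr: "Q x (fr x y) = y"
    and Q_orth: "v \<in> (vert B x)\<^sup>\<bottom> \<Longrightarrow> Q x v = 0" and Q_split: "v - fr x (Q x v) \<in> (vert B x)\<^sup>\<bottom>"
proof -
  have "inj (fr x)" using fr_inj[OF x] by (meson injI)
  from someI_ex[OF linear_inj_pseudo_inverse[OF fr_linear[OF x] this]]
  show "linear (Q x)" "Q x (fr x y) = y" "v \<in> (vert B x)\<^sup>\<bottom> \<Longrightarrow> Q x v = 0" "v - fr x (Q x v) \<in> (vert B x)\<^sup>\<bottom>"
    unfolding range_fr[OF x] Q_def by blast+
qed

lemma Q_cf: "x \<in> U \<Longrightarrow> v \<in> vert B x \<Longrightarrow> Q x v = cf x v"
  using Q_fr[of x "cf x v"] fr_cf[of x v] by simp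

text \<open>The covector with components \<open>g\<close> in the frame dual to \<open>fr\<close>,
  extended by zero to the orthogonal complement of the fibre through \<open>Q\<close>.\<close>

definition \<tau> where "\<tau> x g = Blinfun (\<lambda>v. g \<bullet> Q x v)"

lemma \<tau>_apply:
  assumes x: "x \<in> U"
  shows "blinfun_apply (\<tau> x g) v = g \<bullet> Q x v"
proof -
  have "linear (\<lambda>v. g \<bullet> Q x v)"
    using linear_compose[OF Q_linear[OF x] bounded_linear.linear[OF bounded_linear_inner_right[of g]]] by (simp add: comp_def)
  then show ?thesis by (simp add: \<tau>_def bounded_linear_Blinfun_apply linear_linear)
qed

lemma \<tau>_dual: "x \<in> U \<Longrightarrow> \<tau> x g \<in> dual_space (vert B x)"
  by (simp add: dual_space_def \<tau>_apply Q_orth)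

lemma \<tau>_fr: "x \<in> U \<Longrightarrow> blinfun_apply (\<tau> x g) (fr x y) = g \<bullet> y"
  by (simp add: \<tau>_apply Q_fr)

lemma dual_eq_\<tau>:
  assumes x: "x \<in> U" and t: "t \<in> dual_space (vert B x)"
  shows "t = \<tau> x (\<chi> i. blinfun_apply t (fr x (axis i 1)))"
proof (rule blinfun_eqI)
  fix v
  have "linear (\<lambda>y. blinfun_apply t (fr x y))"
    using linear_compose[OF fr_linear[OF x] bounded_linear.linear[OF blinfun.bounded_linear_right[of t]]] by (simp add: comp_def)
  from inner_vec_axis_expand[OF this, of "Q x v"]
  have "blinfun_apply (\<tau> x (\<chi> i. blinfun_apply t (fr x (axis i 1)))) v = blinfun_apply t (fr x (Q x v))"
    by (simp add: \<tau>_apply[OF x])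
  moreover have "blinfun_apply t (v - fr x (Q x v)) = 0" using t Q_split[OF x] by (simp add: dual_space_def)
  ultimately show "blinfun_apply t v = blinfun_apply (\<tau> x (\<chi> i. blinfun_apply t (fr x (axis i 1)))) v"
    by (simp add: blinfun.diff_right)
qed

lemma gen_fiber_vert_bundle:
  "gen_fiber (vert_bundle B) x = vert B x \<times> dual_space (vert B x)"
  by (simp add: gen_fiber_def vert_bundle_def vert_pullback_def)

lemma fiber_vert_tangent_bundle: "fiber (vert_tangent_bundle B) x = vert B x \<times> UNIV"
  by (simp add: vert_tangent_bundle_def whitney_sum_def vert_bundle_def vert_pullback_def)

lemma gen_fiber_vert_bundle_cases:
  assumes x: "x \<in> U" and "a \<in> gen_fiber (vert_bundle B) x"
  obtains c g where "a = (fr x c, \<tau> x g)"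
proof -
  have a: "fst a \<in> vert B x" "snd a \<in> dual_space (vert B x)" using assms(2) by (auto simp: gen_fiber_vert_bundle)
  have "a = (fr x (cf x (fst a)), \<tau> x (\<chi> i. blinfun_apply (snd a) (fr x (axis i 1))))"
    using fr_cf[OF x a(1)] dual_eq_\<tau>[OF x a(2)] by (simp add: prod_eq_iff)
  then show thesis by (rule that)
qed

lemma orth_vert_times_UNIV: "(v, u) \<in> (vert B x \<times> (UNIV :: 'f set))\<^sup>\<bottom> \<longleftrightarrow> v \<in> (vert B x)\<^sup>\<bottom> \<and> u = 0" if "x \<in> U"
proof
  assume o: "(v, u) \<in> (vert B x \<times> (UNIV :: 'f set))\<^sup>\<bottom>"
  then have o': "\<forall>w\<in>vert B x \<times> UNIV. w \<bullet> (v, u) = 0" by (simp only: orthogonal_comp_iff)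
  have 0: "0 \<in> vert B x" using fr_vert[OF that, of 0] by (simp add: linear_0[OF fr_linear[OF that]])
  have "w \<bullet> v = 0" if "w \<in> vert B x" for w
    using bspec[OF o', of "(w, 0)"] that by simp
  moreover have "u \<bullet> u = 0"
    using bspec[OF o', of "(0, u)"] 0 by simp
  ultimately show "v \<in> (vert B x)\<^sup>\<bottom> \<and> u = 0" by (simp add: orthogonal_comp_iff)
qed (auto simp: orthogonal_comp_iff)

lemma incl_gen_fiber:
  assumes x: "x \<in> U"
  shows "incl_V (fr x c, \<tau> x g) + incl_T a \<in> gen_fiber (vert_tangent_bundle B) x"
proof -
  have "blinfun_apply (snd (incl_V (fr x c, \<tau> x g) + incl_T a)) q = 0" if "q \<in> (vert B x \<times> (UNIV :: 'f set))\<^sup>\<bottom>" for q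
    using that by (cases q) (simp add: orth_vert_times_UNIV[OF x] incl_V_def incl_T_def case_prod_beta blinfun.add_left
        \<tau>_apply[OF x] Q_orth[OF x])
  moreover have "fst (incl_V (fr x c, \<tau> x g) + incl_T a) \<in> vert B x \<times> UNIV"
    by (simp add: incl_V_def incl_T_def case_prod_beta fr_vert[OF x])
  ultimately show ?thesis
    unfolding gen_fiber_def fiber_vert_tangent_bundle by (simp add: mem_Times_iff dual_space_def)
qed

text \<open>Makes the triple of \<open>c\<close>, \<open>g\<close> and \<open>a\<close> injective
  coordinates, which is what computing the inverse of \<open>iso_F\<close> requires. The covector
  part is separated by testing on vectors of the form \<open>(fr x y, 0)\<close> and
  \<open>(0, u)\<close>.\<close>

lemma incl_eq_iff:
  assumes x: "x \<in> U"
  shows "incl_V (fr x c, \<tau> x g) + incl_T a = incl_V (fr x c', \<tau> x g') + incl_T a' \<longleftrightarrow> c = c' \<and> g = g' \<and> a = a'"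
    (is "?l = ?r \<longleftrightarrow> _")
proof
  assume eq: "?l = ?r"
  then have "fst ?l = fst ?r" by simp
  then have 1: "fr x c = fr x c'" "fst a = fst a'" by (simp_all add: incl_V_def incl_T_def case_prod_beta)
  have s: "blinfun_apply (snd ?l) q = blinfun_apply (snd ?r) q" for q using eq by simp
  have "g \<bullet> Q x v + blinfun_apply (snd a) u = g' \<bullet> Q x v + blinfun_apply (snd a') u" for v u
    using s[of "(v, u)"] by (simp add: incl_V_def incl_T_def case_prod_beta blinfun.add_left \<tau>_apply[OF x])
  from this[of "fr x _" 0] this[of 0] have "g \<bullet> y = g' \<bullet> y" "blinfun_apply (snd a) u = blinfun_apply (snd a') u" for y u
    by (simp_all add: Q_fr[OF x] linear_0[OF Q_linear[OF x]])
  then have "g = g'" "snd a = snd a'" using vector_eq_rdot[of g g'] by (blast, auto intro: blinfun_eqI)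
  with 1 show "c = c' \<and> g = g' \<and> a = a'" using fr_inj[OF x] by (auto simp: prod_eq_iff)
qed simp

end

locale torus_coord = torus_triv B U \<psi>
  for B :: "('m::{t2_space, second_countable_topology}, 'f::euclidean_space,
             'z::{t2_space, second_countable_topology}, 'e::euclidean_space, 'n::finite) torus_bundle" and U \<psi> +
  fixes W :: "'z set" and l :: "'z \<Rightarrow> real ^ 'n"
  assumes lc: "local_coord W l"
begin

lemma
  shows W_open: "open W" and l_smooth: "smooth_fun Z W l"
    and p_W: "z \<in> W \<Longrightarrow> p z \<in> U" and \<psi>_l: "z \<in> W \<Longrightarrow> \<psi> (p z) (l z) = z"
  using local_coordD[OF lc] by auto

abbreviation dp where "dp z \<equiv> differential Z M p z"
abbreviation dl where "dl z \<equiv> dfun Z l z"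
abbreviation Vz where "Vz z \<equiv> Vd (p z) (l z)"
abbreviation Hz where "Hz z \<equiv> Hd (p z) (l z)"

lemma
  assumes z: "z \<in> W"
  shows dp_Vz [simp]: "dp z (Vz z c) = 0" and dp_Hz [simp]: "dp z (Hz z u) = u"
    and dl_Vz [simp]: "dl z (Vz z c) = c" and dl_Hz [simp]: "dl z (Hz z u) = 0"
  using dp_Vd[OF p_W[OF z], of "l z" c] dp_Hd[OF p_W[OF z], of "l z" u]
    dl_Vd[OF lc p_W[OF z], of "l z" c] dl_Hd[OF lc p_W[OF z], of "l z" u] z
  by (simp_all add: \<psi>_l[OF z])

lemma
  assumes z: "z \<in> W"
  shows dp_linear: "linear (dp z)" and dl_linear: "linear (dl z)"
    and Vz_linear: "linear (Vz z)" and Hz_linear: "linear (Hz z)"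
  using differential_linear[OF Z_atlas M_atlas open_UNIV UNIV_I p_smooth]
    differential_linear[OF Z_atlas smooth_atlas_euclidean W_open z l_smooth]
    Vd_linear[OF p_W[OF z]] Hd_linear[OF p_W[OF z]] by blast+

lemma Hz_Vz_decompose: "z \<in> W \<Longrightarrow> Hz z (dp z v) + Vz z (dl z v) = v"
  by (rule Hd_Vd_decompose[OF lc])

lemma vector_eqI:
  assumes "z \<in> W" "dl z v = dl z w" "dp z v = dp z w"
  shows "v = w"
  using Hz_Vz_decompose[OF assms(1), of v] unfolding assms(2,3) Hz_Vz_decompose[OF assms(1)] by (rule sym)

lemma covector_eqI:
  assumes "z \<in> W" "\<And>c. blinfun_apply \<xi> (Vz z c) = blinfun_apply \<eta> (Vz z c)" "\<And>u. blinfun_apply \<xi> (Hz z u) = blinfun_apply \<eta> (Hz z u)"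
  shows "\<xi> = \<eta>"
proof (rule blinfun_eqI)
  fix v
  have "blinfun_apply \<xi> (Hz z (dp z v) + Vz z (dl z v)) = blinfun_apply \<eta> (Hz z (dp z v) + Vz z (dl z v))"
    by (simp add: blinfun.add_right assms)
  then show "blinfun_apply \<xi> v = blinfun_apply \<eta> v" by (simp only: Hz_Vz_decompose[OF assms(1)])
qed

text \<open>The element of \<open>T\<^sub>Z \<oplus> T\<^sub>Z\<^sup>\<or>\<close> which \<open>iso_F\<close> maps to
  \<open>(fr c, fst a, \<tau> g, snd a)\<close>.\<close>
definition lift where
  "lift z c g a = (Vz z c + Hz z (fst a), Blinfun (\<lambda>w. g \<bullet> dl z w + blinfun_apply (snd a) (dp z w)))"

lemma fst_lift: "fst (lift z c g a) = Vz z c + Hz z (fst a)"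
  by (simp add: lift_def)

lemma snd_lift:
  assumes z: "z \<in> W"
  shows "blinfun_apply (snd (lift z c g a)) w = g \<bullet> dl z w + blinfun_apply (snd a) (dp z w)"
proof -
  have "linear (\<lambda>w. g \<bullet> dl z w)"
    using linear_compose[OF dl_linear[OF z] bounded_linear.linear[OF bounded_linear_inner_right[of g]]] by (simp add: comp_def)
  moreover have "linear (\<lambda>w. blinfun_apply (snd a) (dp z w))"
    using linear_compose[OF dp_linear[OF z] bounded_linear.linear[OF blinfun.bounded_linear_right[of "snd a"]]] by (simp add: comp_def)
  ultimately have "linear (\<lambda>w. g \<bullet> dl z w + blinfun_apply (snd a) (dp z w))" by (rule linear_compose_add)
  then show ?thesis by (simp add: lift_def bounded_linear_Blinfun_apply linear_linear)
qed

lemma lift_add: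
  assumes z: "z \<in> W"
  shows "lift z c g a + lift z c' g' a' = lift z (c + c') (g + g') (a + a')"
proof (rule prod_eqI)
  show "fst (lift z c g a + lift z c' g' a') = fst (lift z (c + c') (g + g') (a + a'))"
    by (simp add: fst_lift linear_add[OF Vz_linear[OF z]] linear_add[OF Hz_linear[OF z]])
  show "snd (lift z c g a + lift z c' g' a') = snd (lift z (c + c') (g + g') (a + a'))"
    by (rule blinfun_eqI) (simp add: snd_lift[OF z] blinfun.add_left inner_add_left)
qed

lemma lift_scaleR:
  assumes z: "z \<in> W"
  shows "r *\<^sub>R lift z c g a = lift z (r *\<^sub>R c) (r *\<^sub>R g) (r *\<^sub>R a)"
proof (rule prod_eqI)
  show "fst (r *\<^sub>R lift z c g a) = fst (lift z (r *\<^sub>R c) (r *\<^sub>R g) (r *\<^sub>R a))"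
    by (simp add: fst_lift linear_scale[OF Vz_linear[OF z]] linear_scale[OF Hz_linear[OF z]] scaleR_add_right)
  show "snd (r *\<^sub>R lift z c g a) = snd (lift z (r *\<^sub>R c) (r *\<^sub>R g) (r *\<^sub>R a))"
    by (rule blinfun_eqI) (simp add: snd_lift[OF z] blinfun.scaleR_left distrib_left)
qed

lemma lift_zero: "z \<in> W \<Longrightarrow> lift z 0 0 0 = 0"
  using lift_scaleR[of z 0 0 0 0] by simp

text \<open>Carries the vanishing of a bracket on \<open>Z\<close> back to \<open>M\<close>.\<close>

lemma lift_eq_0_iff:
  assumes z: "z \<in> W"
  shows "lift z 0 0 a = 0 \<longleftrightarrow> a = 0"
proof
  assume 0: "lift z 0 0 a = 0"
  have "fst a = dp z (fst (lift z 0 0 a))"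
    using z by (simp add: fst_lift linear_add[OF dp_linear[OF z]])
  then have "fst a = 0" by (simp add: 0 linear_0[OF dp_linear[OF z]])
  moreover have "snd a = 0"
    by (rule blinfun_eqI) (use snd_lift[OF z, of 0 0 a "Hz z _"] z in \<open>simp add: 0\<close>)
  ultimately show "a = 0" by (simp add: prod_eq_iff)
qed (simp add: lift_zero[OF z])

text \<open>Together with \<open>dl z (fst e)\<close> and \<open>base_part\<close>, the components
  that invert \<open>lift\<close>; see \<open>lift_decompose\<close>.\<close>

definition dual_coeff where "dual_coeff z e = (\<chi> i. blinfun_apply (snd e) (Vz z (axis i 1)))"
definition base_part where "base_part z e = (dp z (fst e), Blinfun (\<lambda>u. blinfun_apply (snd e) (Hz z u)))"

lemma dual_coeff_inner:
  assumes z: "z \<in> W"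
  shows "dual_coeff z e \<bullet> c = blinfun_apply (snd e) (Vz z c)"
proof -
  have "linear (\<lambda>c. blinfun_apply (snd e) (Vz z c))"
    using linear_compose[OF Vz_linear[OF z] bounded_linear.linear[OF blinfun.bounded_linear_right[of "snd e"]]] by (simp add: comp_def)
  then show ?thesis unfolding dual_coeff_def by (rule inner_vec_axis_expand)
qed

lemma lift_decompose:
  assumes z: "z \<in> W"
  shows "lift z (dl z (fst e)) (dual_coeff z e) (base_part z e) = e"
proof (rule prod_eqI)
  show "fst (lift z (dl z (fst e)) (dual_coeff z e) (base_part z e)) = fst e"
    using Hz_Vz_decompose[OF z, of "fst e"] by (simp add: fst_lift base_part_def add.commute)
  have "linear (\<lambda>u. blinfun_apply (snd e) (Hz z u))"
    using linear_compose[OF Hz_linear[OF z] bounded_linear.linear[OF blinfun.bounded_linear_right[of "snd e"]]] by (simp add: comp_def)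
  then have b: "blinfun_apply (snd (base_part z e)) u = blinfun_apply (snd e) (Hz z u)" for u
    by (simp add: base_part_def bounded_linear_Blinfun_apply linear_linear)
  show "snd (lift z (dl z (fst e)) (dual_coeff z e) (base_part z e)) = snd e"
    by (rule covector_eqI[OF z]) (use z in \<open>simp_all add: snd_lift b dual_coeff_inner\<close>)
qed

text \<open>In coordinates the three maps inside \<open>iso_F\<close> are known: the splitting is
  \<open>fr\<close> of \<open>dl\<close>, \<open>j\<close> sends \<open>v\<close> to
  \<open>Vz\<close> of its coordinates, and \<open>\<alpha>\<close> is \<open>Hz\<close>. Pulling
  the form \<open>g dl\<close> plus a form from the base back along \<open>j\<close> and
  \<open>\<alpha>\<close> therefore returns its two summands.\<close>

lemma iso_F_lift:
  assumes z: "z \<in> W"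
  shows "iso_F B z (lift z c g a) = incl_V (fr (p z) c, \<tau> (p z) g) + incl_T a"
proof -
  let ?x = "p z"
  have x: "?x \<in> U" by (rule p_W[OF z])
  let ?S = "vert B ?x \<times> (UNIV :: 'f set)"
  let ?i = "incl_V (fr ?x c, \<tau> ?x g) + incl_T a"
  have d: "dl z (fst (lift z c g a)) = c" "dp z (fst (lift z c g a)) = fst a"
    using z by (simp_all add: fst_lift linear_add[OF dp_linear[OF z]] linear_add[OF dl_linear[OF z]])
  have "to_dual ?S (\<lambda>(v, u). blinfun_apply (snd (lift z c g a)) (vert_incl B z v)
      + blinfun_apply (snd (lift z c g a)) (horiz_lift B z u)) = snd ?i"
  proof (rule to_dual_eqI)
    show "snd ?i \<in> dual_space ?S"
      using incl_gen_fiber[OF x, of c g a] by (simp add: gen_fiber_def fiber_vert_tangent_bundle mem_Times_iff)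
  next
    fix q assume "q \<in> ?S"
    then obtain v u where q: "q = (v, u)" "v \<in> vert B ?x" by auto
    have v: "vert_incl B z v = Vz z (cf ?x v)"
      using vert_incl_fr[OF x, of "l z" "cf ?x v"] by (simp add: \<psi>_l[OF z] fr_cf[OF x q(2)])
    show "blinfun_apply (snd ?i) q = (case q of (v, u) \<Rightarrow> blinfun_apply (snd (lift z c g a)) (vert_incl B z v)
        + blinfun_apply (snd (lift z c g a)) (horiz_lift B z u))"
      using z by (simp add: q v horiz_lift_eq[OF lc z] snd_lift incl_V_def incl_T_def case_prod_beta blinfun.add_left
          \<tau>_apply[OF x] Q_cf[OF x q(2)])
  next
    fix q :: "'e \<times> 'f"
    show "\<exists>w\<in>?S. q - w \<in> ?S\<^sup>\<bottom>"
      by (rule bexI[of _ "(fr ?x (Q ?x (fst q)), snd q)"], cases q)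
         (simp_all add: orth_vert_times_UNIV[OF x] Q_split[OF x] fr_vert[OF x])
  qed
  moreover have "fst ?i = (fr ?x c, fst a)" by (simp add: incl_V_def incl_T_def case_prod_beta)
  ultimately show ?thesis
    unfolding iso_F_def fiber_vert_tangent_bundle case_prod_beta[of _ "lift z c g a"] vert_split_eq[OF lc z] d
    by (simp add: prod_eq_iff)
qed

text \<open>\<open>iso_F B z\<close> is injective, but its range lies in the fibre and may be
  smaller than the type. \<open>inv\<close> is therefore evaluated only at points exhibited as
  images of lifts.\<close>

lemma inv_iso_F:
  assumes z: "z \<in> W"
  shows "inv (iso_F B z) (incl_V (fr (p z) c, \<tau> (p z) g) + incl_T a) = lift z c g a"
proof (rule inv_f_eq)
  show "inj (iso_F B z)"
  proof (rule injI)
    fix e e' assume eq: "iso_F B z e = iso_F B z e'"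
    note d = lift_decompose[OF z, of e] lift_decompose[OF z, of e']
    have "iso_F B z (lift z (dl z (fst e)) (dual_coeff z e) (base_part z e)) =
      iso_F B z (lift z (dl z (fst e')) (dual_coeff z e') (base_part z e'))" by (simp only: d eq)
    then have "dl z (fst e) = dl z (fst e') \<and> dual_coeff z e = dual_coeff z e' \<and> base_part z e = base_part z e'"
      by (simp only: iso_F_lift[OF z] incl_eq_iff[OF p_W[OF z]])
    then show "e = e'" using d by metis
  qed
  show "iso_F B z (lift z c g a) = incl_V (fr (p z) c, \<tau> (p z) g) + incl_T a" by (rule iso_F_lift[OF z])
qed

end

section \<open>The Courant bracket of lifted sections\<close>

text \<open>A smooth one-form is only known to pair smoothly with fields on its own manifold. A
  field along \<open>g\<close> is expanded in coordinate fields there, with smooth coefficients on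
  the source.\<close>

lemma one_forms_along_smooth:
  assumes A: "smooth_atlas A" and C: "smooth_atlas C" and T: "open T" and U: "open U"
    and \<eta>: "\<eta> \<in> one_forms A T" and g: "smooth_map C A U g" and sub: "g ` U \<subseteq> T"
    and X: "X \<in> fields_along C A g U"
  shows "smooth_fun C U (\<lambda>x. blinfun_apply (\<eta> (g x)) (X x))"
proof (rule smooth_map_local[OF C smooth_atlas_euclidean])
  fix x assume x: "x \<in> U"
  obtain D \<phi> where c: "(D, \<phi>) \<in> A" "g x \<in> D" using chart_exists[OF A] .
  let ?N = "U \<inter> g -` D"
  let ?e = "\<lambda>b y. blinfun_apply (\<eta> y) (chart_field A (D, \<phi>) b y)"
  have N: "open ?N" by (rule open_Int_vimage[OF smooth_map_continuous[OF g] U chart_open[OF A c(1)]])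
  have o: "open (D \<inter> T)" by (rule open_Int[OF chart_open[OF A c(1)] T])
  have e: "smooth_fun A (D \<inter> T) (?e b)" for b
    by (rule one_formsD[OF \<eta> o _ fields_along_subset[OF chart_field_smooth[OF A c(1)]]]) simp_all
  have eg: "smooth_fun C ?N (\<lambda>x. ?e b (g x))" for b
    by (rule smooth_map_compose[OF C A smooth_atlas_euclidean N o smooth_map_subset[OF g] e]) (use sub in auto)
  have s: "smooth_fun C ?N (\<lambda>x. \<Sum>b\<in>Basis. (dfun A \<phi> (g x) (X x) \<bullet> b) *\<^sub>R ?e b (g x))"
    by (intro smooth_fun_sum[OF C N] smooth_fun_scaleR[OF C N] eg
        smooth_fun_bounded_linear[OF C N bounded_linear_inner_left fields_alongD[OF X c(1)]])
  have "(\<Sum>b\<in>Basis. (dfun A \<phi> (g x) (X x) \<bullet> b) *\<^sub>R ?e b (g x)) = blinfun_apply (\<eta> (g x)) (X x)" if "x \<in> ?N" for x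
  proof -
    have gx: "g x \<in> D" using that by simp
    have "linear (\<lambda>w. ?e w (g x))"
      using linear_compose[OF chart_field_linear[OF A c(1) gx] bounded_linear.linear[OF blinfun.bounded_linear_right[of "\<eta> (g x)"]]]
      by (simp add: comp_def)
    from linear_basis_expand[OF this, of "dfun A \<phi> (g x) (X x)"] show ?thesis
      by (simp add: chart_field_dfun[OF A c(1) gx])
  qed
  then have "smooth_fun C ?N (\<lambda>x. blinfun_apply (\<eta> (g x)) (X x))"
    by (rule smooth_map_cong[OF C N smooth_atlas_euclidean s])
  with N x c(2) show "\<exists>N. open N \<and> x \<in> N \<and> smooth_fun C N (\<lambda>x. blinfun_apply (\<eta> (g x)) (X x))" by blast
qed

lemma courant_zero_right:
  assumes A: "smooth_atlas A" and U: "open U" "z \<in> U" and a: "a \<in> gen_fields A U"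
  shows "courant A a (\<lambda>x. 0) z = 0"
proof -
  have z: "smooth_fun A U (\<lambda>x. 0 :: real)" by (rule smooth_fun_const[OF A U(1)])
  have "d_fun A (\<lambda>x. 0) z = 0" by (rule blinfun_eqI) (simp add: d_fun_apply[OF A U z] dfun_const)
  with courant_scaleR_right[OF A U a a z] show ?thesis by (simp add: dfun_const flip: zero_prod_def)
qed

lemma courant_zero_left:
  assumes A: "smooth_atlas A" and U: "open U" "z \<in> U" and a: "a \<in> gen_fields A U"
  shows "courant A (\<lambda>x. 0) a z = 0"
  using courant_skew[OF A U gen_fields_zero[OF A U(1)] a] courant_zero_right[OF A U a] by simp

context torus_coord
begin

lemma pull_fun_smooth:
  assumes T: "open T" and f: "smooth_fun M T f"
  shows "smooth_fun Z (W \<inter> p -` T) (\<lambda>x. f (p x))"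
  by (rule smooth_map_compose[OF Z_atlas M_atlas smooth_atlas_euclidean _ T smooth_map_subset[OF p_smooth subset_UNIV] f])
     (use open_Int_vimage[OF smooth_map_continuous[OF smooth_map_subset[OF p_smooth subset_UNIV]] W_open T] in auto)

lemma pull_open: "open T \<Longrightarrow> open (W \<inter> p -` T)"
  by (rule open_Int_vimage[OF smooth_map_continuous[OF smooth_map_subset[OF p_smooth subset_UNIV]] W_open])

lemma dfun_pull:
  assumes T: "open T" "p z \<in> T" and f: "smooth_fun M T f"
  shows "dfun Z (\<lambda>x. f (p x)) z v = dfun M f (p z) (dp z v)"
  by (rule differential_compose[OF Z_atlas M_atlas smooth_atlas_euclidean open_UNIV UNIV_I p_smooth T f])

definition hv where "hv c a z = Vz z c + Hz z (a (p z))"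

lemma hv_fields:
  assumes T: "open T" and a: "a \<in> vector_fields M T"
  shows "hv c a \<in> vector_fields Z (W \<inter> p -` T)"
proof -
  let ?N = "W \<inter> p -` T"
  note N = pull_open[OF T]
  have pN: "smooth_map Z M ?N p" by (rule smooth_map_subset[OF p_smooth subset_UNIV])
  have lN: "smooth_fun Z ?N l" by (rule smooth_map_subset[OF l_smooth]) simp
  have sub: "p ` ?N \<subseteq> U" using p_W by auto
  have "continuous_on T id" by (simp add: id_def)
  from fields_along_compose[OF M_atlas M_atlas Z_atlas T N this a pN]
  have w: "(\<lambda>z. a (p z)) \<in> fields_along Z M p ?N" by auto
  have s: "(\<lambda>t. Hd (p t) (l t) (a (p t)) + Vd (p t) (l t) c) \<in> fields_along Z Z (\<lambda>t. \<psi> (p t) (l t)) ?N"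
    by (rule HV_fields_along[OF Z_atlas N pN lN sub w smooth_fun_const[OF Z_atlas N]])
  show ?thesis
    by (rule fields_along_cong[OF Z_atlas Z_atlas smooth_map_continuous[OF \<psi>_smooth[OF Z_atlas N pN lN sub]] N s])
       (auto simp: hv_def \<psi>_l add.commute)
qed

lemma dl_hv: "z \<in> W \<Longrightarrow> dl z (hv c a z) = c"
  by (simp add: hv_def linear_add[OF dl_linear])

lemma dp_hv: "z \<in> W \<Longrightarrow> dp z (hv c a z) = a (p z)"
  by (simp add: hv_def linear_add[OF dp_linear])

text \<open>\<open>dl\<close> takes constant values on both fields, so the bracket annihilates
  \<open>l\<close> and is horizontal. For the base part, both fields are \<open>p\<close>-related to
  fields on \<open>M\<close>, hence so is their bracket; this is tested on coordinate functions
  pulled back by \<open>p\<close>.\<close>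

lemma lie_bracket_hv:
  assumes T: "open T" and z: "z \<in> W" "p z \<in> T" and a: "a \<in> vector_fields M T" and b: "b \<in> vector_fields M T"
  shows "lie_bracket Z (hv c a) (hv c' b) z = Hz z (lie_bracket M a b (p z))"
proof (rule vector_eqI[OF z(1)])
  let ?X = "hv c a" and ?Y = "hv c' b"
  let ?N = "W \<inter> p -` T"
  have N: "open ?N" "z \<in> ?N" using pull_open[OF T] z by auto
  have X: "?X \<in> vector_fields Z ?N" and Y: "?Y \<in> vector_fields Z ?N" by (intro hv_fields T a b)+
  have lN: "smooth_fun Z ?N l" by (rule smooth_map_subset[OF l_smooth]) simp
  have cst: "dfun Z (\<lambda>x. dl x (hv k e x)) z = dfun Z (\<lambda>x. k) z" for k e
    by (rule differential_cong[OF Z_atlas N]) (simp add: dl_hv)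
  show "dl z (lie_bracket Z ?X ?Y z) = dl z (Hz z (lie_bracket M a b (p z)))"
    unfolding lie_bracket_dfun[OF Z_atlas N X Y lN] cst using z by (simp add: dfun_const)
  show "dp z (lie_bracket Z ?X ?Y z) = dp z (Hz z (lie_bracket M a b (p z)))"
    unfolding dp_Hz[OF z(1)]
  proof (rule tangent_eqI[OF M_atlas])
    fix D \<kappa> assume k: "(D, \<kappa>) \<in> M" "p z \<in> D"
    let ?D = "T \<inter> D"
    have D: "open ?D" "p z \<in> ?D" using open_Int[OF T chart_open[OF M_atlas k(1)]] k z by auto
    have \<kappa>: "smooth_fun M ?D \<kappa>" by (rule smooth_map_subset[OF smooth_fun_chart[OF M_atlas k(1)]]) simp
    have aD: "a \<in> vector_fields M ?D" and bD: "b \<in> vector_fields M ?D"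
      using a b by (auto intro: fields_along_subset)
    let ?N' = "W \<inter> p -` ?D"
    have N': "open ?N'" "z \<in> ?N'" using pull_open[OF D(1)] z k by auto
    have X': "?X \<in> vector_fields Z ?N'" and Y': "?Y \<in> vector_fields Z ?N'" by (intro hv_fields D aD bD)+
    have \<kappa>p: "smooth_fun Z ?N' (\<lambda>x. \<kappa> (p x))" by (rule pull_fun_smooth[OF D(1) \<kappa>])
    have step: "dfun Z (\<lambda>x. dfun Z (\<lambda>x. \<kappa> (p x)) x (hv k e x)) z v = dfun M (\<lambda>x. dfun M \<kappa> x (e x)) (p z) (dp z v)"
      if e: "e \<in> vector_fields M ?D" for k e v
    proof -
      have "dfun Z (\<lambda>x. dfun Z (\<lambda>x. \<kappa> (p x)) x (hv k e x)) z v = dfun Z (\<lambda>x. dfun M \<kappa> (p x) (e (p x))) z v"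
        by (subst differential_cong[OF Z_atlas N']) (auto simp: dfun_pull[OF D(1) _ \<kappa>] dp_hv)
      also have "\<dots> = dfun M (\<lambda>x. dfun M \<kappa> x (e x)) (p z) (dp z v)"
        by (rule dfun_pull[OF D smooth_fun_dfun[OF M_atlas D(1) e \<kappa>]])
      finally show ?thesis .
    qed
    have "dfun M \<kappa> (p z) (dp z (lie_bracket Z ?X ?Y z)) = dfun Z (\<lambda>x. \<kappa> (p x)) z (lie_bracket Z ?X ?Y z)"
      by (rule dfun_pull[OF D \<kappa>, symmetric])
    also have "\<dots> = dfun M \<kappa> (p z) (lie_bracket M a b (p z))"
      unfolding lie_bracket_dfun[OF Z_atlas N' X' Y' \<kappa>p] lie_bracket_dfun[OF M_atlas D aD bD \<kappa>] step[OF aD] step[OF bD]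
        dp_hv[OF z(1)] ..
    finally show "dfun M \<kappa> (p z) (dp z (lie_bracket Z ?X ?Y z)) = dfun M \<kappa> (p z) (lie_bracket M a b (p z))" .
  qed
qed

definition lift_field where "lift_field c g a z = lift z c g (a (p z))"

lemma fst_lift_field: "fst (lift_field c g a z) = hv c (\<lambda>x. fst (a x)) z"
  by (simp add: lift_field_def fst_lift hv_def)

lemma lift_field_smooth:
  assumes T: "open T" and a: "a \<in> gen_fields M T"
  shows "lift_field c g a \<in> gen_fields Z (W \<inter> p -` T)"
  unfolding gen_fields_iff fst_lift_field
proof
  show "hv c (\<lambda>x. fst (a x)) \<in> vector_fields Z (W \<inter> p -` T)" by (rule hv_fields[OF T gen_fieldsD(1)[OF a]])
  show "(\<lambda>z. snd (lift_field c g a z)) \<in> one_forms Z (W \<inter> p -` T)"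
  proof (rule one_formsI)
    fix V Y assume V: "open V" "V \<subseteq> W \<inter> p -` T" and Y: "Y \<in> vector_fields Z V"
    have lV: "smooth_fun Z V l" by (rule smooth_map_subset[OF l_smooth]) (use V in auto)
    have pV: "smooth_map Z M V p" by (rule smooth_map_subset[OF p_smooth subset_UNIV])
    have pT: "p ` V \<subseteq> T" using V by auto
    have "(\<lambda>x. differential Z M p (id x) (Y x)) \<in> fields_along Z M (\<lambda>x. p (id x)) V"
      by (rule fields_along_differential[OF Z_atlas Z_atlas M_atlas V(1) V(1) _ Y pV])
         (use smooth_map_id[OF Z_atlas, of V] in \<open>simp_all add: id_def\<close>)
    then have dY: "(\<lambda>x. dp x (Y x)) \<in> fields_along Z M p V" by simp
    have s: "smooth_fun Z V (\<lambda>x. g \<bullet> dl x (Y x) + blinfun_apply (snd (a (p x))) (dp x (Y x)))"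
      by (intro smooth_fun_add[OF Z_atlas V(1)] one_forms_along_smooth[OF M_atlas Z_atlas T V(1) gen_fieldsD(2)[OF a] pV pT dY]
          smooth_fun_bounded_linear[OF Z_atlas V(1) bounded_linear_inner_right] smooth_fun_dfun[OF Z_atlas V(1) Y lV])
    show "smooth_fun Z V (\<lambda>x. blinfun_apply (snd (lift_field c g a x)) (Y x))"
      by (rule smooth_map_cong[OF Z_atlas V(1) smooth_atlas_euclidean s]) (use V in \<open>auto simp: lift_field_def snd_lift\<close>)
  qed
qed

text \<open>For the covector part, the test vector is extended to a field of the same lifted kind,
  so that every function to be differentiated is a constant plus a pull-back from
  \<open>M\<close>.\<close>

lemma courant_lift_field:
  assumes T: "open T" and z: "z \<in> W" "p z \<in> T" and a: "a \<in> gen_fields M T" and b: "b \<in> gen_fields M T"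
  shows "courant Z (lift_field c g a) (lift_field c' g' b) z = lift z 0 0 (courant M a b (p z))"
proof (rule prod_eqI)
  show "fst (courant Z (lift_field c g a) (lift_field c' g' b) z) = fst (lift z 0 0 (courant M a b (p z)))"
    unfolding fst_courant fst_lift_field
    by (simp add: lie_bracket_hv[OF T z gen_fieldsD(1)[OF a] gen_fieldsD(1)[OF b]] fst_lift fst_courant linear_0[OF Vz_linear[OF z(1)]])
  show "snd (courant Z (lift_field c g a) (lift_field c' g' b) z) = snd (lift z 0 0 (courant M a b (p z)))"
  proof (rule blinfun_eqI)
    fix v
    obtain D \<kappa> where ch: "chart_at M (p z) = (D, \<kappa>)" by (cases "chart_at M (p z)")
    note k = chart_at_props[OF M_atlas ch]
    let ?D = "T \<inter> D"
    have D: "open ?D" "p z \<in> ?D" using open_Int[OF T chart_open[OF M_atlas k(1)]] k z by auto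
    \<comment> \<open>Extends \<open>dp z v\<close> to a field on the base; with the constant fibre
      part \<open>dl z v\<close>, the lifted field \<open>?V\<close> takes the arbitrary value
      \<open>v\<close> at \<open>z\<close>.\<close>
    define w where "w = chart_field M (D, \<kappa>) (dp z v)"
    have wz: "w (p z) = dp z v" by (simp add: w_def chart_field_chart_at[OF M_atlas ch])
    have w: "w \<in> vector_fields M ?D"
      unfolding w_def by (rule fields_along_subset[OF chart_field_smooth[OF M_atlas k(1)]]) simp
    have aD: "a \<in> gen_fields M ?D" and bD: "b \<in> gen_fields M ?D" using a b by (auto intro: gen_fields_subset)
    let ?N = "W \<inter> p -` ?D"
    have N: "open ?N" "z \<in> ?N" using pull_open[OF D(1)] z k by auto
    have A: "lift_field c g a \<in> gen_fields Z ?N" and B: "lift_field c' g' b \<in> gen_fields Z ?N"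
      by (intro lift_field_smooth D aD bD)+
    let ?V = "hv (dl z v) w"
    have V: "?V \<in> vector_fields Z ?N" by (rule hv_fields[OF D(1) w])
    have Vz: "?V z = v" using Hz_Vz_decompose[OF z(1), of v] by (simp add: hv_def wz add.commute)
    have fz: "dp z (fst (lift_field k h e z)) = fst (e (p z))" for k h e
      by (simp add: fst_lift_field dp_hv[OF z(1)])
    have 1: "dfun Z (\<lambda>x. blinfun_apply (snd (lift_field k h e x)) (?V x)) z u
        = dfun M (\<lambda>x. blinfun_apply (snd (e x)) (w x)) (p z) (dp z u)"
      if e: "e \<in> gen_fields M ?D" for k h e u
    proof -
      have ew: "smooth_fun M ?D (\<lambda>x. blinfun_apply (snd (e x)) (w x))"
        by (rule one_formsD[OF gen_fieldsD(2)[OF e] D(1) _ w]) simp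
      have "dfun Z (\<lambda>x. blinfun_apply (snd (lift_field k h e x)) (?V x)) z u
          = dfun Z (\<lambda>x. h \<bullet> dl z v + blinfun_apply (snd (e (p x))) (w (p x))) z u"
        by (subst differential_cong[OF Z_atlas N]) (auto simp: lift_field_def snd_lift dl_hv dp_hv)
      also have "\<dots> = dfun Z (\<lambda>x. blinfun_apply (snd (e (p x))) (w (p x))) z u"
        by (simp add: dfun_add[OF Z_atlas N smooth_fun_const[OF Z_atlas N(1)] pull_fun_smooth[OF D(1) ew]] dfun_const)
      also have "\<dots> = dfun M (\<lambda>x. blinfun_apply (snd (e x)) (w x)) (p z) (dp z u)" by (rule dfun_pull[OF D ew])
      finally show ?thesis .
    qed
    have 2: "blinfun_apply (snd (lift_field k h e z)) (lie_bracket Z (\<lambda>x. fst (lift_field k' h' e' x)) ?V z)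
        = blinfun_apply (snd (e (p z))) (lie_bracket M (\<lambda>x. fst (e' x)) w (p z))"
      if e': "e' \<in> gen_fields M ?D" for k h e k' h' e'
      unfolding fst_lift_field lie_bracket_hv[OF D(1) z(1) D(2) gen_fieldsD(1)[OF e'] w]
      using z(1) by (simp add: lift_field_def snd_lift)
    have 3: "dfun Z (\<lambda>x. blinfun_apply (snd (lift_field c g a x)) (fst (lift_field c' g' b x))
          - blinfun_apply (snd (lift_field c' g' b x)) (fst (lift_field c g a x))) z u
        = dfun M (\<lambda>x. blinfun_apply (snd (a x)) (fst (b x)) - blinfun_apply (snd (b x)) (fst (a x))) (p z) (dp z u)" for u
    proof -
      let ?h = "\<lambda>x. blinfun_apply (snd (a x)) (fst (b x)) - blinfun_apply (snd (b x)) (fst (a x))"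
      have h: "smooth_fun M ?D ?h" by (rule gen_fields_contraction_diff_smooth[OF M_atlas D(1) aD bD])
      have "dfun Z (\<lambda>x. blinfun_apply (snd (lift_field c g a x)) (fst (lift_field c' g' b x))
          - blinfun_apply (snd (lift_field c' g' b x)) (fst (lift_field c g a x))) z u
          = dfun Z (\<lambda>x. (g \<bullet> c' - g' \<bullet> c) + ?h (p x)) z u"
        by (subst differential_cong[OF Z_atlas N])
           (auto simp: fst_lift_field dl_hv dp_hv algebra_simps, auto simp: lift_field_def snd_lift dl_hv dp_hv)
      also have "\<dots> = dfun Z (\<lambda>x. ?h (p x)) z u"
        by (simp add: dfun_add[OF Z_atlas N smooth_fun_const[OF Z_atlas N(1)] pull_fun_smooth[OF D(1) h]] dfun_const)
      also have "\<dots> = dfun M ?h (p z) (dp z u)" by (rule dfun_pull[OF D h])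
      finally show ?thesis .
    qed
    have "blinfun_apply (snd (courant Z (lift_field c g a) (lift_field c' g' b) z)) (?V z) = blinfun_apply (snd (courant M a b (p z))) (w (p z))"
      unfolding snd_courant_apply[OF Z_atlas N A B V] snd_courant_apply[OF M_atlas D aD bD w]
        1[OF aD] 1[OF bD] 2[OF aD] 2[OF bD] 3 fz
      by (simp add: Vz wz)
    then show "blinfun_apply (snd (courant Z (lift_field c g a) (lift_field c' g' b) z)) v
        = blinfun_apply (snd (lift z 0 0 (courant M a b (p z)))) v"
      by (simp add: Vz wz snd_lift[OF z(1)])
  qed
qed

end

section \<open>Semi-flat structures\<close>

lemma locally_constant_of_dfun_zero:
  assumes A: "smooth_atlas A" and T: "open T" "x \<in> T" and f: "smooth_fun A T f"
    and 0: "\<And>x v. x \<in> T \<Longrightarrow> dfun A f x v = 0"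
  shows "\<exists>N. open N \<and> x \<in> N \<and> N \<subseteq> T \<and> (\<forall>y\<in>N. f y = f x)"
proof -
  obtain D \<phi> where c: "(D, \<phi>) \<in> A" "x \<in> D" using chart_exists[OF A] .
  let ?S = "\<phi> ` (D \<inter> T)" and ?F = "\<lambda>y. f (inv_into D \<phi> y)"
  have S: "open ?S" "\<phi> x \<in> ?S" using chart_image_Int_open[OF A c(1) T(1)] c T by auto
  \<comment> \<open>A ball inside the chart image is convex, as the constancy theorem
    requires.\<close>
  then obtain r where r: "r > 0" "ball (\<phi> x) r \<subseteq> ?S" using openE by blast
  have F: "smooth_on ?S ?F" by (rule smooth_funD[OF A T(1) f c(1)])
  have F0: "(?F has_derivative (\<lambda>v. 0)) (at y)" if y: "y \<in> ?S" for y
  proof -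
    obtain z where z: "y = \<phi> z" "z \<in> D" "z \<in> T" using y by auto
    have "frechet_derivative ?F (at y) w = 0" for w
      using dfun_in_chart[OF A c(1) T(1) f z(2,3), of "chart_field A (D, \<phi>) w z"] 0[OF z(3)]
      by (simp add: z(1) dfun_chart_field[OF A c(1) z(2)])
    then have "frechet_derivative ?F (at y) = (\<lambda>w. 0)" by (rule ext)
    with has_derivative_frechet[OF smooth_on_imp_differentiable[OF F y]] show ?thesis by simp
  qed
  have "\<exists>k. \<forall>y\<in>ball (\<phi> x) r. ?F y = k"
    by (rule has_derivative_zero_constant[OF convex_ball]) (use r(2) F0 in \<open>blast intro: has_derivative_at_withinI\<close>)
  then obtain k where k: "\<forall>y\<in>ball (\<phi> x) r. ?F y = k" ..
  have fk: "f y = k" if "y \<in> D" "\<phi> y \<in> ball (\<phi> x) r" for y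
    using k that chart_inv[OF A c(1)] by metis
  have "open (D \<inter> \<phi> -` ball (\<phi> x) r)"
    by (rule open_Int_vimage[OF chart_continuous[OF A c(1)] chart_open[OF A c(1)] open_ball])
  then show ?thesis
    using T r(1) c(2) fk by (intro exI[of _ "T \<inter> (D \<inter> \<phi> -` ball (\<phi> x) r)"]) auto
qed

lemma incl_T_inj:
  fixes a b :: "'f::euclidean_space \<times> ('f \<Rightarrow>\<^sub>L real)"
  assumes eq: "(incl_T a :: ('e::euclidean_space \<times> 'f) \<times> (('e \<times> 'f) \<Rightarrow>\<^sub>L real)) = incl_T b"
  shows "a = b"
proof (rule prod_eqI)
  show "fst a = fst b" using arg_cong[OF eq, of "\<lambda>q. snd (fst q)"] by (simp add: incl_T_def case_prod_beta)
  show "snd a = snd b"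
    by (rule blinfun_eqI)
       (use arg_cong[OF eq, of "\<lambda>q. blinfun_apply (snd q) (0, _)"] in \<open>simp add: incl_T_def case_prod_beta\<close>)
qed

context torus_triv
begin

section \<open>Flat sections of the vertical bundle and of its dual\<close>

lemma conn_fr:
  assumes T: "open T" "x \<in> T" "T \<subseteq> U" and k: "smooth_fun M T k" and \<sigma>: "\<And>y. y \<in> T \<Longrightarrow> \<sigma> y = fr y (k y)"
  shows "conn B x u \<sigma> = fr x (dfun M k x u)"
  unfolding conn_def
  using pull_conn_fr[OF M_atlas T(1,2), of id k \<sigma> u] smooth_map_id[OF M_atlas, of T] T(3) k \<sigma>
  by (simp add: id_def)

lemma section_fr_cf:
  assumes T: "open T" "T \<subseteq> U" and \<sigma>: "\<sigma> \<in> sections (vert_bundle B) T"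
  shows "smooth_fun M T (\<lambda>x. cf x (\<sigma> x))" "\<And>x. x \<in> T \<Longrightarrow> \<sigma> x = fr x (cf x (\<sigma> x))"
  using cf_section_smooth[OF T \<sigma>] fr_cf T(2) \<sigma> unfolding sections_vert_bundle by auto

lemma fr_flat: "(\<lambda>x. fr x c) \<in> flat_sections B U"
  using fr_section[OF U_open subset_refl smooth_fun_const[OF M_atlas U_open]]
    conn_fr[OF U_open _ subset_refl smooth_fun_const[OF M_atlas U_open], of _ "\<lambda>x. fr x c" c]
  by (simp add: flat_sections_def dfun_const linear_0[OF fr_linear])

lemma \<tau>_section: "(\<lambda>x. \<tau> x g) \<in> dual_sections M (vert_bundle B) U"
  unfolding dual_sections_def
proof (simp, intro conjI ballI allI impI)
  fix x assume "x \<in> U"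
  then show "\<tau> x g \<in> dual_space (fiber (vert_bundle B) x)"
    using \<tau>_dual by (simp add: vert_bundle_def vert_pullback_def)
next
  fix T \<sigma> assume "open T \<and> T \<subseteq> U \<and> \<sigma> \<in> sections (vert_bundle B) T"
  then have T: "open T" "T \<subseteq> U" and \<sigma>: "\<sigma> \<in> sections (vert_bundle B) T" by auto
  note s = section_fr_cf[OF T \<sigma>]
  have "smooth_fun M T (\<lambda>x. g \<bullet> cf x (\<sigma> x))"
    by (rule smooth_fun_bounded_linear[OF M_atlas T(1) bounded_linear_inner_right s(1)])
  then show "smooth_fun M T (\<lambda>x. blinfun_apply (\<tau> x g) (\<sigma> x))"
  proof (rule smooth_map_cong[OF M_atlas T(1) smooth_atlas_euclidean])
    fix x assume x: "x \<in> T"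
    then have xU: "x \<in> U" using T by auto
    have "blinfun_apply (\<tau> x g) (\<sigma> x) = blinfun_apply (\<tau> x g) (fr x (cf x (\<sigma> x)))" using s(2)[OF x] by simp
    then show "g \<bullet> cf x (\<sigma> x) = blinfun_apply (\<tau> x g) (\<sigma> x)" by (simp add: \<tau>_fr[OF xU])
  qed
qed

text \<open>Both sides of the dual Leibniz rule equal \<open>g\<close> paired with the differential
  of the flat coordinates of the section.\<close>

lemma \<tau>_flat: "(\<lambda>x. \<tau> x g) \<in> flat_dual_sections B U"
  unfolding flat_dual_sections_def
proof (simp add: \<tau>_section, intro allI impI ballI)
  fix T \<sigma> x u assume "open T \<and> T \<subseteq> U \<and> \<sigma> \<in> sections (vert_bundle B) T" and x: "x \<in> T"
  then have T: "open T" "T \<subseteq> U" and \<sigma>: "\<sigma> \<in> sections (vert_bundle B) T" by auto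
  note s = section_fr_cf[OF T \<sigma>]
  have xU: "x \<in> U" using T x by auto
  have "blinfun_apply (\<tau> y g) (\<sigma> y) = g \<bullet> cf y (\<sigma> y)" if y: "y \<in> T" for y
  proof -
    have yU: "y \<in> U" using T y by auto
    have "blinfun_apply (\<tau> y g) (\<sigma> y) = blinfun_apply (\<tau> y g) (fr y (cf y (\<sigma> y)))" using s(2)[OF y] by simp
    then show ?thesis by (simp add: \<tau>_fr[OF yU])
  qed
  then have "dfun M (\<lambda>y. blinfun_apply (\<tau> y g) (\<sigma> y)) x u = dfun M (\<lambda>y. g \<bullet> cf y (\<sigma> y)) x u"
    by (subst differential_cong[OF M_atlas T(1) x]) simp_all
  also have "\<dots> = g \<bullet> dfun M (\<lambda>y. cf y (\<sigma> y)) x u"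
    by (rule dfun_bounded_linear[OF M_atlas T(1) x s(1) bounded_linear_inner_right])
  also have "\<dots> = blinfun_apply (\<tau> x g) (conn B x u \<sigma>)"
    by (simp add: conn_fr[OF T(1) x T(2) s] \<tau>_fr[OF xU])
  finally show "dfun M (\<lambda>y. blinfun_apply (\<tau> y g) (\<sigma> y)) x u = blinfun_apply (\<tau> x g) (conn B x u \<sigma>)" .
qed

text \<open>The connection differentiates the coordinates \<open>cf\<close>, so flatness makes their
  differential vanish.\<close>

lemma flat_section_locally_constant:
  assumes T: "open T" "x \<in> T" and x: "x \<in> U" and \<sigma>: "\<sigma> \<in> flat_sections B T"
  shows "\<exists>N c. open N \<and> x \<in> N \<and> N \<subseteq> T \<inter> U \<and> (\<forall>y\<in>N. \<sigma> y = fr y c)"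
proof -
  let ?T = "T \<inter> U"
  have T': "open ?T" "x \<in> ?T" "?T \<subseteq> U" using T x U_open by auto
  have "\<sigma> \<in> sections (vert_bundle B) T" using \<sigma> by (simp add: flat_sections_def)
  then have s: "\<sigma> \<in> sections (vert_bundle B) ?T"
    unfolding sections_vert_bundle using fields_along_subset[of \<sigma> M Z s0 T ?T] by simp
  note c = section_fr_cf[OF T'(1,3) s]
  have "dfun M (\<lambda>y. cf y (\<sigma> y)) y u = 0" if y: "y \<in> ?T" for y u
  proof -
    have yU: "y \<in> U" using y by simp
    have "fr y (dfun M (\<lambda>y. cf y (\<sigma> y)) y u) = conn B y u \<sigma>"
      by (rule conn_fr[OF T'(1) y T'(3) c, symmetric])
    also have "\<dots> = 0" using \<sigma> y by (simp add: flat_sections_def)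
    also have "0 = fr y 0" by (simp add: linear_0[OF fr_linear[OF yU]])
    finally show ?thesis using fr_inj[OF yU] by blast
  qed
  from locally_constant_of_dfun_zero[OF M_atlas T'(1,2) c(1) this]
  obtain N where N: "open N" "x \<in> N" "N \<subseteq> ?T" "\<forall>y\<in>N. cf y (\<sigma> y) = cf x (\<sigma> x)" by auto
  have "\<sigma> y = fr y (cf x (\<sigma> x))" if y: "y \<in> N" for y
  proof -
    have "y \<in> ?T" using N(3) y by auto
    from c(2)[OF this] N(4) y show ?thesis by simp
  qed
  then have "\<forall>y\<in>N. \<sigma> y = fr y (cf x (\<sigma> x))" by (rule ballI)
  then show ?thesis using N(1-3) by blast
qed

text \<open>Flatness is tested on the flat sections \<open>fr y c\<close>: their covariant
  derivative is zero, so the pairings with \<open>t\<close> have zero differential.\<close>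

lemma flat_dual_section_locally_constant:
  assumes T: "open T" "x \<in> T" and x: "x \<in> U" and t: "t \<in> flat_dual_sections B T"
  shows "\<exists>N g. open N \<and> x \<in> N \<and> N \<subseteq> T \<inter> U \<and> (\<forall>y\<in>N. t y = \<tau> y g)"
proof -
  let ?T = "T \<inter> U"
  have T': "open ?T" "x \<in> ?T" "?T \<subseteq> U" using T x U_open by auto
  have fs: "(\<lambda>y. fr y c) \<in> sections (vert_bundle B) ?T" for c
    by (rule fr_section[OF T'(1,3) smooth_fun_const[OF M_atlas T'(1)]])
  have td: "t \<in> dual_sections M (vert_bundle B) T" using t by (simp add: flat_dual_sections_def)
  \<comment> \<open>The vector of components of \<open>t\<close>, written as a sum over
    \<open>axis\<close> so that the rules for sums of smooth functions apply.\<close>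
  let ?g = "\<lambda>y. \<Sum>i\<in>UNIV. blinfun_apply (t y) (fr y (axis i 1)) *\<^sub>R axis i (1::real)"
  have ts: "smooth_fun M ?T (\<lambda>y. blinfun_apply (t y) (fr y c))" for c
    using td fs[of c] T' unfolding dual_sections_def by simp
  have sg: "smooth_fun M ?T (\<lambda>y. blinfun_apply (t y) (fr y (axis i 1)) *\<^sub>R axis i (1::real))" for i
    by (rule smooth_fun_bounded_linear[OF M_atlas T'(1) bounded_linear_scaleR_left ts])
  have g: "smooth_fun M ?T ?g" by (rule smooth_fun_sum[OF M_atlas T'(1) sg])
  have "dfun M (\<lambda>y. blinfun_apply (t y) (fr y c)) y u = 0" if y: "y \<in> ?T" for y u c
  proof -
    have "\<forall>U' \<sigma>. open U' \<and> U' \<subseteq> T \<and> \<sigma> \<in> sections (vert_bundle B) U' \<longrightarrow>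
        (\<forall>x\<in>U'. \<forall>u. dfun M (\<lambda>x'. blinfun_apply (t x') (\<sigma> x')) x u - blinfun_apply (t x) (conn B x u \<sigma>) = 0)"
      using t by (simp add: flat_dual_sections_def)
    from this[rule_format, of ?T "\<lambda>y. fr y c" y u]
    have "dfun M (\<lambda>y. blinfun_apply (t y) (fr y c)) y u = blinfun_apply (t y) (conn B y u (\<lambda>y. fr y c))"
      using T'(1) fs[of c] y by simp
    also have "conn B y u (\<lambda>y. fr y c) = 0"
      using fr_flat[of c] y by (simp add: flat_sections_def)
    finally show ?thesis by simp
  qed
  then have "dfun M (\<lambda>y. blinfun_apply (t y) (fr y (axis i 1)) *\<^sub>R axis i (1::real)) y u = 0" if "y \<in> ?T" for i y u
    using that dfun_bounded_linear[OF M_atlas T'(1) that ts bounded_linear_scaleR_left, of "axis i 1" "axis i 1" u] by simp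
  then have "dfun M ?g y u = 0" if "y \<in> ?T" for y u
    using that by (simp add: dfun_sum[OF M_atlas T'(1) that sg])
  from locally_constant_of_dfun_zero[OF M_atlas T'(1,2) g this]
  obtain N where N: "open N" "x \<in> N" "N \<subseteq> ?T" "\<forall>y\<in>N. ?g y = ?g x" by auto
  have vec: "(\<chi> i. h i) = (\<Sum>i\<in>UNIV. h i *\<^sub>R axis i (1::real))" for h :: "'n \<Rightarrow> real"
    using basis_expansion[of "\<chi> i. h i"] by (simp add: scalar_mult_eq_scaleR)
  have "t y = \<tau> y (?g x)" if y: "y \<in> N" for y
  proof -
    have yT: "y \<in> T" "y \<in> U" using N y by auto
    have "t y \<in> dual_space (vert B y)"
      using td yT(1) by (simp add: dual_sections_def vert_bundle_def vert_pullback_def)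
    from dual_eq_\<tau>[OF yT(2) this] have "t y = \<tau> y (?g y)" unfolding vec .
    then show ?thesis using N(4) y by simp
  qed
  then have "\<forall>y\<in>N. t y = \<tau> y (?g x)" by (rule ballI)
  then show ?thesis using N(1-3) by blast
qed

end

locale semi_flat_coord = torus_coord B U \<psi> W l
  for B :: "('m::{t2_space, second_countable_topology}, 'f::euclidean_space,
             'z::{t2_space, second_countable_topology}, 'e::euclidean_space, 'n::finite) torus_bundle" and U \<psi> W l +
  fixes J :: "'z \<Rightarrow> 'e \<times> ('e \<Rightarrow>\<^sub>L real) \<Rightarrow> 'e \<times> ('e \<Rightarrow>\<^sub>L real)"
    and Jb :: "'m \<Rightarrow> ('e \<times> 'f) \<times> (('e \<times> 'f) \<Rightarrow>\<^sub>L real) \<Rightarrow> ('e \<times> 'f) \<times> (('e \<times> 'f) \<Rightarrow>\<^sub>L real)"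
  assumes sf: "semi_flat B J Jb"
begin

lemma
  shows gac_J: "gen_almost_complex Z (tangent_bundle Z) J"
    and gac_Jb: "gen_almost_complex M (vert_tangent_bundle B) Jb"
    and adapted: "adapted B Jb"
    and J_eq: "J z = inv (iso_F B z) \<circ> Jb (p z) \<circ> iso_F B z"
  using sf by (simp_all add: semi_flat_def)

sublocale tangent_gacs Z J
  by unfold_locales (rule Z_atlas, rule gac_J)

text \<open>The section of \<open>\<J>(\<S> \<oplus> \<S>^\<or>)\<close> over \<open>U\<close> with
  constant flat components \<open>c\<close> and \<open>g\<close>; adaptedness is what makes the
  description solvable.\<close>

definition K where "K c g x = (THE a. incl_T a = Jb x (incl_V (fr x c, \<tau> x g)))"

lemma incl_V_fr_gen_fiber: "x \<in> U \<Longrightarrow> incl_V (fr x c, \<tau> x g) \<in> gen_fiber (vert_tangent_bundle B) x"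
  using incl_gen_fiber[of x c g 0] by (simp add: linear_0[OF incl_T_linear])

lemma adapted_image: "Jb x ` incl_V ` gen_fiber (vert_bundle B) x = incl_T ` UNIV"
proof -
  have "gen_fiber (tangent_bundle M) x = UNIV" by (auto simp: gen_fiber_def mem_Times_iff)
  then show ?thesis using adapted unfolding adapted_def by metis
qed

lemma incl_T_K:
  assumes x: "x \<in> U"
  shows "incl_T (K c g x) = Jb x (incl_V (fr x c, \<tau> x g))"
proof -
  have "(fr x c, \<tau> x g) \<in> gen_fiber (vert_bundle B) x"
    by (simp add: gen_fiber_vert_bundle fr_vert[OF x] \<tau>_dual[OF x])
  then have "Jb x (incl_V (fr x c, \<tau> x g)) \<in> incl_T ` UNIV" using adapted_image by blast
  then obtain a where a: "incl_T a = Jb x (incl_V (fr x c, \<tau> x g))" by (metis imageE)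
  have "K c g x = a" unfolding K_def by (rule the_equality, rule a) (simp add: a[symmetric] incl_T_inj)
  with a show ?thesis by simp
qed

lemma incl_T_surj:
  assumes x: "x \<in> U"
  obtains c g where "incl_T t = Jb x (incl_V (fr x c, \<tau> x g))"
proof -
  have "incl_T t \<in> Jb x ` incl_V ` gen_fiber (vert_bundle B) x" using adapted_image by blast
  then obtain v where v: "v \<in> gen_fiber (vert_bundle B) x" "incl_T t = Jb x (incl_V v)" by (metis imageE)
  obtain c g where "v = (fr x c, \<tau> x g)" by (rule gen_fiber_vert_bundle_cases[OF x v(1)])
  with v(2) show thesis using that by simp
qed

lemma incl_V_fr_sections: "(\<lambda>x. incl_V (fr x c, \<tau> x g)) \<in> gen_sections M (vert_tangent_bundle B) U"
proof -
  have 1: "(\<lambda>x. fr x c) \<in> sections (vert_bundle B) U" using fr_flat by (simp add: flat_sections_def)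
  have 2: "(\<lambda>x. 0) \<in> vector_fields M U"
    by (rule fields_along_zero[OF M_atlas M_atlas U_open]) (simp add: id_def)
  have "(\<lambda>x. \<tau> x g o\<^sub>L fst_blinfun) \<in> dual_sections M (vert_tangent_bundle B) U"
    unfolding dual_sections_def
  proof (simp, intro conjI ballI allI impI)
    fix x assume "x \<in> U"
    from incl_V_fr_gen_fiber[OF this] show "\<tau> x g o\<^sub>L fst_blinfun \<in> dual_space (fiber (vert_tangent_bundle B) x)"
      by (simp add: gen_fiber_def incl_V_def)
  next
    fix T \<sigma> assume "open T \<and> T \<subseteq> U \<and> \<sigma> \<in> sections (vert_tangent_bundle B) T"
    then have T: "open T" "T \<subseteq> U" and "(\<lambda>x. fst (\<sigma> x)) \<in> sections (vert_bundle B) T"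
      by (auto simp: vert_tangent_bundle_def whitney_sum_def comp_def)
    then show "smooth_fun M T (\<lambda>x. blinfun_apply (\<tau> x g) (fst (\<sigma> x)))"
      using \<tau>_section[of g] unfolding dual_sections_def by simp
  qed
  with 1 2 show ?thesis
    by (simp add: gen_sections_def comp_def incl_V_def vert_tangent_bundle_def whitney_sum_def)
qed

text \<open>Smoothness of a pointwise description is obtained from \<open>Jb\<close>, which maps
  smooth sections to smooth sections, by reading off the components along
  \<open>T_M\<close>.\<close>

lemma K_smooth: "K c g \<in> gen_fields M U"
proof -
  have "(\<lambda>x. Jb x (incl_V (fr x c, \<tau> x g))) \<in> gen_sections M (vert_tangent_bundle B) U"
    using gac_Jb U_open incl_V_fr_sections[of c g] unfolding gen_almost_complex_def by simp
  then have s: "(\<lambda>x. snd (fst (Jb x (incl_V (fr x c, \<tau> x g))))) \<in> vector_fields M U"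
      "(\<lambda>x. snd (Jb x (incl_V (fr x c, \<tau> x g)))) \<in> dual_sections M (vert_tangent_bundle B) U"
    by (simp_all add: gen_sections_def comp_def vert_tangent_bundle_def whitney_sum_def)
  have K1: "snd (fst (Jb x (incl_V (fr x c, \<tau> x g)))) = fst (K c g x)" if "x \<in> U" for x
    by (simp add: incl_T_K[OF that, symmetric]) (simp add: incl_T_def case_prod_beta)
  have K2: "blinfun_apply (snd (Jb x (incl_V (fr x c, \<tau> x g)))) (0, u) = blinfun_apply (snd (K c g x)) u" if "x \<in> U" for x u
    by (simp add: incl_T_K[OF that, symmetric]) (simp add: incl_T_def case_prod_beta)
  show ?thesis
    unfolding gen_fields_iff
  proof
    show "(\<lambda>x. fst (K c g x)) \<in> vector_fields M U"
      by (rule fields_along_cong[OF M_atlas M_atlas _ U_open s(1)]) (simp_all add: K1 id_def)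
    show "(\<lambda>x. snd (K c g x)) \<in> one_forms M U"
    proof (rule one_formsI)
      fix V X assume V: "open V" "V \<subseteq> U" and X: "X \<in> vector_fields M V"
      \<comment> \<open>A test field on \<open>M\<close> is extended by zero to the sum with the
        vertical bundle; writing zero as \<open>fr x 0\<close> supplies its smoothness.\<close>
      have "(\<lambda>x. fr x 0) \<in> sections (vert_bundle B) V"
        by (rule fr_section[OF V smooth_fun_const[OF M_atlas V(1)]])
      then have "(\<lambda>x. (fr x 0, X x)) \<in> sections (vert_tangent_bundle B) V"
        using X by (simp add: vert_tangent_bundle_def whitney_sum_def comp_def)
      then have sm: "smooth_fun M V (\<lambda>x. blinfun_apply (snd (Jb x (incl_V (fr x c, \<tau> x g)))) (fr x 0, X x))"
        using s(2) V unfolding dual_sections_def by simp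
      show "smooth_fun M V (\<lambda>x. blinfun_apply (snd (K c g x)) (X x))"
      proof (rule smooth_map_cong[OF M_atlas V(1) smooth_atlas_euclidean sm])
        fix x assume "x \<in> V"
        then have x: "x \<in> U" using V by auto
        show "blinfun_apply (snd (Jb x (incl_V (fr x c, \<tau> x g)))) (fr x 0, X x) = blinfun_apply (snd (K c g x)) (X x)"
          by (simp add: linear_0[OF fr_linear[OF x]] K2[OF x])
      qed
    qed
  qed
qed

lemma K_J_flat: "K c g \<in> J_flat_sections B Jb U"
  unfolding J_flat_sections_def
  by (intro CollectI bexI[OF _ fr_flat[of c]] bexI[OF _ \<tau>_flat[of g]] ballI incl_T_K)

text \<open>A flat section over a possibly disconnected set has no single constants
  \<open>c\<close>, \<open>g\<close>. They exist near each point, which suffices because the bracket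
  is local.\<close>

lemma J_flat_sections_locally_K:
  assumes T: "open T" "x \<in> T" and x: "x \<in> U" and a: "a \<in> J_flat_sections B Jb T"
  shows "\<exists>N c g. open N \<and> x \<in> N \<and> N \<subseteq> T \<inter> U \<and> (\<forall>y\<in>N. a y = K c g y)"
proof -
  obtain \<sigma> t where \<sigma>: "\<sigma> \<in> flat_sections B T" and t: "t \<in> flat_dual_sections B T"
    and at: "\<forall>x\<in>T. incl_T (a x) = Jb x (incl_V (\<sigma> x, t x))"
    using a unfolding J_flat_sections_def by blast
  obtain N c where N: "open N" "x \<in> N" "N \<subseteq> T \<inter> U" "\<forall>y\<in>N. \<sigma> y = fr y c"
    using flat_section_locally_constant[OF T x \<sigma>] by blast
  obtain N' g where N': "open N'" "x \<in> N'" "N' \<subseteq> T \<inter> U" "\<forall>y\<in>N'. t y = \<tau> y g"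
    using flat_dual_section_locally_constant[OF T x t] by blast
  have "a y = K c g y" if y: "y \<in> N \<inter> N'" for y
  proof (rule incl_T_inj)
    have "y \<in> T" "y \<in> U" using N(3) y by auto
    then show "incl_T (a y) = (incl_T (K c g y) :: ('e \<times> 'f) \<times> (('e \<times> 'f) \<Rightarrow>\<^sub>L real))"
      using at N(4) N'(4) y by (simp add: incl_T_K)
  qed
  then have "\<forall>y\<in>N \<inter> N'. a y = K c g y" by (rule ballI)
  moreover have "open (N \<inter> N')" "x \<in> N \<inter> N'" "N \<inter> N' \<subseteq> T \<inter> U" using N N' by auto
  ultimately show ?thesis by blast
qed

lemma J_lift_vertical:
  assumes z: "z \<in> W"
  shows "J z (lift z c g 0) = lift z 0 0 (K c g (p z))"
proof -
  have x: "p z \<in> U" by (rule p_W[OF z])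
  have "J z (lift z c g 0) = inv (iso_F B z) (Jb (p z) (incl_V (fr (p z) c, \<tau> (p z) g)))"
    by (simp add: J_eq iso_F_lift[OF z] linear_0[OF incl_T_linear])
  also have "Jb (p z) (incl_V (fr (p z) c, \<tau> (p z) g)) = incl_V (fr (p z) 0, \<tau> (p z) 0) + incl_T (K c g (p z))"
  proof -
    have "\<tau> (p z) 0 = 0" by (rule blinfun_eqI) (simp add: \<tau>_apply[OF x])
    then have "incl_V (fr (p z) 0, \<tau> (p z) 0) = (0 :: ('e \<times> 'f) \<times> (('e \<times> 'f) \<Rightarrow>\<^sub>L real))"
      using linear_0[OF incl_V_linear] by (simp add: linear_0[OF fr_linear[OF x]] zero_prod_def)
    then show ?thesis by (simp add: incl_T_K[OF x])
  qed
  finally show ?thesis by (simp add: inv_iso_F[OF z])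
qed

text \<open>Adaptedness presents \<open>t\<close> as the value of some \<open>K c g\<close>, so its
  lift is already \<open>J\<close> of a vertical element; applying \<open>J\<close> again gives
  minus that element.\<close>

lemma J_lift_horizontal:
  assumes z: "z \<in> W"
  obtains c g where "J z (lift z 0 0 t) = lift z c g 0"
proof -
  have x: "p z \<in> U" by (rule p_W[OF z])
  obtain c g where cg: "incl_T t = Jb (p z) (incl_V (fr (p z) c, \<tau> (p z) g))" by (rule incl_T_surj[OF x])
  then have "t = K c g (p z)" by (simp add: incl_T_K[OF x, symmetric] incl_T_inj)
  then have "J z (lift z 0 0 t) = J z (J z (lift z c g 0))" by (simp add: J_lift_vertical[OF z])
  also have "\<dots> = lift z (- c) (- g) 0"
    using lift_scaleR[OF z, of "-1" c g 0] by (simp add: J_square)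
  finally show thesis by (rule that)
qed

section \<open>Evaluation on the vertical frame and the frame expansion\<close>

definition E where "E c g = lift_field c g (\<lambda>x. 0)"

lemma E_smooth: "E c g \<in> gen_fields Z W"
proof -
  have "W \<inter> p -` U = W" using p_W by auto
  then show ?thesis
    using lift_field_smooth[OF U_open gen_fields_zero[OF M_atlas U_open], of c g] by (simp add: E_def)
qed

text \<open>The base part of \<open>E\<close> is zero and that of \<open>J E\<close> is
  \<open>K\<close>. Since brackets of lifts only see base parts, the three brackets containing an
  undisturbed \<open>E\<close> vanish.\<close>

lemma nijenhuis_E:
  assumes z: "z \<in> W"
  shows "nijenhuis Z J (E c g) (E c' g') z = lift z 0 0 (courant M (K c g) (K c' g') (p z))"
proof -
  have x: "p z \<in> U" by (rule p_W[OF z])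
  note zero = gen_fields_zero[OF M_atlas U_open]
  have JE: "J y (E c g y) = lift_field 0 0 (K c g) y" if "y \<in> W" for y c g
    by (simp add: E_def lift_field_def J_lift_vertical[OF that])
  have 1: "courant Z (\<lambda>y. J y (E c g y)) (\<lambda>y. J y (E c' g' y)) z = lift z 0 0 (courant M (K c g) (K c' g') (p z))"
    by (subst courant_cong[OF Z_atlas W_open z JE JE])
       (simp_all add: courant_lift_field[OF U_open z x K_smooth K_smooth])
  have 2: "courant Z (E c g) (E c' g') z = 0"
    by (simp add: E_def courant_lift_field[OF U_open z x zero zero] courant_zero_right[OF M_atlas U_open x zero] lift_zero[OF z])
  have 3: "courant Z (E c g) (\<lambda>y. J y (E c' g' y)) z = 0"
    by (subst courant_cong[OF Z_atlas W_open z refl JE])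
       (simp_all add: E_def courant_lift_field[OF U_open z x zero K_smooth] courant_zero_left[OF M_atlas U_open x K_smooth] lift_zero[OF z])
  have 4: "courant Z (\<lambda>y. J y (E c g y)) (E c' g') z = 0"
    by (subst courant_cong[OF Z_atlas W_open z JE refl])
       (simp_all add: E_def courant_lift_field[OF U_open z x K_smooth zero] courant_zero_right[OF M_atlas U_open x K_smooth] lift_zero[OF z])
  show ?thesis unfolding nijenhuis_def 1 2 3 4 by (simp add: J_zero)
qed

lemma E_sum:
  assumes z: "z \<in> W"
  shows "(\<Sum>i\<in>Basis. (k \<bullet> i) *\<^sub>R E (fst i) (snd i) z) = lift z (fst k) (snd k) 0"
proof -
  have "linear (\<lambda>k. lift z (fst k) (snd k) 0)"
    by (rule linearI) (simp_all add: lift_add[OF z] lift_scaleR[OF z])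
  from linear_basis_expand[OF this, of k] show ?thesis by (simp add: E_def lift_field_def)
qed

text \<open>The vertical components as one vector of \<open>\<real>^n \<times> \<real>^n\<close>, so
  that \<open>Basis\<close> of this product serves as index set of the frame
  \<open>E\<close>.\<close>

definition frame_coeff where "frame_coeff e z = (dl z (fst (e z)), dual_coeff z (e z))"

lemma frame_coeff_smooth:
  assumes T: "open T" "T \<subseteq> W" and e: "e \<in> gen_fields Z T"
  shows "smooth_fun Z T (frame_coeff e)"
proof -
  have lT: "smooth_fun Z T l" by (rule smooth_map_subset[OF l_smooth T(2)])
  have c1: "smooth_fun Z T (\<lambda>z. dl z (fst (e z)))" by (rule smooth_fun_dfun[OF Z_atlas T(1) gen_fieldsD(1)[OF e] lT])
  have "smooth_fun Z T (\<lambda>z. blinfun_apply (snd (e z)) (Vz z (axis i 1)))" for i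
  proof (rule one_formsD[OF gen_fieldsD(2)[OF e] T(1) subset_refl])
    have "W \<inter> p -` U = W" using p_W by auto
    then have h: "hv (axis i 1) (\<lambda>x. 0) \<in> vector_fields Z W"
      using hv_fields[OF U_open gen_fieldsD(1)[OF gen_fields_zero[OF M_atlas U_open]], of "axis i 1"] by simp
    show "(\<lambda>z. Vz z (axis i 1)) \<in> vector_fields Z T"
      by (rule fields_along_cong[OF Z_atlas Z_atlas _ T(1) fields_along_subset[OF h T(2)]])
         (use T(2) in \<open>auto simp: id_def hv_def linear_0[OF Hz_linear]\<close>)
  qed
  then have sum: "smooth_fun Z T (\<lambda>z. \<Sum>i\<in>UNIV. blinfun_apply (snd (e z)) (Vz z (axis i 1)) *\<^sub>R axis i (1::real))"
    by (intro smooth_fun_sum[OF Z_atlas T(1)] smooth_fun_bounded_linear[OF Z_atlas T(1) bounded_linear_scaleR_left])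
  have expand: "dual_coeff z a = (\<Sum>i\<in>UNIV. blinfun_apply (snd a) (Vz z (axis i 1)) *\<^sub>R axis i (1::real))" for z a
    using basis_expansion[of "dual_coeff z a"] by (simp add: scalar_mult_eq_scaleR dual_coeff_def)
  have c2: "smooth_fun Z T (\<lambda>z. dual_coeff z (e z))" unfolding expand by (rule sum)
  show ?thesis unfolding frame_coeff_def[abs_def] by (rule smooth_fun_Pair[OF Z_atlas T(1) c1 c2])
qed

lemma frame_coeff_lift:
  assumes z: "z \<in> W" and e: "e z = lift z c g 0"
  shows "frame_coeff e z = (c, g)"
proof -
  have "dual_coeff z (lift z c g 0) \<bullet> y = g \<bullet> y" for y
    using z by (simp add: dual_coeff_inner snd_lift)
  then have "dual_coeff z (lift z c g 0) = g" using vector_eq_rdot[of "dual_coeff z (lift z c g 0)" g]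
    by (simp add: inner_commute)
  then show ?thesis using z by (simp add: frame_coeff_def e fst_lift linear_add[OF dl_linear[OF z]])
qed

text \<open>Subtracting the vertical part of \<open>a\<close> leaves a horizontal section, which \<open>J\<close> makes vertical.\<close>
lemma frame_expansion:
  assumes T: "open T" "T \<subseteq> W" and a: "a \<in> gen_fields Z T"
  shows "\<exists>k m. smooth_fun Z T k \<and> smooth_fun Z T m \<and>
    (\<forall>z\<in>T. a z = (\<Sum>i\<in>Basis. (k z \<bullet> i) *\<^sub>R E (fst i) (snd i) z) + J z (\<Sum>i\<in>Basis. (m z \<bullet> i) *\<^sub>R E (fst i) (snd i) z))"
proof -
  let ?v = "\<lambda>k z. \<Sum>i\<in>Basis. (k z \<bullet> i) *\<^sub>R E (fst i) (snd i) z"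
  have v: "?v k \<in> gen_fields Z T" if "smooth_fun Z T k" for k
    by (intro gen_fields_sum[OF Z_atlas T(1)] gen_fields_scaleR[OF Z_atlas T(1)] gen_fields_subset[OF E_smooth T(2)]
        smooth_fun_bounded_linear[OF Z_atlas T(1) bounded_linear_inner_left that])
  have k: "smooth_fun Z T (frame_coeff a)" by (rule frame_coeff_smooth[OF T a])
  let ?r = "\<lambda>z. J z (a z - ?v (frame_coeff a) z)"
  have r: "?r \<in> gen_fields Z T"
    by (rule J_smooth[OF T(1) gen_fields_diff[OF Z_atlas T(1) a v[OF k]]])
  \<comment> \<open>The sign compensates \<open>J_square\<close>: \<open>J\<close> applied to minus
    \<open>?r\<close> returns the horizontal part of \<open>a\<close>.\<close>
  have m: "smooth_fun Z T (\<lambda>z. - frame_coeff ?r z)" by (rule smooth_fun_minus[OF Z_atlas T(1) frame_coeff_smooth[OF T r]])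
  have "a z = ?v (frame_coeff a) z + J z (?v (\<lambda>z. - frame_coeff ?r z) z)" if "z \<in> T" for z
  proof -
    have z: "z \<in> W" using that T by auto
    let ?t = "base_part z (a z)"
    have va: "?v (frame_coeff a) z = lift z (dl z (fst (a z))) (dual_coeff z (a z)) 0"
      by (simp add: E_sum[OF z] frame_coeff_def)
    have eq: "a z = lift z 0 0 ?t + ?v (frame_coeff a) z"
      using lift_decompose[OF z, of "a z"] by (simp add: va lift_add[OF z])
    have h: "a z - ?v (frame_coeff a) z = lift z 0 0 ?t" by (rule diff_eq_eq[THEN iffD2, OF eq])
    obtain c g where cg: "J z (lift z 0 0 ?t) = lift z c g 0" by (rule J_lift_horizontal[OF z])
    have rz: "?r z = lift z c g 0" unfolding h by (rule cg)
    have "?v (\<lambda>z. - frame_coeff ?r z) z = lift z (- c) (- g) 0"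
      unfolding E_sum[OF z] frame_coeff_lift[of z ?r, OF z rz] by simp
    also have "\<dots> = - ?r z" unfolding rz using lift_scaleR[OF z, of "-1" c g 0] by simp
    finally have "J z (?v (\<lambda>z. - frame_coeff ?r z) z) = a z - ?v (frame_coeff a) z"
      by (simp only: J_minus J_square minus_minus)
    then show ?thesis by (simp only: add_diff_cancel_left' add.commute[of _ "_ - _"] diff_add_cancel)
  qed
  with k m show ?thesis by blast
qed

end

theorem theorem1p1:
  fixes B :: "('m::{t2_space, second_countable_topology}, real ^ 'n,
               'z::{t2_space, second_countable_topology}, 'e::euclidean_space, 'n::finite) torus_bundle"
    and J :: "'z \<Rightarrow> 'e \<times> ('e \<Rightarrow>\<^sub>L real) \<Rightarrow> 'e \<times> ('e \<Rightarrow>\<^sub>L real)"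
    and Jb :: "'m \<Rightarrow> ('e \<times> (real ^ 'n)) \<times> (('e \<times> (real ^ 'n)) \<Rightarrow>\<^sub>L real)
                  \<Rightarrow> ('e \<times> (real ^ 'n)) \<times> (('e \<times> (real ^ 'n)) \<Rightarrow>\<^sub>L real)"
  assumes "torus_bundle B"
    and "semi_flat B J Jb"
  shows "integrable_gacs (tot B) J \<longleftrightarrow>
         (\<forall>U. open U \<longrightarrow> (\<forall>a\<in>J_flat_sections B Jb U. \<forall>b\<in>J_flat_sections B Jb U.
            \<forall>x\<in>U. courant (base B) a b x = 0))"
proof -
  interpret torus B by unfold_locales (rule assms(1))
  interpret G: tangent_gacs "tot B" J
    by unfold_locales (use Z_atlas assms(2) in \<open>simp_all add: semi_flat_def\<close>)
  have coords: "\<exists>U \<psi> W l. semi_flat_coord B U \<psi> W l J Jb \<and> z \<in> W" for z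
  proof -
    obtain U \<psi> where t: "(U, \<psi>) \<in> trivs B" "p z \<in> U" by (rule trivs_cover)
    interpret torus_triv B U \<psi> by unfold_locales (rule t)
    obtain W l where W: "open W" "z \<in> W" "smooth_fun Z W l" "\<And>z'. z' \<in> W \<Longrightarrow> p z' \<in> U \<and> \<psi> (p z') (l z') = z'"
      using local_inverse[OF t(2)] by blast
    then have "local_coord W l" by (simp add: local_coord_def)
    then have "semi_flat_coord B U \<psi> W l J Jb" by unfold_locales (use assms(2) in auto)
    with W(2) show ?thesis by blast
  qed
  show ?thesis
  proof (intro iffI allI impI ballI)
    fix T a b x
    assume int: "integrable_gacs (tot B) J" and T: "open T" "x \<in> T"
      and a: "a \<in> J_flat_sections B Jb T" and b: "b \<in> J_flat_sections B Jb T"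
    \<comment> \<open>The zero section supplies a point over \<open>x\<close> at which integrability
      on \<open>Z\<close> can be tested.\<close>
    obtain U \<psi> W l where c: "semi_flat_coord B U \<psi> W l J Jb" "s0 x \<in> W" using coords by blast
    interpret semi_flat_coord B U \<psi> W l J Jb by (rule c)
    \<comment> \<open>Not a clause of \<open>torus_bundle\<close>; it follows from
      \<open>s0 x = \<psi> x 0\<close> in a trivialization around \<open>x\<close>.\<close>
    have "p (s0 x) = x"
    proof -
      obtain U' \<psi>' where t: "(U', \<psi>') \<in> trivs B" "x \<in> U'" by (rule trivs_cover)
      interpret t: torus_triv B U' \<psi>' by unfold_locales (rule t)
      show ?thesis by (rule t.p_s0[OF t(2)])
    qed
    with p_W[OF c(2)] have xU: "x \<in> U" by simp
    obtain N c g where N: "open N" "x \<in> N" "\<forall>y\<in>N. a y = K c g y"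
      using J_flat_sections_locally_K[OF T xU a] by blast
    obtain N' c' g' where N': "open N'" "x \<in> N'" "\<forall>y\<in>N'. b y = K c' g' y"
      using J_flat_sections_locally_K[OF T xU b] by blast
    have "courant M a b x = courant M (K c g) (K c' g') x"
      by (rule courant_cong[OF M_atlas, of "N \<inter> N'"]) (use N N' in auto)
    moreover have "nijenhuis Z J (E c g) (E c' g') (s0 x) = 0"
      using int E_smooth W_open \<open>s0 x \<in> W\<close> unfolding G.integrable_iff_nijenhuis by blast
    ultimately show "courant M a b x = 0"
      using nijenhuis_E[OF \<open>s0 x \<in> W\<close>, of c g c' g'] lift_eq_0_iff[OF \<open>s0 x \<in> W\<close>] \<open>p (s0 x) = x\<close> by simp
  next
    assume flat: "\<forall>U. open U \<longrightarrow> (\<forall>a\<in>J_flat_sections B Jb U. \<forall>b\<in>J_flat_sections B Jb U.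
            \<forall>x\<in>U. courant (base B) a b x = 0)"
    show "integrable_gacs (tot B) J"
      unfolding G.integrable_iff_nijenhuis
    proof (intro allI impI)
      fix T a b z assume T: "open T" "z \<in> T" and a: "a \<in> gen_fields Z T" and b: "b \<in> gen_fields Z T"
      obtain U \<psi> W l where c: "semi_flat_coord B U \<psi> W l J Jb" "z \<in> W" using coords by blast
      interpret semi_flat_coord B U \<psi> W l J Jb by (rule c)
      let ?T = "T \<inter> W"
      have T': "open ?T" "z \<in> ?T" "?T \<subseteq> W" using T c(2) W_open by auto
      have a': "a \<in> gen_fields Z ?T" and b': "b \<in> gen_fields Z ?T" using a b by (auto intro: gen_fields_subset)
      obtain k m where km: "smooth_fun Z ?T k" "smooth_fun Z ?T m" and
        ka: "\<forall>z\<in>?T. a z = (\<Sum>i\<in>Basis. (k z \<bullet> i) *\<^sub>R E (fst i) (snd i) z) + J z (\<Sum>i\<in>Basis. (m z \<bullet> i) *\<^sub>R E (fst i) (snd i) z)"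
        using frame_expansion[OF T'(1,3) a'] by blast
      obtain k' m' where km': "smooth_fun Z ?T k'" "smooth_fun Z ?T m'" and
        kb: "\<forall>z\<in>?T. b z = (\<Sum>i\<in>Basis. (k' z \<bullet> i) *\<^sub>R E (fst i) (snd i) z) + J z (\<Sum>i\<in>Basis. (m' z \<bullet> i) *\<^sub>R E (fst i) (snd i) z)"
        using frame_expansion[OF T'(1,3) b'] by blast
      \<comment> \<open>The coefficients of the frame elements are the coordinates of the
        vector-valued functions \<open>k\<close>, \<open>m\<close>, \<open>k'\<close>,
        \<open>m'\<close>.\<close>
      have s: "\<forall>i\<in>Basis. smooth_fun Z ?T (\<lambda>z. h z \<bullet> i)" if "smooth_fun Z ?T h" for h :: "'z \<Rightarrow> (real ^ 'n) \<times> (real ^ 'n)"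
        using smooth_fun_bounded_linear[OF Z_atlas T'(1) bounded_linear_inner_left that] by blast
      show "nijenhuis Z J a b z = 0"
      proof (rule G.nijenhuis_eq_0_frame[where E = "\<lambda>i. E (fst i) (snd i)", OF T'(1,2) finite_Basis _ _ s[OF km(1)] s[OF km(2)] s[OF km'(1)] s[OF km'(2)]])
        fix i j :: "(real ^ 'n) \<times> (real ^ 'n)"
        show "E (fst i) (snd i) \<in> gen_fields Z ?T" by (rule gen_fields_subset[OF E_smooth T'(3)])
        have "courant M (K (fst i) (snd i)) (K (fst j) (snd j)) (p z) = 0"
          using flat U_open K_J_flat p_W[OF \<open>z \<in> W\<close>] by blast
        then show "nijenhuis Z J (E (fst i) (snd i)) (E (fst j) (snd j)) z = 0"
          by (simp add: nijenhuis_E[OF \<open>z \<in> W\<close>] lift_zero[OF \<open>z \<in> W\<close>])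
      qed (use ka kb in auto)
    qed
  qed
qed

end
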